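(* Let $-1<\alpha<0$ and let $r\ge 1$ be an integer. Let $(G_n^\alpha)_{n\ge 0}$ be the Grosjean polynomials of the first kind, with recurrence coefficients $b_n$ ($n\ge 0$) and $a_n^2$ ($n\ge 1$). Let $b_{-r},b_{-r+1},\ldots,b_{-1}\in\mathbb{R}$ and $a_{-r+1},\ldots,a_{-1},a_0>0$ be arbitrary parameters, let $q_0,\dots,q_r$ be the orthonormal polynomials built from these parameters, and let $p_n^{(-r)}$ ($n\ge 0$) be the orthonormal anti-associated polynomials of order $r$ obtained from the family $(G_n^\alpha)$ and these parameters (all as defined in the context). Then the polynomials $p_n^{(-r)}$ are orthonormal with respect to a probability measure $\mu^{(-r)}$ on $\mathbb{R}$ which is absolutely continuous on $[-1,1]$ with density $$ w_r(x)=\frac{\sin(-\pi\alpha)}{\pi}\,\frac{(1-x)^{\alpha}}{(1+x)^{\alpha+1}}\left|\,q_r(x)-a_0e^{i\alpha\pi}q_{r-1}(x)\frac{(1-x)^\alpha}{(1+x)^{\alpha+1}}\right|^{-2},\qquad -1<x<1 .$$ In addition, outside $[-1,1]$ the measure $\mu^{(-r)}$ consists of at most $2r$ mass points (at most $r$ to the left of $-1$ and at most $r$ to the right of $1$). These mass points are the roots $x\in\mathbb{R}\setminus[-1,1]$ of the equation $$ q_r(x)-a_0\,q_{r-1}(x)\,\operatorname{sign}(x)\,\frac{|x-1|^\alpha}{|x+1|^{\alpha+1}}=0 .$$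
   Context: Grosjean polynomials of the first kind: for $-1<\alpha<0$, $(G_n^\alpha)_{n\ge0}$ is the sequence of monic orthogonal polynomials ($\deg G_n^\alpha=n$) on $(-1,1)$ with respect to the probability weight $$w_G(x)=\frac{\sin(-\pi\alpha)}{\pi}\left(\frac{1-x}{1+x}\right)^{\alpha}\frac{1}{1+x},\qquad -1<x<1;$$ equivalently $G_n^\alpha$ is the monic multiple of the Jacobi polynomial $P_n^{(\alpha,-1-\alpha)}$. Its recurrence coefficients $b_n\in\mathbb{R}$ ($n\ge0$) and $a_n^2>0$ ($n\ge1$, $a_n>0$) are those of the three-term recurrence $P_{n+1}(x)=(x-b_n)P_n(x)-a_n^2P_{n-1}(x)$, $n\ge 0$, $P_0=1$, $P_{-1}=0$, with $P_n=G_n^\alpha$. Anti-associated polynomials: given the parameters $b_{-r},\dots,b_{-1}\in\mathbb{R}$ and $a_{-r+1},\dots,a_0>0$, the monic anti-associated polynomials of order $r$, $P_n^{(-r)}$ ($n\ge0$), are defined by $$P_{n+1}^{(-r)}(x)=(x-b_{n-r})P_n^{(-r)}(x)-a_{n-r}^2P_{n-1}^{(-r)}(x),\quad n\ge0,\qquad P_0^{(-r)}=1,\ P_{-1}^{(-r)}=0$$ (the value of $a_{-r}^2$ is irrelevant). That is, the sequence of diagonal Jacobi coefficients is $b_{-r},\dots,b_{-1},b_0,b_1,\dots$ and the sequence of off-diagonal coefficients is $a_{-r+1}^2,\dots,a_{-1}^2,a_0^2,a_1^2,\dots$: the original Jacobi matrix is shifted down by $r$ rows and columns, with $2r$ new parameters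 on top. The orthonormal anti-associated polynomials are $p_n^{(-r)}=P_n^{(-r)}/(a_{-r+1}a_{-r+2}\cdots a_{-r+n})$ (empty product $=1$ for $n=0$). The polynomials $q_n$: for $0\le n\le r$, $q_n=p_n^{(-r)}$. Equivalently, $q_n=Q_n/(a_{-r+1}a_{-r+2}\cdots a_{-r+n})$, where $Q_0=1$, $Q_{-1}=0$ and $Q_{n+1}(x)=(x-b_{-r+n})Q_n(x)-a_{-r+n}^2Q_{n-1}(x)$ for $0\le n\le r-1$. These depend only on the new parameters. All orthogonality measures are normalized to be probability measures. *)

theory Defs
  imports "HOL-Probability.Probability" "HOL-Computational_Algebra.Polynomial"
begin

definition orthogonal_polys :: "real measure \<Rightarrow> (nat \<Rightarrow> real poly) \<Rightarrow> bool" where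
  "orthogonal_polys M P \<longleftrightarrow>
     (\<forall>m n. integrable M (\<lambda>x. poly (P m) x * poly (P n) x)) \<and>
     (\<forall>m n. m \<noteq> n \<longrightarrow> (LINT x|M. poly (P m) x * poly (P n) x) = 0)"

definition orthonormal_polys :: "real measure \<Rightarrow> (nat \<Rightarrow> real poly) \<Rightarrow> bool" where
  "orthonormal_polys M P \<longleftrightarrow>
     orthogonal_polys M P \<and> (\<forall>n. (LINT x|M. poly (P n) x * poly (P n) x) = 1)"

definition monic_orthogonal_polys :: "real measure \<Rightarrow> (nat \<Rightarrow> real poly) \<Rightarrow> bool" where
  "monic_orthogonal_polys M P \<longleftrightarrow>
     (\<forall>n. degree (P n) = n \<and> lead_coeff (P n) = 1) \<and> orthogonal_polys M P"

definition grosjean_weight :: "real \<Rightarrow> real \<Rightarrow> real" where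
  "grosjean_weight \<alpha> x = sin (- pi * \<alpha>) / pi * ((1 - x) / (1 + x)) powr \<alpha> * (1 / (1 + x))"

definition grosjean_measure :: "real \<Rightarrow> real measure" where
  "grosjean_measure \<alpha> =
     density lborel (\<lambda>x. ennreal (grosjean_weight \<alpha> x * indicator {-1<..<1} x))"

(* The family satisfying this is unique: it consists of the Grosjean polynomials
   of the first kind. *)
definition grosjean_polys :: "real \<Rightarrow> (nat \<Rightarrow> real poly) \<Rightarrow> bool" where
  "grosjean_polys \<alpha> G \<longleftrightarrow> monic_orthogonal_polys (grosjean_measure \<alpha>) G"

(* P_(n+1) = (x - b_n) P_n - (a_n)^2 P_(n-1), P_0 = 1, P_(-1) = 0; a_0 does not occur. *)
fun ttr_poly :: "(nat \<Rightarrow> real) \<Rightarrow> (nat \<Rightarrow> real) \<Rightarrow> nat \<Rightarrow> real poly" where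
  "ttr_poly b a 0 = 1"
| "ttr_poly b a (Suc 0) = [:- b 0, 1:]"
| "ttr_poly b a (Suc (Suc n)) =
     [:- b (Suc n), 1:] * ttr_poly b a (Suc n) - smult ((a (Suc n))\<^sup>2) (ttr_poly b a n)"

definition recurrence_coeffs ::
  "(nat \<Rightarrow> real poly) \<Rightarrow> (nat \<Rightarrow> real) \<Rightarrow> (nat \<Rightarrow> real) \<Rightarrow> bool" where
  "recurrence_coeffs P b a \<longleftrightarrow> (\<forall>n\<ge>1. a n > 0) \<and> (\<forall>n. P n = ttr_poly b a n)"

(* The coefficient sequences are indexed by int: b_j (j \<ge> 0) and a_j (j \<ge> 1) belong to the
   original family, b_j (-r \<le> j < 0) and a_j (-r < j \<le> 0) are the new parameters, and the
   values of b_j for j < -r and of a_j for j \<le> -r do not occur. *)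
definition antiassoc :: "(int \<Rightarrow> real) \<Rightarrow> (int \<Rightarrow> real) \<Rightarrow> nat \<Rightarrow> nat \<Rightarrow> real poly" where
  "antiassoc b a r n = ttr_poly (\<lambda>k. b (int k - int r)) (\<lambda>k. a (int k - int r)) n"

(* For n \<le> r these are the polynomials q_n, which involve only the new parameters. *)
definition antiassoc_orthonormal ::
  "(int \<Rightarrow> real) \<Rightarrow> (int \<Rightarrow> real) \<Rightarrow> nat \<Rightarrow> nat \<Rightarrow> real poly" where
  "antiassoc_orthonormal b a r n =
     smult (1 / (\<Prod>k=1..n. a (int k - int r))) (antiassoc b a r n)"

definition antiassoc_weight ::
  "real \<Rightarrow> (int \<Rightarrow> real) \<Rightarrow> (int \<Rightarrow> real) \<Rightarrow> nat \<Rightarrow> real \<Rightarrow> real" where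
  "antiassoc_weight \<alpha> b a r x =
     (let q = antiassoc_orthonormal b a r;
          s = (1 - x) powr \<alpha> / (1 + x) powr (\<alpha> + 1)
      in sin (- pi * \<alpha>) / pi * s /
           (cmod (of_real (poly (q r) x)
                  - of_real (a 0) * exp (\<i> * of_real (\<alpha> * pi))
                    * of_real (poly (q (r - 1)) x) * of_real s))\<^sup>2)"

definition mass_points :: "real measure \<Rightarrow> real set" where
  "mass_points M = {x. emeasure M {x} > 0}"

end

theory Submission
  imports Defs "HOL-Complex_Analysis.Complex_Analysis"
begin

text \<open>
  Write \<open>r = m + 1\<close>, let \<open>T n\<close> be the monic anti-associated polynomials and \<open>V n\<close> their numerator
  polynomials, and let \<open>f z = (z - 1) powr \<alpha> * (z + 1) powr (- 1 - \<alpha>)\<close> be the Stieltjes transform of the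
  Grosjean weight. Putting \<open>f\<close> into the tail of the continued fraction of the extended matrix leads to
  the quotient \<open>N / D\<close> with \<open>D = T r - (a 0)\<^sup>2 * T (r - 1) * f\<close> and
  \<open>N = V r - (a 0)\<^sup>2 * V (r - 1) * f\<close>, and this must be the Stieltjes transform of the measure that is
  sought. On the cut its imaginary part is a Casoratian over \<open>\<bar>D\<bar>\<^sup>2\<close>, which is the density of the
  theorem; its poles outside the cut are the zeros of \<open>D\<close>, and the residues are the masses.

  No spectral theorem is used: the measure is defined by these data, and its orthogonality relations
  are verified by residues. The functions \<open>T n * N / D - V n\<close> satisfy the three-term recurrence and decay
  like \<open>z ^ (- n - 1)\<close> at infinity. Hence the integral of \<open>T j\<close> times such a function over a large
  contour vanishes for \<open>j < n\<close> and is the squared norm for \<open>j = n\<close>. Shrinking the contour to the cut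
  turns the same integral into the integral of \<open>T j * T n\<close> against the density plus the sum over the
  masses.

  The exterior of the cut is parametrised by the unit disc through \<open>z = (u + 1 / u) / 2\<close>. There \<open>f\<close> is
  an explicit combination of powers of a function with values in the right half-plane, the contours
  are circles, and the limit at the unit circle is a dominated convergence argument
  (\<open>boundary_residues\<close>). The same theorem, applied to the Grosjean polynomials themselves, gives the
  decay of their functions of the second kind (\<open>second_kind_limit\<close>), from which the recurrence passes to
  the extended family (\<open>second_num_limit\<close>).

  What remains is the location of the zeros of \<open>D\<close>. They are real because \<open>T r / T (r - 1)\<close> and \<open>f\<close> map
  the upper half-plane to opposite half-planes. They do not accumulate at the cut, not even at its
  endpoints, where \<open>D\<close> has a nonzero or an infinite limit (\<open>weyl_den_lower_bound\<close>); in particular there is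
  no mass at -1 or 1. On either side of the interval \<open>T r / T (r - 1)\<close> increases and \<open>f\<close> decreases, so the
  zeros are separated by the at most \<open>r - 1\<close> zeros of \<open>T (r - 1)\<close> (\<open>zeros_separated\<close>), and there are at
  most \<open>r\<close> of them.
\<close>

section \<open>Real polynomials at complex points\<close>

text \<open>The recurrence coefficients are real, but the contour arguments need the polynomials
  at complex points.\<close>
definition cpoly :: "real poly \<Rightarrow> complex \<Rightarrow> complex" where
  "cpoly p z = poly (map_poly complex_of_real p) z"

lemma cpoly_0 [simp]: "cpoly 0 z = 0"
  and cpoly_1 [simp]: "cpoly 1 z = 1"
  and cpoly_pCons [simp]: "cpoly (pCons c p) z = of_real c + z * cpoly p z"
  by (simp_all add: cpoly_def map_poly_pCons)

lemma cpoly_add [simp]: "cpoly (p + q) z = cpoly p z + cpoly q z"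
proof -
  have "map_poly complex_of_real (p + q) = map_poly of_real p + map_poly of_real q"
    by (rule poly_eqI) (simp add: coeff_map_poly)
  then show ?thesis by (simp add: cpoly_def)
qed

lemma cpoly_smult [simp]: "cpoly (smult c p) z = of_real c * cpoly p z"
  by (simp add: cpoly_def map_poly_smult)

lemma cpoly_diff [simp]: "cpoly (p - q) z = cpoly p z - cpoly q z"
  using cpoly_add[of "p - q" q z] by simp

lemma cpoly_mult [simp]: "cpoly (p * q) z = cpoly p z * cpoly q z"
  by (induction p) (simp_all add: algebra_simps)

lemma cpoly_of_real [simp]: "cpoly p (of_real x) = of_real (poly p x)"
  by (induction p) simp_all

lemma cpoly_cnj [simp]: "cpoly p (cnj z) = cnj (cpoly p z)"
  by (induction p) simp_all

lemma cpoly_has_field_derivative [derivative_intros]: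
  assumes "(g has_field_derivative g') (at z within S)"
  shows "((\<lambda>z. cpoly p (g z)) has_field_derivative cpoly (pderiv p) (g z) * g') (at z within S)"
proof -
  have "map_poly complex_of_real (pderiv p) = pderiv (map_poly of_real p)"
    by (rule poly_eqI) (simp add: coeff_map_poly coeff_pderiv)
  then have "(cpoly p has_field_derivative cpoly (pderiv p) (g z)) (at (g z))"
    unfolding cpoly_def by (simp add: poly_DERIV)
  then show ?thesis
    using assms by (rule DERIV_chain2)
qed

lemma cpoly_holomorphic [holomorphic_intros]:
  "g holomorphic_on S \<Longrightarrow> (\<lambda>z. cpoly p (g z)) holomorphic_on S"
  unfolding cpoly_def by (induction p) (auto intro!: holomorphic_intros simp: map_poly_pCons)

lemma cpoly_continuous_on [continuous_intros]:
  "continuous_on S g \<Longrightarrow> continuous_on S (\<lambda>z. cpoly p (g z))"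
  unfolding cpoly_def by (intro continuous_intros)

lemma cpoly_tendsto [tendsto_intros]:
  "(g \<longlongrightarrow> l) F \<Longrightarrow> ((\<lambda>z. cpoly p (g z)) \<longlongrightarrow> cpoly p l) F"
  unfolding cpoly_def by (intro tendsto_intros)

section \<open>Three-term recurrences\<close>

text \<open>The associated polynomials, which are the numerators of the continued fraction with
  denominators \<^const>\<open>ttr_poly\<close>: the second solution of the same recurrence,
  started with 0 and 1.\<close>
fun ttr_numerator :: "(nat \<Rightarrow> real) \<Rightarrow> (nat \<Rightarrow> real) \<Rightarrow> nat \<Rightarrow> real poly" where
  "ttr_numerator b a 0 = 0"
| "ttr_numerator b a (Suc 0) = 1"
| "ttr_numerator b a (Suc (Suc n)) =
     [:- b (Suc n), 1:] * ttr_numerator b a (Suc n) - smult ((a (Suc n))\<^sup>2) (ttr_numerator b a n)"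

text \<open>Both sequences solve one second-order recurrence, so their Casoratian only picks up
  the factor \<open>(a n)\<^sup>2\<close> in each step. It is the source of every closed form
  below: positivity of the density, the value of the masses and the absence of common
  zeros.\<close>
lemma ttr_casoratian:
  "ttr_poly b a n * ttr_numerator b a (Suc n) - ttr_poly b a (Suc n) * ttr_numerator b a n
     = [:\<Prod>k=1..n. (a k)\<^sup>2:]"
proof (induction n)
  case (Suc n)
  have "ttr_poly b a (Suc n) * ttr_numerator b a (Suc (Suc n))
          - ttr_poly b a (Suc (Suc n)) * ttr_numerator b a (Suc n)
        = smult ((a (Suc n))\<^sup>2)
            (ttr_poly b a n * ttr_numerator b a (Suc n) - ttr_poly b a (Suc n) * ttr_numerator b a n)"
    by (simp add: algebra_simps smult_diff_right)
  also have "\<dots> = [:\<Prod>k=1..Suc n. (a k)\<^sup>2:]"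
    unfolding Suc.IH by (simp add: mult.commute)
  finally show ?case .
qed (simp add: one_pCons)

lemma ttr_casoratian_cpoly:
  "cpoly (ttr_poly b a n) z * cpoly (ttr_numerator b a (Suc n)) z
    - cpoly (ttr_poly b a (Suc n)) z * cpoly (ttr_numerator b a n) z = of_real (\<Prod>k=1..n. (a k)\<^sup>2)"
  using arg_cong[OF ttr_casoratian[of b a n], of "\<lambda>p. cpoly p z"] by simp

text \<open>The confluent Christoffel-Darboux formula, proved directly from the recurrence: each
  step multiplies the Wronskian by a positive number and adds a square. It says that the
  quotient of consecutive polynomials increases between its poles.\<close>
lemma ttr_wronskian_pos:
  assumes "\<And>k. k \<ge> 1 \<Longrightarrow> a k > 0"
  shows "poly (pderiv (ttr_poly b a (Suc n)) * ttr_poly b a n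
           - ttr_poly b a (Suc n) * pderiv (ttr_poly b a n)) x > 0"
proof (induction n)
  case 0
  then show ?case by (simp add: pderiv_pCons)
next
  case (Suc n)
  let ?T = "ttr_poly b a"
  have "poly (pderiv (?T (Suc (Suc n))) * ?T (Suc n) - ?T (Suc (Suc n)) * pderiv (?T (Suc n))) x
      = (poly (?T (Suc n)) x)\<^sup>2 + (a (Suc n))\<^sup>2 *
         poly (pderiv (?T (Suc n)) * ?T n - ?T (Suc n) * pderiv (?T n)) x"
    by (simp add: pderiv_diff pderiv_smult pderiv_mult pderiv_pCons power2_eq_square
          del: mult_pCons_left) (simp add: algebra_simps)
  also have "\<dots> > 0"
    using Suc.IH assms[of "Suc n"] by (intro add_nonneg_pos mult_pos_pos) auto
  finally show ?case .
qed

text \<open>The same recurrence at a non-real point: the quotient of consecutive polynomials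
  maps the upper half-plane to itself.\<close>
lemma ttr_Im_pos:
  assumes "\<And>k. k \<ge> 1 \<Longrightarrow> a k > 0" and "Im z > 0"
  shows "Im (cpoly (ttr_poly b a (Suc n)) z * cnj (cpoly (ttr_poly b a n) z)) > 0"
proof (induction n)
  case 0
  then show ?case using assms(2) by simp
next
  case (Suc n)
  define p q where "p = cpoly (ttr_poly b a (Suc n)) z" and "q = cpoly (ttr_poly b a n) z"
  have "Im (cpoly (ttr_poly b a (Suc (Suc n))) z * cnj (cpoly (ttr_poly b a (Suc n)) z))
      = Im z * (cmod p)\<^sup>2 + (a (Suc n))\<^sup>2 * Im (p * cnj q)"
    unfolding cmod_power2 by (simp add: p_def q_def algebra_simps power2_eq_square)
  also have "\<dots> > 0"
    using Suc.IH assms(1)[of "Suc n"] assms(2)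
    by (intro add_nonneg_pos mult_pos_pos) (auto simp: p_def q_def)
  finally show ?case .
qed

lemma degree_ttr_poly: "degree (ttr_poly b a n) = n"
  and lead_coeff_ttr_poly: "lead_coeff (ttr_poly b a n) = 1"
proof -
  have "degree (ttr_poly b a n) = n \<and> lead_coeff (ttr_poly b a n) = 1"
  proof (induction n rule: less_induct)
    case (less k)
    consider "k = 0" | "k = Suc 0" | n where "k = Suc (Suc n)"
      by (metis not0_implies_Suc)
    then show ?case
    proof cases
      case 3
      define p where "p = [:- b (Suc n), 1:] * ttr_poly b a (Suc n)"
      define q where "q = smult (- (a (Suc n))\<^sup>2) (ttr_poly b a n)"
      have IH: "degree (ttr_poly b a (Suc n)) = Suc n" "lead_coeff (ttr_poly b a (Suc n)) = 1"
        "degree (ttr_poly b a n) = n"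
        using less.IH[of "Suc n"] less.IH[of n] 3 by auto
      then have "ttr_poly b a (Suc n) \<noteq> 0" by auto
      then have "degree p = degree [:- b (Suc n), 1:] + degree (ttr_poly b a (Suc n))"
        unfolding p_def by (intro degree_mult_eq) auto
      then have p: "degree p = Suc (Suc n)" using IH by simp
      have lp: "lead_coeff p = 1"
        using IH(2) unfolding p_def lead_coeff_mult by simp
      have "degree q < degree p"
        using IH p degree_smult_le[of "- (a (Suc n))\<^sup>2" "ttr_poly b a n"] unfolding q_def by linarith
      then have "degree (p + q) = degree p" "lead_coeff (p + q) = lead_coeff p"
        by (simp_all add: degree_add_eq_left coeff_eq_0)
      moreover have "ttr_poly b a k = p + q" by (simp add: 3 p_def q_def)
      ultimately show ?thesis using p lp 3 by simp
    qed simp_all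
  qed
  then show "degree (ttr_poly b a n) = n" "lead_coeff (ttr_poly b a n) = 1" by auto
qed

section \<open>The Stieltjes transform of the Grosjean weight in the unit disc\<close>

text \<open>The Joukowski map takes the punctured unit disc to the complement of \<open>[-1,
  1]\<close>, with 0 going to infinity and the unit circle covering the cut twice. In the disc
  the Stieltjes transform \<open>(z - 1) powr \<alpha> * (z + 1) powr (- 1 - \<alpha>)\<close>
  of the Grosjean weight is single-valued: if \<open>v\<close> is the Cayley transform of
  \<open>u\<close>, which lies in the right half-plane, then \<open>(z - 1) / (z + 1) =
  v\<^sup>2\<close> and \<open>1 / (z + 1) = (1 - v\<^sup>2) / 2\<close>.\<close>
definition jouk :: "complex \<Rightarrow> complex" where "jouk u = (u + 1 / u) / 2"
definition djouk :: "complex \<Rightarrow> complex" where "djouk u = (1 - 1 / u\<^sup>2) / 2"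
definition cayley :: "complex \<Rightarrow> complex" where "cayley u = (1 - u) / (1 + u)"

definition stieltjes :: "real \<Rightarrow> complex \<Rightarrow> complex" where
  "stieltjes \<alpha> u = (cayley u powr of_real (2 * \<alpha>) - cayley u powr of_real (2 * \<alpha> + 2)) / 2"

lemma jouk_has_field_derivative:
  "u \<noteq> 0 \<Longrightarrow> (jouk has_field_derivative djouk u) (at u within S)"
  unfolding jouk_def[abs_def] djouk_def
  by (auto intro!: derivative_eq_intros simp: power2_eq_square field_simps)

lemma one_plus_eq_0_iff: "1 + u = 0 \<longleftrightarrow> u = - 1" for u :: complex
  by (metis add.commute add_eq_0_iff)

lemma Re_cayley: "Re (cayley u) = (1 - (cmod u)\<^sup>2) / (cmod (1 + u))\<^sup>2"
  and Im_cayley: "Im (cayley u) = - 2 * Im u / (cmod (1 + u))\<^sup>2"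
  unfolding cayley_def Re_divide Im_divide cmod_power2
  by (simp_all add: algebra_simps power2_eq_square)

text \<open>On the closed disc the principal branch of the power of the Cayley transform is
  never used on its cut, so the transform extends continuously to the circle without its two
  points over the endpoints.\<close>
lemma cayley_notin_nonpos:
  assumes "cmod u \<le> 1" "u \<noteq> 1" "u \<noteq> -1"
  shows "cayley u \<notin> \<real>\<^sub>\<le>\<^sub>0"
proof
  assume *: "cayley u \<in> \<real>\<^sub>\<le>\<^sub>0"
  have p: "(cmod (1 + u))\<^sup>2 > 0"
    using assms(3) by (simp add: one_plus_eq_0_iff)
  have "(cmod u)\<^sup>2 \<le> 1"
    using assms(1) by (simp add: power_le_one)
  moreover have "Re (cayley u) \<le> 0" "Im (cayley u) = 0"
    using * by (auto simp: complex_nonpos_Reals_iff)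
  ultimately have "(cmod u)\<^sup>2 = 1" "Im u = 0"
    using p by (auto simp: Re_cayley Im_cayley divide_simps split: if_splits)
  then have "Re u = 1 \<or> Re u = -1"
    by (simp add: cmod_power2 power2_eq_1_iff)
  then show False
    using assms \<open>Im u = 0\<close> by (auto simp: complex_eq_iff)
qed

lemma Re_cayley_pos: "cmod u < 1 \<Longrightarrow> Re (cayley u) > 0"
  unfolding Re_cayley
  by (intro divide_pos_pos) (auto simp: power_less_one_iff abs_square_less_1 one_plus_eq_0_iff)

lemma stieltjes_alt:
  assumes "u \<noteq> 1" "u \<noteq> -1"
  shows "stieltjes \<alpha> u = cayley u powr of_real (2 * \<alpha>) * (2 * u / (1 + u)\<^sup>2)"
proof -
  have nz: "1 + u \<noteq> 0" "1 - u \<noteq> 0" using assms by (auto simp: one_plus_eq_0_iff)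
  then have "cayley u \<noteq> 0" by (simp add: cayley_def)
  then have p: "cayley u powr of_real (2 * \<alpha> + 2) = cayley u powr of_real (2 * \<alpha>) * (cayley u)\<^sup>2"
    unfolding of_real_add powr_add by simp
  have "1 - (cayley u)\<^sup>2 = ((1 + u)\<^sup>2 - (1 - u)\<^sup>2) / (1 + u)\<^sup>2"
    unfolding cayley_def power_divide using nz(1) by (simp add: diff_divide_distrib)
  then have "1 - (cayley u)\<^sup>2 = 4 * u / (1 + u)\<^sup>2"
    by (simp add: power2_eq_square algebra_simps)
  then have "(1 - (cayley u)\<^sup>2) / 2 = 2 * u / (1 + u)\<^sup>2" by simp
  moreover have "stieltjes \<alpha> u = cayley u powr of_real (2 * \<alpha>) * ((1 - (cayley u)\<^sup>2) / 2)"
    unfolding stieltjes_def p by (simp add: right_diff_distrib diff_divide_distrib)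
  ultimately show ?thesis by metis
qed

lemma djouk_alt: "u \<noteq> 0 \<Longrightarrow> djouk u = - ((1 - u) * (1 + u)) / (2 * u\<^sup>2)"
  by (simp add: djouk_def field_simps power2_eq_square)

text \<open>The factor that the change of variables brings in softens the singularities over
  both endpoints at once: the power that remains has its exponent strictly between -1 and 1 when
  \<open>-1 < \<alpha> < 0\<close>, and is integrable along the circle.\<close>
lemma stieltjes_djouk:
  assumes "u \<noteq> 1" "u \<noteq> -1" "u \<noteq> 0"
  shows "stieltjes \<alpha> u * djouk u = - (cayley u powr of_real (2 * \<alpha> + 1)) / u"
proof -
  have nz: "1 + u \<noteq> 0" "1 - u \<noteq> 0" using assms by (auto simp: one_plus_eq_0_iff)
  then have "cayley u \<noteq> 0" by (simp add: cayley_def)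
  then have "cayley u powr of_real (2 * \<alpha> + 1) = cayley u powr of_real (2 * \<alpha>) * cayley u"
    unfolding of_real_add powr_add by simp
  moreover have "2 * u / p\<^sup>2 * (- (q * p) / (2 * u\<^sup>2)) = - (q / p) / u" if "p \<noteq> 0" for p q
    using that assms(3) by (simp add: divide_simps power2_eq_square)
  from this[OF nz(1), of "1 - u"] have "2 * u / (1 + u)\<^sup>2 * djouk u = - cayley u / u"
    using assms(3) by (simp add: djouk_alt cayley_def)
  ultimately show ?thesis
    unfolding stieltjes_alt[OF assms(1,2)] mult.assoc by simp
qed

lemma cayley_cnj: "cayley (cnj u) = cnj (cayley u)" by (simp add: cayley_def)
lemma jouk_cnj: "jouk (cnj u) = cnj (jouk u)" by (simp add: jouk_def)
lemma djouk_cnj: "djouk (cnj u) = cnj (djouk u)" by (simp add: djouk_def)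

lemma stieltjes_cnj:
  assumes "cmod u \<le> 1" "u \<noteq> 1" "u \<noteq> -1"
  shows "stieltjes \<alpha> (cnj u) = cnj (stieltjes \<alpha> u)"
proof -
  have "cnj (cayley u) powr of_real s = cnj (cayley u powr of_real s)" for s
    using cayley_notin_nonpos[OF assms] by (subst cnj_powr) (auto simp: complex_nonpos_Reals_iff)
  then show ?thesis
    by (simp add: stieltjes_def cayley_cnj del: of_real_mult of_real_add)
qed

text \<open>In the form \<open>(v powr (2 * \<alpha>) - v powr (2 * \<alpha> + 2)) / 2\<close>
  both terms have imaginary parts of a definite sign, since the argument of \<open>v\<close>
  lies between 0 and \<open>- pi / 2\<close>. As \<^const>\<open>jouk\<close> exchanges the
  half-planes, this is the Nevanlinna property of the transform.\<close>
lemma stieltjes_Im_pos: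
  assumes "-1 < \<alpha>" "\<alpha> < 0" "cmod u < 1" "Im u > 0"
  shows "Im (stieltjes \<alpha> u) > 0"
proof -
  define v where "v = cayley u"
  define \<phi> where "\<phi> = - Arg v"
  have "Re v > 0" "Im v < 0"
    using Re_cayley_pos[OF assms(3)] assms(4) by (auto simp: v_def Im_cayley divide_simps one_plus_eq_0_iff)
  then have v: "v \<noteq> 0" and \<phi>: "0 < \<phi>" "\<phi> < pi / 2"
    using Arg_neg_iff[of v] Arg_Re_pos[of v] by (auto simp: \<phi>_def abs_if complex_eq_iff)
  have *: "Im (v powr of_real s) = cmod v powr s * sin (- s * \<phi>)" for s
  proof -
    have "v powr of_real s = exp (of_real s * Ln v)" using v by (simp add: powr_def)
    then show ?thesis using v
      by (simp add: Im_exp powr_def Arg_eq_Im_Ln[OF v] \<phi>_def)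
  qed
  have "sin (- (2 * \<alpha>) * \<phi>) > 0"
  proof (rule sin_gt_zero)
    show "0 < - (2 * \<alpha>) * \<phi>" using assms \<phi> by (simp add: mult_neg_pos)
    have "- (2 * \<alpha>) * \<phi> < 2 * \<phi>"
      using mult_strict_right_mono[of "- (2 * \<alpha>)" 2 \<phi>] assms \<phi> by simp
    then show "- (2 * \<alpha>) * \<phi> < pi" using \<phi> by simp
  qed
  moreover have "sin ((2 * \<alpha> + 2) * \<phi>) > 0"
  proof (rule sin_gt_zero)
    show "0 < (2 * \<alpha> + 2) * \<phi>" using assms \<phi> by simp
    have "(2 * \<alpha> + 2) * \<phi> < 2 * \<phi>"
      using mult_strict_right_mono[of "2 * \<alpha> + 2" 2 \<phi>] assms \<phi> by simp
    also have "\<dots> < pi" using \<phi> by simp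
    finally show "(2 * \<alpha> + 2) * \<phi> < pi" .
  qed
  then have "sin (- (2 * \<alpha> + 2) * \<phi>) < 0" by (simp only: sin_minus mult_minus_left neg_less_0_iff_less)
  ultimately have "Im (v powr of_real (2 * \<alpha>)) > 0" "Im (v powr of_real (2 * \<alpha> + 2)) < 0"
    unfolding * using v by (auto intro: mult_pos_pos mult_pos_neg)
  then show ?thesis by (simp add: stieltjes_def v_def)
qed

lemma jouk_Im_neg:
  assumes "cmod u < 1" "Im u > 0"
  shows "Im (jouk u) < 0"
proof -
  have "u \<noteq> 0" using assms by auto
  have "Im (jouk u) = Im u / 2 * (1 - 1 / (cmod u)\<^sup>2)"
  proof -
    have "Im (1 / u) = - Im u / (cmod u)\<^sup>2" by (simp add: Im_divide cmod_power2)
    then show ?thesis by (simp add: jouk_def right_diff_distrib)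
  qed
  moreover have "1 / (cmod u)\<^sup>2 > 1"
    using assms \<open>u \<noteq> 0\<close> by (simp add: power_less_one_iff abs_square_less_1)
  ultimately show ?thesis using assms by (simp only:) (intro mult_pos_neg, auto)
qed

text \<open>In the variable \<open>z\<close> this is the logarithmic derivative \<open>\<alpha>
  / (z - 1) - (\<alpha> + 1) / (z + 1)\<close> of the transform.\<close>
lemma stieltjes_has_field_derivative:
  assumes "cmod u < 1" "u \<noteq> 0"
  shows "(stieltjes \<alpha> has_field_derivative
    stieltjes \<alpha> u * (of_real (2 * \<alpha> + 1) - jouk u) / ((jouk u)\<^sup>2 - 1) * djouk u) (at u)"
proof -
  have nz: "1 + u \<noteq> 0" "1 - u \<noteq> 0" "u \<noteq> 1" "u \<noteq> -1" using assms by (auto simp: one_plus_eq_0_iff)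
  define v where "v = cayley u"
  have v: "v \<notin> \<real>\<^sub>\<le>\<^sub>0" "v \<noteq> 0"
    using Re_cayley_pos[OF assms(1)] by (auto simp: v_def complex_nonpos_Reals_iff)
  have dm: "(cayley has_field_derivative - 2 / (1 + u)\<^sup>2) (at u)"
    unfolding cayley_def[abs_def] using nz
    by (auto intro!: derivative_eq_intros simp: power2_eq_square divide_simps)
  have dv: "((\<lambda>u. cayley u powr of_real s) has_field_derivative
     of_real s * v powr (of_real s) / v * (- 2 / (1 + u)\<^sup>2)) (at u)" for s
    using v dm unfolding v_def
    by (auto intro!: derivative_eq_intros simp: powr_diff)
  have "(stieltjes \<alpha> has_field_derivative (of_real (2*\<alpha>) * v powr (of_real (2*\<alpha>)) / v * (- 2 / (1 + u)\<^sup>2)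
     - of_real (2*\<alpha>+2) * v powr (of_real (2*\<alpha>+2)) / v * (- 2 / (1 + u)\<^sup>2)) / 2) (at u)"
    unfolding stieltjes_def[abs_def] by (intro DERIV_cdivide DERIV_diff dv)
  also have "v powr (of_real (2*\<alpha>+2)) = v powr of_real (2*\<alpha>) * v\<^sup>2"
    unfolding of_real_add powr_add using v by simp
  also have "(of_real (2*\<alpha>) * v powr (of_real (2*\<alpha>)) / v * (- 2 / (1 + u)\<^sup>2)
     - of_real (2*\<alpha>+2) * (v powr of_real (2*\<alpha>) * v\<^sup>2) / v * (- 2 / (1 + u)\<^sup>2)) / 2 =
     v powr of_real (2 * \<alpha>) * ((of_real (2*\<alpha>+2) * v - of_real (2*\<alpha>) / v) / (1 + u)\<^sup>2)"
    using v nz by (simp add: divide_simps power2_eq_square) (simp add: algebra_simps)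
  also have "(of_real (2*\<alpha>+2) * v - of_real (2*\<alpha>) / v) / (1 + u)\<^sup>2 =
     2 * u / (1 + u)\<^sup>2 * (of_real (2 * \<alpha> + 1) - jouk u) / ((jouk u)\<^sup>2 - 1) * djouk u"
  proof -
    have aux1: "(c * (q / p) - d / (q / p)) / p\<^sup>2 = (c * q\<^sup>2 - d * p\<^sup>2) / (q * p * p\<^sup>2)"
      if "p \<noteq> 0" "q \<noteq> 0" for c d p q :: complex
      using that by (simp add: divide_simps power2_eq_square)
    have aux2: "2 * u / p\<^sup>2 * e / (q * p / (2 * u))\<^sup>2 * (- (q * p) / (2 * u\<^sup>2))
        = - 4 * u * e / (q * p * p\<^sup>2)"
      if "p \<noteq> 0" "q \<noteq> 0" for e p q
      using that assms(2) by (simp add: divide_simps power2_eq_square)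
    have j: "(jouk u)\<^sup>2 - 1 = ((1 - u) * (1 + u) / (2 * u))\<^sup>2"
      using assms(2) by (simp add: jouk_def field_simps power2_eq_square)
    have e: "u * jouk u = (u\<^sup>2 + 1) / 2"
      using assms(2) by (simp add: jouk_def field_simps power2_eq_square)
    have "of_real (2*\<alpha>+2) * (1 - u)\<^sup>2 - of_real (2*\<alpha>) * (1 + u)\<^sup>2
        = - 4 * u * of_real (2 * \<alpha> + 1) + 4 * (u * jouk u)"
      unfolding e by (simp add: power2_eq_square algebra_simps)
    also have "\<dots> = - 4 * u * (of_real (2 * \<alpha> + 1) - jouk u)"
      by (simp add: algebra_simps)
    finally show ?thesis
      unfolding j djouk_alt[OF assms(2)] v_def cayley_def
      by (simp only: aux1[OF nz(1,2)] aux2[OF nz(1,2)])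
  qed
  finally show ?thesis
    by (simp add: stieltjes_alt[OF nz(3,4)] v_def mult.assoc)
qed

lemma stieltjes_holomorphic: "stieltjes \<alpha> holomorphic_on ball 0 1"
proof -
  have "cayley u \<notin> \<real>\<^sub>\<le>\<^sub>0" "1 + u \<noteq> 0" if "u \<in> ball 0 1" for u
    using Re_cayley_pos[of u] that by (auto simp: complex_nonpos_Reals_iff one_plus_eq_0_iff)
  then show ?thesis
    unfolding stieltjes_def[abs_def] cayley_def[abs_def] by (auto intro!: holomorphic_intros)
qed

lemma stieltjes_continuous_on: "continuous_on (cball 0 1 - {1, -1}) (stieltjes \<alpha>)"
proof -
  have *: "cayley u \<notin> \<real>\<^sub>\<le>\<^sub>0" "cayley u \<noteq> 0" "1 + u \<noteq> 0" if "u \<in> cball 0 1 - {1, -1}" for u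
    using cayley_notin_nonpos[of u] that by (auto simp: one_plus_eq_0_iff)
  have "continuous_on (cball 0 1 - {1, -1}) cayley"
    unfolding cayley_def[abs_def] using * by (intro continuous_intros) auto
  then have "continuous_on (cball 0 1 - {1, -1}) (\<lambda>u. exp (c * Ln (cayley u)))" for c
    by (intro continuous_on_exp continuous_on_mult continuous_on_const continuous_on_Ln')
       (use * in auto)
  then have "continuous_on (cball 0 1 - {1, -1})
     (\<lambda>u. (exp (of_real (2 * \<alpha>) * Ln (cayley u)) - exp (of_real (2 * \<alpha> + 2) * Ln (cayley u))) / 2)"
    by (intro continuous_on_divide continuous_on_diff continuous_on_const) auto
  then show ?thesis
    by (rule continuous_on_eq) (use * in \<open>auto simp: stieltjes_def powr_def\<close>)
qed

text \<open>The transform behaves as \<open>1 / z\<close> at infinity: the Grosjean weight has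
  total mass 1.\<close>
lemma jouk_stieltjes_tendsto: "((\<lambda>u. jouk u * stieltjes \<alpha> u) \<longlongrightarrow> 1) (at 0)"
proof -
  have "((\<lambda>u. (1 - u) / (1 + u)) \<longlongrightarrow> (1 - 0) / (1 + 0)) (at (0::complex))"
    by (intro tendsto_intros) auto
  then have "((\<lambda>u. cayley u powr of_real (2 * \<alpha>)) \<longlongrightarrow> 1 powr of_real (2 * \<alpha>)) (at 0)"
    unfolding cayley_def by (intro tendsto_powr_complex tendsto_intros) auto
  moreover have "((\<lambda>u. (u\<^sup>2 + 1) / (1 + u)\<^sup>2) \<longlongrightarrow> (0\<^sup>2 + 1) / (1 + 0)\<^sup>2) (at (0::complex))"
    by (intro tendsto_intros) auto
  ultimately have "((\<lambda>u. cayley u powr of_real (2 * \<alpha>) * ((u\<^sup>2 + 1) / (1 + u)\<^sup>2)) \<longlongrightarrow> 1) (at 0)"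
    using tendsto_mult by fastforce
  moreover have "eventually (\<lambda>u::complex. u \<in> ball 0 1 - {0}) (at 0)"
    using eventually_at_in_open[of "ball 0 1" "0::complex"] by simp
  then have "eventually (\<lambda>u. cayley u powr of_real (2 * \<alpha>) * ((u\<^sup>2 + 1) / (1 + u)\<^sup>2)
       = jouk u * stieltjes \<alpha> u) (at 0)"
  proof eventually_elim
    case (elim u)
    then have "jouk u * (2 * u) = u\<^sup>2 + 1" "u \<noteq> 1" "u \<noteq> -1"
      by (auto simp: jouk_def field_simps power2_eq_square)
    then show ?case
      by (simp add: stieltjes_alt mult.left_commute[of "jouk u"] flip: times_divide_eq_right)
         (simp add: mult.assoc mult.left_commute)
  qed
  ultimately show ?thesis by (rule Lim_transform_eventually)
qed

lemma inverse_jouk_tendsto: "((\<lambda>u. 1 / jouk u) \<longlongrightarrow> 0) (at 0)"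
proof -
  have "((\<lambda>u. 2 * u / (u\<^sup>2 + 1)) \<longlongrightarrow> 2 * 0 / (0\<^sup>2 + 1)) (at (0::complex))"
    by (intro tendsto_intros) auto
  moreover have "eventually (\<lambda>u::complex. 2 * u / (u\<^sup>2 + 1) = 1 / jouk u) (at 0)"
    by (intro eventually_at_filter[THEN iffD2] always_eventually)
       (auto simp: jouk_def field_simps power2_eq_square)
  ultimately show ?thesis using Lim_transform_eventually by fastforce
qed

lemma djouk_over_jouk_tendsto: "((\<lambda>u. djouk u * u / jouk u) \<longlongrightarrow> -1) (at 0)"
proof -
  have "((\<lambda>u. (u\<^sup>2 - 1) / (u\<^sup>2 + 1)) \<longlongrightarrow> (0\<^sup>2 - 1) / (0\<^sup>2 + 1)) (at (0::complex))"
    by (intro tendsto_intros) auto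
  moreover have "eventually (\<lambda>u::complex. (u\<^sup>2 - 1) / (u\<^sup>2 + 1) = djouk u * u / jouk u) (at 0)"
  proof (intro eventually_at_filter[THEN iffD2] always_eventually allI impI)
    fix u :: complex assume "u \<noteq> 0"
    then have "djouk u * u = (u\<^sup>2 - 1) / (2 * u)" "jouk u = (u\<^sup>2 + 1) / (2 * u)"
      by (simp_all add: jouk_def djouk_def field_simps power2_eq_square)
    then show "(u\<^sup>2 - 1) / (u\<^sup>2 + 1) = djouk u * u / jouk u"
      using \<open>u \<noteq> 0\<close> by simp
  qed
  ultimately show ?thesis using Lim_transform_eventually by fastforce
qed

lemma jouk_neq_0: "cmod u < 1 \<Longrightarrow> u \<noteq> 0 \<Longrightarrow> jouk u \<noteq> 0"
proof
  assume u: "cmod u < 1" "u \<noteq> 0" "jouk u = 0"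
  then have "1 + u\<^sup>2 = 0"
    by (simp add: jouk_def power2_eq_square field_simps)
  then have "u\<^sup>2 = -1"
    by (simp add: one_plus_eq_0_iff)
  then have "(cmod u)\<^sup>2 = 1" by (metis norm_power norm_minus_cancel norm_one)
  moreover have "(cmod u)\<^sup>2 < 1" using u(1) by (simp add: abs_square_less_1)
  ultimately show False by simp
qed

text \<open>The Grosjean weight without its normalising constant.\<close>
definition jacobi :: "real \<Rightarrow> real \<Rightarrow> real" where
  "jacobi \<alpha> x = (1 - x) powr \<alpha> / (1 + x) powr (\<alpha> + 1)"

lemma jouk_cis: "jouk (cis t) = of_real (cos t)"
  by (simp add: jouk_def complex_eq_iff Re_divide Im_divide)

lemma djouk_cis: "djouk (cis t) * cis t = \<i> * of_real (sin t)"
proof -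
  have "djouk z * z = (z - inverse z) / 2" if "z \<noteq> 0" for z
    using that by (simp add: djouk_def power2_eq_square field_simps)
  then have "djouk (cis t) * cis t = (cis t - cis (-t)) / 2"
    by (simp only: cis_neq_zero simp_thms) (simp only: cis_inverse)
  also have "\<dots> = \<i> * of_real (sin t)" by (simp add: complex_eq_iff)
  finally show ?thesis .
qed

text \<open>The boundary value from the lower side of the cut. Over the point \<open>cos
  t\<close> the Cayley transform is \<open>- \<i> * tan (t / 2)\<close>, and its powers produce
  the phase.\<close>
lemma stieltjes_cis:
  assumes "0 < t" "t < pi"
  shows "stieltjes \<alpha> (cis t) = cnj (cis (\<alpha> * pi)) * of_real (jacobi \<alpha> (cos t))"
proof -
  have sp: "sin t > 0" using assms by (simp add: sin_gt_zero)
  have cp: "1 + cos t > 0" "1 - cos t > 0"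
    using assms cos_monotone_0_pi[of t pi] cos_monotone_0_pi[of 0 t] by auto
  define w where "w = sin t / (1 + cos t)"
  have w: "w > 0" using sp cp by (simp add: w_def)
  have nz: "1 + cis t \<noteq> 0" using cp by (auto simp: complex_eq_iff)
  have "cayley (cis t) * (1 + cis t) = 1 - cis t" using nz by (simp add: cayley_def)
  moreover have "w * sin t = 1 - cos t" "w * (1 + cos t) = sin t"
    using cp sin_cos_squared_add[of t]
    by (simp_all add: w_def divide_simps) (simp add: algebra_simps power2_eq_square)
  then have "- \<i> * of_real w * (1 + cis t) = 1 - cis t"
    by (simp add: complex_eq_iff)
  ultimately have cayley: "cayley (cis t) = - \<i> * of_real w"
    using nz by (metis mult_right_cancel)
  have sin2: "sin t * sin t = (1 - cos t) * (1 + cos t)"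
    using sin_cos_squared_add[of t] by (simp add: algebra_simps power2_eq_square)
  then have w2: "w\<^sup>2 = (1 - cos t) / (1 + cos t)"
    using cp by (simp add: w_def power2_eq_square)
  have "cis t \<noteq> 1" "cis t \<noteq> -1" using sp by (auto simp: complex_eq_iff)
  then have "stieltjes \<alpha> (cis t) = cayley (cis t) powr of_real (2 * \<alpha>) * (2 * cis t / (1 + cis t)\<^sup>2)"
    by (rule stieltjes_alt)
  also have "cayley (cis t) powr of_real (2 * \<alpha>) = cnj (cis (\<alpha> * pi)) * of_real (w powr (2 * \<alpha>))"
  proof -
    have "Ln (- \<i> * of_real w) = of_real (ln w) - \<i> * of_real pi / 2"
      using Ln_times_of_real[of w "-\<i>"] w by (simp add: mult.commute Ln_of_real)
    then have "of_real (2 * \<alpha>) * Ln (- \<i> * of_real w)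
        = of_real (2 * \<alpha> * ln w) + - \<i> * of_real (\<alpha> * pi)"
      by (simp only:) (simp add: algebra_simps)
    then have "cayley (cis t) powr of_real (2 * \<alpha>)
        = exp (of_real (2 * \<alpha> * ln w) + - \<i> * of_real (\<alpha> * pi))"
      using w unfolding cayley powr_def by (simp only: if_False) simp
    also have "\<dots> = of_real (w powr (2 * \<alpha>)) * cis (- (\<alpha> * pi))"
      using w unfolding exp_add cis_conv_exp exp_of_real by (simp add: powr_def)
    finally show ?thesis by (simp add: cis_cnj)
  qed
  also have "w powr (2 * \<alpha>) = (w\<^sup>2) powr \<alpha>"
    using w by (simp add: powr_powr flip: powr_numeral)
  also have "\<dots> = (1 - cos t) powr \<alpha> / (1 + cos t) powr \<alpha>"
    unfolding w2 using cp by (simp add: powr_divide)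
  also have "2 * cis t / (1 + cis t)\<^sup>2 = of_real (1 / (1 + cos t))"
  proof -
    have "2 * cis t * (1 + of_real (cos t)) = (1 + cis t)\<^sup>2"
      using sin_cos_squared_add[of t]
      by (simp add: complex_eq_iff power2_eq_square algebra_simps)
    moreover have "1 + complex_of_real (cos t) \<noteq> 0" using cp by (auto simp: complex_eq_iff)
    ultimately show ?thesis using nz by (simp add: field_simps)
  qed
  finally show ?thesis
    using cp by (simp add: jacobi_def powr_add)
qed

definition jouk_real :: "real \<Rightarrow> real" where "jouk_real u = (u + 1 / u) / 2"

text \<open>The transform on the real line outside \<open>[-1, 1]\<close>.\<close>
definition stieltjes_real :: "real \<Rightarrow> real \<Rightarrow> real" where
  "stieltjes_real \<alpha> x = sgn x * (\<bar>x - 1\<bar> powr \<alpha> / \<bar>x + 1\<bar> powr (\<alpha> + 1))"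

lemma jouk_of_real: "jouk (of_real u) = of_real (jouk_real u)" by (simp add: jouk_def jouk_real_def)

lemma stieltjes_of_real:
  assumes "\<bar>u\<bar> < 1" "u \<noteq> 0"
  shows "stieltjes \<alpha> (of_real u) = of_real (stieltjes_real \<alpha> (jouk_real u))"
proof -
  define v where "v = (1 - u) / (1 + u)"
  have p: "1 - u > 0" "1 + u > 0" and v: "v > 0" using assms by (auto simp: v_def)
  have a1: "\<bar>jouk_real u - 1\<bar> = (1 - u)\<^sup>2 / (2 * \<bar>u\<bar>)"
  proof -
    have "jouk_real u - 1 = (1 - u)\<^sup>2 / (2 * u)"
      using assms by (simp add: jouk_real_def field_simps power2_eq_square)
    then show ?thesis by (simp only: abs_divide abs_mult abs_power2 abs_numeral)
  qed
  have a2: "\<bar>jouk_real u + 1\<bar> = (1 + u)\<^sup>2 / (2 * \<bar>u\<bar>)"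
  proof -
    have "jouk_real u + 1 = (1 + u)\<^sup>2 / (2 * u)"
      using assms by (simp add: jouk_real_def field_simps power2_eq_square)
    then show ?thesis by (simp only: abs_divide abs_mult abs_power2 abs_numeral)
  qed
  have s: "sgn (jouk_real u) = sgn u"
  proof -
    have "jouk_real u = u * ((1 + 1 / u\<^sup>2) / 2)"
      using assms by (simp add: jouk_real_def field_simps power2_eq_square)
    moreover have "(1 + 1 / u\<^sup>2) / 2 > 0" by (simp add: add_pos_nonneg)
    ultimately show ?thesis by (metis mult.right_neutral sgn_mult sgn_pos)
  qed
  have q: "(x\<^sup>2) powr \<beta> = x powr (2 * \<beta>)" if "x > 0" for x \<beta> :: real
    using that by (simp add: powr_powr flip: powr_numeral)
  have "stieltjes_real \<alpha> (jouk_real u) = sgn u * (((1 - u) powr (2 * \<alpha>) / (2 * \<bar>u\<bar>) powr \<alpha>)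
      / ((1 + u) powr (2 * (\<alpha> + 1)) / (2 * \<bar>u\<bar>) powr (\<alpha> + 1)))"
    unfolding stieltjes_real_def s a1 a2 using p by (simp add: powr_divide q)
  also have "(1 + u) powr (2 * (\<alpha> + 1)) = (1 + u) powr (2 * \<alpha>) * (1 + u)\<^sup>2"
    using p by (simp add: powr_add algebra_simps powr_numeral)
  also have "(2 * \<bar>u\<bar>) powr (\<alpha> + 1) = (2 * \<bar>u\<bar>) powr \<alpha> * (2 * \<bar>u\<bar>)"
    by (simp add: powr_add)
  also have "sgn u * (((1 - u) powr (2 * \<alpha>) / (2 * \<bar>u\<bar>) powr \<alpha>)
      / ((1 + u) powr (2 * \<alpha>) * (1 + u)\<^sup>2 / ((2 * \<bar>u\<bar>) powr \<alpha> * (2 * \<bar>u\<bar>))))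
      = (1 - u) powr (2 * \<alpha>) / (1 + u) powr (2 * \<alpha>) * (2 * (sgn u * \<bar>u\<bar>)) / (1 + u)\<^sup>2"
    using p assms by (simp add: divide_simps)
  also have "\<dots> = v powr (2 * \<alpha>) * (2 * u / (1 + u)\<^sup>2)"
    using p by (simp add: v_def powr_divide mult.commute[of "sgn u"] abs_mult_sgn)
  finally have R: "stieltjes_real \<alpha> (jouk_real u) = v powr (2 * \<alpha>) * (2 * u / (1 + u)\<^sup>2)" .
  have "cayley (of_real u) = of_real v" by (simp add: cayley_def v_def)
  moreover have "complex_of_real u \<noteq> 1" "complex_of_real u \<noteq> -1"
    using assms by (auto simp: complex_eq_iff)
  ultimately show ?thesis
    unfolding R using v powr_of_real[of v "2 * \<alpha>"] by (subst stieltjes_alt) simp_all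
qed

section \<open>Contour integrals collapsing onto the cut\<close>

lemma sin_ge_third:
  assumes "0 \<le> t" "t \<le> pi / 2"
  shows "t / 3 \<le> sin t"
proof -
  have "\<bar>sin t - (\<Sum>m<3. sin_coeff m * t ^ m)\<bar> \<le> inverse (fact 3) * \<bar>t\<bar> ^ 3"
    by (rule Maclaurin_sin_bound)
  then have "sin t \<ge> t - t ^ 3 / 6"
    using assms(1) abs_ge_minus_self[of "sin t - t"]
    by (simp add: sin_coeff_def eval_nat_numeral field_simps)
  moreover have "t ^ 3 \<le> t * 2 ^ 2"
    using assms pi_less_4 mult_mono[of t 2 t 2]
    by (auto simp: power3_eq_cube power2_eq_square mult.assoc intro!: mult_left_mono)
  ultimately show ?thesis by simp
qed

text \<open>This is the dominating function for the passage to the unit circle; it is compared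
  with powers of \<open>t\<close> and of \<open>pi - t\<close>.\<close>
lemma sin_powr_integrable:
  assumes "0 \<le> b" "b < 1"
  shows "(\<lambda>t. (2 / sin t) powr b) integrable_on {0<..<pi}"
proof -
  define h where "h = (\<lambda>t. 6 powr b * (t powr (- b) + (pi - t) powr (- b)))"
  have i1: "(\<lambda>t. t powr (- b)) integrable_on {0..pi}"
    using has_integral_powr_from_0[of "- b" pi] assms by (auto simp: integrable_on_def)
  then have "(\<lambda>t. (- t) powr (- b)) integrable_on {- pi..0}"
    using Henstock_Kurzweil_Integration.integrable_reflect_real[of "\<lambda>t. t powr (- b)" pi 0] by simp
  then have i2: "(\<lambda>t. (pi - t) powr (- b)) integrable_on {0..pi}"
    using integrable_shift_real_ivl[of "\<lambda>t. (- t) powr (- b)" "- pi" 0 "- pi"] by simp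
  have h: "h integrable_on {0<..<pi}"
    unfolding h_def integrable_on_open_interval_real
    by (intro integrable_on_mult_right integrable_add i1 i2)
  have bound: "norm ((2 / sin t) powr b) \<le> h t" if t: "t \<in> {0<..<pi}" for t
  proof -
    have *: "(2 / s) powr b \<le> 6 powr b * x powr (- b)" if "x / 3 \<le> s" "x > 0" for s x :: real
    proof -
      have "2 / s \<le> 6 / x" using that by (simp add: field_simps)
      then have "(2 / s) powr b \<le> (6 / x) powr b"
        using that assms by (intro powr_mono2) auto
      then show ?thesis using that by (simp add: powr_divide powr_minus field_simps)
    qed
    show ?thesis
    proof (cases "t \<le> pi / 2")
      case True
      then have "(2 / sin t) powr b \<le> 6 powr b * t powr (- b)"
        using t by (intro * sin_ge_third) auto
      then show ?thesis unfolding h_def by (simp add: distrib_left add_increasing2)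
    next
      case False
      then have "(pi - t) / 3 \<le> sin t"
        using sin_ge_third[of "pi - t"] t by simp
      then have "(2 / sin t) powr b \<le> 6 powr b * (pi - t) powr (- b)"
        using t by (intro *) auto
      then show ?thesis unfolding h_def by (simp add: distrib_left add_increasing)
    qed
  qed
  have "continuous_on {0<..<pi} (\<lambda>t. (2 / sin t) powr b)"
    by (intro continuous_intros) (use sin_gt_zero in force)+
  then have "(\<lambda>t. (2 / sin t) powr b) \<in> borel_measurable (lebesgue_on {0<..<pi})"
    by (intro continuous_imp_measurable_on_sets_lebesgue) auto
  then have "(\<lambda>t. (2 / sin t) powr b) absolutely_integrable_on {0<..<pi}"
    by (rule measurable_bounded_by_integrable_imp_absolutely_integrable[OF _ _ h bound]) auto
  then show ?thesis by (rule set_lebesgue_integral_eq_integral(1))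
qed

text \<open>The distance from 1 or -1 to the ray with direction \<open>t\<close> is at least
  \<open>sin t\<close>, uniformly in the radius.\<close>
lemma norm_one_minus_cis:
  assumes "\<rho> \<ge> 0" "0 < t" "t < pi"
  shows "sin t \<le> cmod (1 - of_real \<rho> * cis t)" "sin t \<le> cmod (1 + of_real \<rho> * cis t)"
proof -
  have *: "(sin t)\<^sup>2 \<le> (cmod (1 + of_real x * cis t))\<^sup>2" for x
  proof -
    have "(cmod (1 + of_real x * cis t))\<^sup>2 = (1 + x * cos t)\<^sup>2 + (x * sin t)\<^sup>2"
      unfolding cmod_power2 by simp
    also have "\<dots> = 1 + 2 * x * cos t + x\<^sup>2 * ((sin t)\<^sup>2 + (cos t)\<^sup>2)"
      unfolding power_mult_distrib power2_sum distrib_left by simp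
    also have "\<dots> = ((sin t)\<^sup>2 + (cos t)\<^sup>2) + 2 * x * cos t + x\<^sup>2"
      by (simp only: sin_cos_squared_add mult_1_right)
    also have "\<dots> = (sin t)\<^sup>2 + (x + cos t)\<^sup>2"
      by (simp add: power2_eq_square algebra_simps)
    finally have "(cmod (1 + of_real x * cis t))\<^sup>2 = (sin t)\<^sup>2 + (x + cos t)\<^sup>2" .
    then show ?thesis by simp
  qed
  show "sin t \<le> cmod (1 - of_real \<rho> * cis t)"
    using power2_le_imp_le[OF *[of "- \<rho>"] norm_ge_zero] by simp
  show "sin t \<le> cmod (1 + of_real \<rho> * cis t)"
    by (rule power2_le_imp_le[OF * norm_ge_zero])
qed

lemma norm_stieltjes_djouk_le:
  fixes \<rho> t :: real
  assumes "0 < \<rho>" "\<rho> < 1" "0 < t" "t < pi"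
  shows "cmod (stieltjes \<alpha> (\<rho> * cis t) * djouk (\<rho> * cis t) * (\<rho> * cis t))
           \<le> (2 / sin t) powr \<bar>2 * \<alpha> + 1\<bar>"
proof -
  define u where "u = complex_of_real \<rho> * cis t"
  have s: "0 < sin t" using assms by (intro sin_gt_zero)
  have n: "cmod u = \<rho>" using assms by (simp add: u_def norm_mult)
  then have u: "cmod u < 1" "u \<noteq> 0" "u \<noteq> 1" "u \<noteq> -1" using assms by auto
  have b1: "sin t \<le> cmod (1 - u)" "sin t \<le> cmod (1 + u)"
    using norm_one_minus_cis[of \<rho> t] assms by (auto simp: u_def)
  have b2: "cmod (1 - u) \<le> 2" "cmod (1 + u) \<le> 2"
    using norm_triangle_ineq4[of 1 u] norm_triangle_ineq[of 1 u] u by auto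
  define w where "w = cmod (cayley u)"
  have w: "w = cmod (1 - u) / cmod (1 + u)" by (simp add: w_def cayley_def norm_divide)
  have wp: "w > 0" unfolding w using b1 s by (intro divide_pos_pos) auto
  have w1: "w \<le> 2 / sin t" and w2: "1 / w \<le> 2 / sin t"
    unfolding w using b1 b2 s by (auto intro!: frac_le)
  have "cmod (stieltjes \<alpha> u * djouk u * u) = cmod (cayley u powr of_real (2 * \<alpha> + 1))"
    using u by (simp add: stieltjes_djouk)
  also have "\<dots> = w powr (2 * \<alpha> + 1)"
    by (simp add: norm_powr_complex w_def flip: of_real_mult of_real_add)
  also have "\<dots> \<le> (2 / sin t) powr \<bar>2 * \<alpha> + 1\<bar>"
  proof (cases "2 * \<alpha> + 1 \<ge> 0")
    case True
    then show ?thesis using w1 wp by (simp add: powr_mono2)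
  next
    case False
    have "w powr (2 * \<alpha> + 1) = (1 / w) powr \<bar>2 * \<alpha> + 1\<bar>"
      using False wp by (simp add: powr_divide powr_minus_divide[symmetric] add.commute)
    also have "\<dots> \<le> (2 / sin t) powr \<bar>2 * \<alpha> + 1\<bar>"
      using wp w2 by (intro powr_mono2) auto
    finally show ?thesis .
  qed
  finally show ?thesis by (simp add: u_def)
qed

text \<open>Residue theorem on a circle; the reflection symmetry makes the lower half contribute
  the complex conjugate of the upper half, so the sum of the residues is real.\<close>
lemma half_circle_residues:
  fixes F :: "complex \<Rightarrow> complex" and \<rho> :: real
  assumes "finite S" "S \<subseteq> ball 0 \<rho>" "0 < \<rho>" "\<rho> < 1"
    and holo: "F holomorphic_on ball 0 1 - S"
    and sym: "\<And>u. cmod u = \<rho> \<Longrightarrow> F (cnj u) = cnj (F u)"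
  shows "Re (integral {0..pi} (\<lambda>t. F (\<rho> * cis t) * (\<rho> * cis t))) = pi * Re (\<Sum>p\<in>S. residue F p)"
    and "Im (\<Sum>p\<in>S. residue F p) = 0"
proof -
  define g where "g = (\<lambda>t. F (\<rho> * cis t) * (\<rho> * cis t))"
  have "contour_integral (circlepath 0 \<rho>) F = 2 * pi * \<i> * (\<Sum>p\<in>S. winding_number (circlepath 0 \<rho>) p * residue F p)"
  proof (rule Residue_theorem[of "ball 0 1"])
    show "\<forall>z. z \<notin> ball 0 1 \<longrightarrow> winding_number (circlepath 0 \<rho>) z = 0"
      using assms by (intro allI impI winding_number_zero_outside[of _ "cball 0 \<rho>"]) auto
  qed (use assms in auto)
  also have "(\<Sum>p\<in>S. winding_number (circlepath 0 \<rho>) p * residue F p) = (\<Sum>p\<in>S. residue F p)"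
    using assms(2) by (intro sum.cong refl) (auto simp: winding_number_circlepath)
  also have "contour_integral (circlepath 0 \<rho>) F = integral {0..2*pi} (\<lambda>t. \<i> * g t)"
    unfolding circlepath_def by (subst contour_integral_part_circlepath_eq) (auto simp: g_def mult_ac)
  also have "\<dots> = \<i> * integral {0..2*pi} g" by simp
  finally have full: "integral {0..2*pi} g = 2 * pi * (\<Sum>p\<in>S. residue F p)" by simp
  have cont: "continuous_on A g" for A
  proof -
    have "continuous_on (ball 0 1 - S) F" using holo by (rule holomorphic_on_imp_continuous_on)
    then have "continuous_on A (\<lambda>t. F (\<rho> * cis t))"
      by (rule continuous_on_compose2) (use assms in \<open>auto intro!: continuous_intros simp: norm_mult\<close>)
    then show ?thesis unfolding g_def by (intro continuous_intros)
  qed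
  have per: "g (t + 2 * pi) = g t" for t by (simp add: g_def flip: cis_mult)
  have "integral {0..2*pi} g = integral {0..pi} g + integral {pi..2*pi} g"
    using Henstock_Kurzweil_Integration.integral_combine[of 0 pi "2*pi" g]
      integrable_continuous_interval[OF cont, of 0 "2*pi"] by simp
  also have "integral {pi..2*pi} g = integral {-pi..0} (\<lambda>t. g (t + 2 * pi))"
    using integral_shift_real_ivl[of pi "2*pi" "2*pi" g] by simp
  also have "\<dots> = integral {-pi..-0} (\<lambda>t. (\<lambda>s. g (- s)) (- t))" by (simp add: per)
  also have "\<dots> = integral {0..pi} (\<lambda>s. g (- s))" by (rule Henstock_Kurzweil_Integration.integral_reflect_real)
  also have "(\<lambda>s. g (- s)) = (\<lambda>s. cnj (g s))"
  proof
    fix s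
    have "complex_of_real \<rho> * cis (- s) = cnj (\<rho> * cis s)" by (simp add: cis_cnj)
    then show "g (- s) = cnj (g s)"
      unfolding g_def using sym[of "\<rho> * cis s"] assms by (simp add: norm_mult)
  qed
  finally have "integral {0..2*pi} g = 2 * of_real (Re (integral {0..pi} g))"
    by (simp add: Henstock_Kurzweil_Integration.integral_cnj[symmetric] complex_add_cnj)
  then have "Re (integral {0..2*pi} g) = 2 * Re (integral {0..pi} g)"
    "Im (integral {0..2*pi} g) = 0" by simp_all
  then show "Re (integral {0..pi} (\<lambda>t. F (\<rho> * cis t) * (\<rho> * cis t))) = pi * Re (\<Sum>p\<in>S. residue F p)"
    "Im (\<Sum>p\<in>S. residue F p) = 0"
    unfolding full g_def[symmetric] by simp_all
qed

text \<open>A function whose singularities over the endpoints are no worse than those of the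
  Stieltjes transform may be integrated along the cut itself: the circles of radius
  \<open>\<rho> < 1\<close> correspond to contours around \<open>[-1, 1]\<close>, dominated
  convergence lets \<open>\<rho>\<close> tend to 1, and on the unit circle the substitution
  \<open>x = cos t\<close> leaves the integral of the imaginary part over \<open>(-1,
  1)\<close>. The point 0 represents infinity and always counts as singular, since the
  differential of the map has a pole there.\<close>
theorem boundary_residues:
  fixes Y :: "complex \<Rightarrow> complex"
  assumes \<alpha>: "-1 < \<alpha>" "\<alpha> < 0"
    and S: "finite S" "S \<subseteq> ball 0 1" "0 \<in> S"
    and holo: "Y holomorphic_on ball 0 1 - S"
    and cont: "continuous_on (cball 0 1 - S - {1, -1}) Y"
    and sym: "\<And>u. u \<in> ball 0 1 - S \<Longrightarrow> Y (cnj u) = cnj (Y u)"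
    and \<rho>: "\<rho> < 1" and bound: "\<And>u. \<rho> \<le> cmod u \<Longrightarrow> u \<in> ball 0 1 - S \<Longrightarrow> cmod (Y u) \<le> C * (1 + cmod (stieltjes \<alpha> u))"
    and y: "\<And>t. 0 < t \<Longrightarrow> t < pi \<Longrightarrow> Im (Y (cis t)) = y (cos t)"
  shows "y absolutely_integrable_on {-1<..<1}"
    and "of_real (integral {-1<..<1} y) = - pi * (\<Sum>p\<in>S. residue (\<lambda>u. Y u * djouk u) p)"
proof -
  define F where "F = (\<lambda>u. Y u * djouk u)"
  define \<rho>0 where "\<rho>0 = Max (insert \<rho> (insert (1/2) (cmod ` S)))"
  have \<rho>0: "\<rho>0 < 1" "\<rho> \<le> \<rho>0" "1/2 \<le> \<rho>0" "\<And>p. p \<in> S \<Longrightarrow> cmod p \<le> \<rho>0"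
  proof -
    have fin: "finite (insert \<rho> (insert (1/2) (cmod ` S)))" using S by simp
    show "\<rho>0 < 1" unfolding \<rho>0_def using S \<rho> by (subst Max_less_iff[OF fin]) auto
    show "\<rho> \<le> \<rho>0" "1/2 \<le> \<rho>0" unfolding \<rho>0_def by (rule Max_ge[OF fin], simp)+
    show "cmod p \<le> \<rho>0" if "p \<in> S" for p
      unfolding \<rho>0_def by (rule Max_ge[OF fin]) (use that in simp)
  qed
  define r where "r = (\<lambda>n::nat. 1 - (1 - \<rho>0) / real (n + 2))"
  have r: "\<rho>0 < r n" "r n < 1" for n
  proof -
    have "(1 - \<rho>0) / real (n + 2) < (1 - \<rho>0) / 1"
      using \<rho>0(1) by (intro divide_strict_left_mono) auto
    then show "\<rho>0 < r n" by (simp add: r_def)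
    show "r n < 1" using \<rho>0(1) by (simp add: r_def)
  qed
  have r_lim: "r \<longlonglongrightarrow> 1"
  proof -
    have "(\<lambda>n. inverse (real (Suc (n + 1)))) \<longlonglongrightarrow> 0"
      by (rule LIMSEQ_ignore_initial_segment[OF LIMSEQ_inverse_real_of_nat])
    then have "(\<lambda>n. 1 - (1 - \<rho>0) * inverse (real (Suc (n + 1)))) \<longlonglongrightarrow> 1 - (1 - \<rho>0) * 0"
      by (intro tendsto_intros)
    then show ?thesis by (simp add: r_def[abs_def] divide_inverse)
  qed
  define G where "G = (\<lambda>\<rho> t. F (of_real \<rho> * cis t) * (of_real \<rho> * cis t))"
  define b where "b = \<bar>2 * \<alpha> + 1\<bar>"
  define C' where "C' = max C 0"
  have holoF: "F holomorphic_on ball 0 1 - S"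
    unfolding F_def djouk_def[abs_def] using S(3)
    by (intro holomorphic_intros holo) auto
  have contF: "continuous_on (cball 0 1 - S - {1, -1}) F"
    unfolding F_def djouk_def[abs_def] using S(3)
    by (intro continuous_intros cont) auto
  have int_r: "Re (integral {0..pi} (G (r n))) = pi * Re (\<Sum>p\<in>S. residue F p)"
    and real_res: "Im (\<Sum>p\<in>S. residue F p) = 0" for n
  proof -
    have S': "S \<subseteq> ball 0 (r n)"
    proof
      fix p assume "p \<in> S"
      then show "p \<in> ball 0 (r n)" using \<rho>0(4)[of p] r(1)[of n] by simp
    qed
    have r0: "0 < r n" using r(1)[of n] \<rho>0(3) by simp
    have sy: "F (cnj u) = cnj (F u)" if u: "cmod u = r n" for u
    proof -
      have "u \<in> ball 0 1 - S" using S' r(2)[of n] u by auto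
      then show "F (cnj u) = cnj (F u)" by (simp add: F_def sym djouk_cnj)
    qed
    show "Re (integral {0..pi} (G (r n))) = pi * Re (\<Sum>p\<in>S. residue F p)"
      "Im (\<Sum>p\<in>S. residue F p) = 0"
      unfolding G_def using half_circle_residues[OF S(1) S' r0 r(2) holoF sy] by auto
  qed
  (* The bound comes from the summand 1 through the boundedness of the differential, and from
     the transform through the softened singularity. *)
  have nG: "norm (G (r n) t) \<le> C' * (2 + (2 / sin t) powr b)" if t: "t \<in> {0<..<pi}" for n t
  proof -
    define u where "u = complex_of_real (r n) * cis t"
    have rn: "0 < r n" "1/2 \<le> r n" using r(1)[of n] \<rho>0(3) by auto
    have cu: "cmod u = r n" using rn by (simp add: u_def norm_mult)
    then have u: "u \<in> ball 0 1 - S" "\<rho> \<le> cmod u" "u \<noteq> 0"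
      using r[of n] \<rho>0 S(3) by (auto simp: dist_norm) (metis not_less)
    have d: "cmod (djouk u * u) \<le> 2"
    proof -
      have "djouk u * u = (u - 1 / u) / 2"
        using u(3) by (simp add: djouk_def field_simps power2_eq_square)
      then have "cmod (djouk u * u) = cmod (u - 1 / u) / 2"
        by (simp only: norm_divide norm_numeral)
      also have "\<dots> \<le> (cmod u + 1 / cmod u) / 2"
        using norm_triangle_ineq4[of u "1 / u"] by (simp add: norm_divide)
      finally have "cmod (djouk u * u) \<le> (r n + 1 / r n) / 2" unfolding cu .
      moreover have "1 / r n \<le> 2" using rn divide_left_mono[of "1/2" "r n" 1] by simp
      then have "(r n + 1 / r n) / 2 \<le> (1 + 2) / 2"
        using r(2)[of n] by (intro divide_right_mono add_mono) auto
      ultimately show ?thesis by simp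
    qed
    have "G (r n) t = Y u * (djouk u * u)"
      by (simp only: G_def F_def u_def mult.assoc)
    then have "norm (G (r n) t) = cmod (Y u) * cmod (djouk u * u)"
      by (simp only: norm_mult)
    also have "\<dots> \<le> (C' * (1 + cmod (stieltjes \<alpha> u))) * cmod (djouk u * u)"
    proof (rule mult_right_mono)
      have "C * (1 + cmod (stieltjes \<alpha> u)) \<le> C' * (1 + cmod (stieltjes \<alpha> u))"
        by (intro mult_right_mono) (auto simp: C'_def)
      then show "cmod (Y u) \<le> C' * (1 + cmod (stieltjes \<alpha> u))"
        using bound[OF u(2,1)] by (rule order_trans[rotated])
    qed simp
    also have "\<dots> = C' * (cmod (djouk u * u) + cmod (stieltjes \<alpha> u * djouk u * u))"
      by (simp only: norm_mult mult.assoc distrib_left distrib_right mult_1_left)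
    also have "\<dots> \<le> C' * (2 + (2 / sin t) powr b)"
      unfolding b_def using t rn r(2)[of n] d
      by (intro mult_left_mono add_mono) (auto simp: C'_def u_def intro!: norm_stieltjes_djouk_le)
    finally show ?thesis .
  qed
  have lim: "(\<lambda>n. G (r n) t) \<longlonglongrightarrow> G 1 t" if t: "t \<in> {0<..<pi}" for t
  proof -
    define A where "A = cball 0 1 - S - {1, -1 :: complex}"
    have "sin t > 0" using t by (simp add: sin_gt_zero)
    then have A1: "cis t \<in> A"
      using S(2) by (auto simp: A_def complex_eq_iff)
    have An: "complex_of_real (r n) * cis t \<in> A" for n
    proof -
      have "cmod (of_real (r n) * cis t) = r n" using r(1)[of n] \<rho>0(3) by (simp add: norm_mult)
      then show ?thesis using r[of n] \<rho>0(4) by (fastforce simp: A_def)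
    qed
    have l: "(\<lambda>n. complex_of_real (r n) * cis t) \<longlonglongrightarrow> of_real 1 * cis t"
      by (intro tendsto_intros r_lim)
    have "continuous_on A F" using contF by (simp add: A_def)
    then have "(\<lambda>n. F (of_real (r n) * cis t)) \<longlonglongrightarrow> F (of_real 1 * cis t)"
      by (rule continuous_on_tendsto_compose[OF _ l]) (use A1 An in auto)
    then show ?thesis unfolding G_def by (intro tendsto_mult l)
  qed
  (* On the circle the differential contributes the factor i sin t, which exchanges real and
     imaginary parts. *)
  have ReG1: "Re (G 1 t) = - (sin t * y (cos t))" if "t \<in> {0<..<pi}" for t
  proof -
    have "G 1 t = Y (cis t) * (djouk (cis t) * cis t)" by (simp add: G_def F_def mult.assoc)
    then show ?thesis using y[of t] that by (simp add: djouk_cis)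
  qed
  have h_int: "(\<lambda>t. C' * (2 + (2 / sin t) powr b)) integrable_on {0<..<pi}"
    using \<alpha> by (intro integrable_on_mult_right integrable_add sin_powr_integrable)
      (auto simp: b_def abs_if integrable_on_open_interval_real)
  have f_int: "(\<lambda>t. Re (G (r n) t)) integrable_on {0<..<pi}"
    and f_val: "integral {0<..<pi} (\<lambda>t. Re (G (r n) t)) = pi * Re (\<Sum>p\<in>S. residue F p)" for n
  proof -
    have cR: "continuous_on {0..pi} (G (r n))"
    proof -
      have *: "complex_of_real (r n) * cis t \<in> ball 0 1 - S" for t
      proof -
        have "cmod (of_real (r n) * cis t) = r n" using r(1)[of n] \<rho>0(3) by (simp add: norm_mult)
        then show ?thesis using r[of n] \<rho>0(4) by fastforce
      qed
      have "continuous_on {0..pi} (\<lambda>t. F (of_real (r n) * cis t))"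
        by (rule continuous_on_compose2[OF holomorphic_on_imp_continuous_on[OF holoF]])
           (use * in \<open>auto intro!: continuous_intros\<close>)
      then show ?thesis unfolding G_def by (intro continuous_intros)
    qed
    then have i: "G (r n) integrable_on {0..pi}" by (rule integrable_continuous_interval)
    show "(\<lambda>t. Re (G (r n) t)) integrable_on {0<..<pi}"
      unfolding integrable_on_open_interval_real
      using cR by (intro integrable_continuous_interval continuous_intros)
    have "integral {0..pi} (\<lambda>t. Re (G (r n) t)) = Re (integral {0..pi} (G (r n)))"
      using integral_linear[OF i bounded_linear_Re] by (simp add: o_def)
    then show "integral {0<..<pi} (\<lambda>t. Re (G (r n) t)) = pi * Re (\<Sum>p\<in>S. residue F p)"
      using int_r by (simp add: integral_open_interval_real)
  qed
  have le: "norm (Re (G (r n) t)) \<le> C' * (2 + (2 / sin t) powr b)" if "t \<in> {0<..<pi}" for n t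
    using nG[OF that, of n] abs_Re_le_cmod[of "G (r n) t"] by simp
  have conv: "(\<lambda>n. Re (G (r n) t)) \<longlonglongrightarrow> - (sin t * y (cos t))" if "t \<in> {0<..<pi}" for t
    using tendsto_Re[OF lim[OF that]] ReG1[OF that] by simp
  have intY: "(\<lambda>t. - (sin t * y (cos t))) integrable_on {0<..<pi}"
    by (rule dominated_convergence(1)[OF f_int h_int le conv])
  have "(\<lambda>k. integral {0<..<pi} (\<lambda>t. Re (G (r k) t)))
      \<longlonglongrightarrow> integral {0<..<pi} (\<lambda>t. - (sin t * y (cos t)))"
    by (rule dominated_convergence(2)[OF f_int h_int le conv])
  then have "integral {0<..<pi} (\<lambda>t. - (sin t * y (cos t))) = pi * Re (\<Sum>p\<in>S. residue F p)"
    unfolding f_val by (simp add: LIMSEQ_const_iff)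
  then have val: "integral {0<..<pi} (\<lambda>t. sin t * y (cos t)) = - pi * Re (\<Sum>p\<in>S. residue F p)"
    by simp
  have "norm (- (sin t * y (cos t))) \<le> C' * (2 + (2 / sin t) powr b)" if "t \<in> {0<..<pi}" for t
  proof (rule LIMSEQ_le_const2)
    show "(\<lambda>n. norm (Re (G (r n) t))) \<longlonglongrightarrow> norm (- (sin t * y (cos t)))"
      by (intro tendsto_norm conv that)
    show "\<exists>N. \<forall>n\<ge>N. norm (Re (G (r n) t)) \<le> C' * (2 + (2 / sin t) powr b)"
      using le[OF that] by blast
  qed
  then have "(\<lambda>t. - (sin t * y (cos t))) absolutely_integrable_on {0<..<pi}"
    by (rule absolutely_integrable_integrable_bound[OF _ intY h_int])
  then have abs: "(\<lambda>t. sin t * y (cos t)) absolutely_integrable_on {0<..<pi}"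
    using set_integrable_mult_right[of "-1" lebesgue "{0<..<pi}" "\<lambda>t. - (sin t * y (cos t))"] by simp
  have s: "\<bar>- sin t\<bar> * y (cos t) = sin t * y (cos t)" if "t \<in> {0<..<pi}" for t
    using that sin_gt_zero[of t] by simp
  have "(\<lambda>t. \<bar>- sin t\<bar> * y (cos t)) absolutely_integrable_on {0<..<pi}"
    using abs by (rule absolutely_integrable_spike[of _ _ "{}"]) (use s in auto)
  moreover have "integral {0<..<pi} (\<lambda>t. \<bar>- sin t\<bar> * y (cos t)) = - pi * Re (\<Sum>p\<in>S. residue F p)"
    using integral_cong[of "{0<..<pi}", OF s] val by simp
  moreover have "(cos has_field_derivative - sin t) (at t within {0<..<pi})" for t
    by (auto intro!: derivative_eq_intros)
  moreover have "inj_on cos {0<..<pi}"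
    by (auto intro!: inj_onI cos_inj_pi)
  ultimately have "y absolutely_integrable_on cos ` {0<..<pi} \<and>
      integral (cos ` {0<..<pi}) y = - pi * Re (\<Sum>p\<in>S. residue F p)"
    using has_absolute_integral_change_of_variables_1'[of "{0<..<pi}" cos "\<lambda>t. - sin t" y
        "- pi * Re (\<Sum>p\<in>S. residue F p)"] by auto
  moreover have "cos ` {0<..<pi} = {-1<..<1}"
  proof (intro equalityI subsetI)
    fix x assume "x \<in> cos ` {0<..<pi}"
    then obtain t where "0 < t" "t < pi" "x = cos t" by auto
    then show "x \<in> {-1<..<1}"
      using cos_monotone_0_pi[of t pi] cos_monotone_0_pi[of 0 t] by auto
  next
    fix x :: real assume "x \<in> {-1<..<1}"
    then have "cos (arccos x) = x" "arccos x \<in> {0<..<pi}"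
      using arccos_lt_bounded[of x] by auto
    then show "x \<in> cos ` {0<..<pi}" by (metis imageI)
  qed
  ultimately show "y absolutely_integrable_on {-1<..<1}"
    "of_real (integral {-1<..<1} y) = - pi * (\<Sum>p\<in>S. residue (\<lambda>u. Y u * djouk u) p)"
    using real_res by (auto simp: F_def complex_eq_iff)
qed

section \<open>Functions of the second kind\<close>

lemma jouk_holomorphic [holomorphic_intros]: "0 \<notin> S \<Longrightarrow> jouk holomorphic_on S"
  unfolding jouk_def[abs_def] by (auto intro!: holomorphic_intros)

lemma jouk_continuous_on [continuous_intros]: "0 \<notin> S \<Longrightarrow> continuous_on S jouk"
  unfolding jouk_def[abs_def] by (auto intro!: continuous_intros)

lemma cpoly_jouk_bounded:
  obtains B where "B \<ge> 0" "\<And>u. 1/2 \<le> cmod u \<Longrightarrow> cmod u \<le> 1 \<Longrightarrow> cmod (cpoly p (jouk u)) \<le> B"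
proof -
  define K where "K = cball 0 1 - ball (0::complex) (1/2)"
  have "compact K" unfolding K_def by (intro compact_diff) auto
  moreover have "continuous_on K (\<lambda>u. cpoly p (jouk u))"
    unfolding K_def by (intro continuous_intros) auto
  ultimately have "bounded ((\<lambda>u. cpoly p (jouk u)) ` K)"
    by (intro compact_imp_bounded compact_continuous_image)
  then obtain B where B: "B > 0" "\<And>u. u \<in> K \<Longrightarrow> cmod (cpoly p (jouk u)) \<le> B"
    by (auto simp: bounded_pos)
  show ?thesis
  proof (rule that[of B])
    fix u :: complex assume "1/2 \<le> cmod u" "cmod u \<le> 1"
    then show "cmod (cpoly p (jouk u)) \<le> B" by (intro B(2)) (auto simp: K_def)
  qed (use B in simp)
qed

lemma eventually_jouk_neq_0: "eventually (\<lambda>u. jouk u \<noteq> 0) (at 0)"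
proof -
  have "eventually (\<lambda>u::complex. u \<in> ball 0 1 - {0}) (at 0)"
    using eventually_at_in_open[of "ball 0 1" "0::complex"] by simp
  then show ?thesis by eventually_elim (auto dest: jouk_neq_0)
qed

text \<open>Decay at infinity is measured by powers of \<^const>\<open>jouk\<close>, which is
  the original variable.\<close>
lemma jouk_power_tendsto_less:
  assumes "((\<lambda>u. jouk u ^ n * f u) \<longlongrightarrow> L) (at 0)" "i < n"
  shows "((\<lambda>u. jouk u ^ i * f u) \<longlongrightarrow> 0) (at 0)"
proof -
  have "((\<lambda>u. (jouk u ^ n * f u) * (1 / jouk u) ^ (n - i)) \<longlongrightarrow> L * 0 ^ (n - i)) (at 0)"
    by (intro tendsto_intros assms inverse_jouk_tendsto)
  moreover have "eventually (\<lambda>u. (jouk u ^ n * f u) * (1 / jouk u) ^ (n - i) = jouk u ^ i * f u) (at 0)"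
    using eventually_jouk_neq_0
    by eventually_elim (use assms(2) in \<open>simp add: power_divide power_diff\<close>)
  ultimately show ?thesis
    using assms(2) Lim_transform_eventually by (fastforce simp: power_0_left)
qed

lemma ttr_poly_jouk_tendsto:
  "((\<lambda>u. cpoly (ttr_poly b a n) (jouk u) / jouk u ^ n) \<longlongrightarrow> 1) (at 0)"
proof (induction n rule: less_induct)
  case (less k)
  consider "k = 0" | "k = Suc 0" | n where "k = Suc (Suc n)" by (metis not0_implies_Suc)
  then show ?case
  proof cases
    case 2
    have "((\<lambda>u. 1 - b 0 * (1 / jouk u)) \<longlongrightarrow> 1 - of_real (b 0) * 0) (at 0)"
      by (intro tendsto_intros inverse_jouk_tendsto)
    moreover have "eventually (\<lambda>u. 1 - b 0 * (1 / jouk u) = (jouk u - b 0) / jouk u) (at 0)"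
      using eventually_jouk_neq_0 by eventually_elim (simp add: field_simps)
    ultimately show ?thesis using 2 Lim_transform_eventually by fastforce
  next
    case (3 n)
    let ?T = "\<lambda>n u. cpoly (ttr_poly b a n) (jouk u)"
    have "((\<lambda>u. (1 - b (Suc n) * (1 / jouk u)) * (?T (Suc n) u / jouk u ^ Suc n)
        - of_real ((a (Suc n))\<^sup>2) * (1 / jouk u)\<^sup>2 * (?T n u / jouk u ^ n))
        \<longlongrightarrow> (1 - of_real (b (Suc n)) * 0) * 1 - of_real ((a (Suc n))\<^sup>2) * 0\<^sup>2 * 1) (at 0)"
      using 3 by (intro tendsto_intros inverse_jouk_tendsto less.IH) auto
    then have "((\<lambda>u. (1 - b (Suc n) * (1 / jouk u)) * (?T (Suc n) u / jouk u ^ Suc n)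
        - of_real ((a (Suc n))\<^sup>2) * (1 / jouk u)\<^sup>2 * (?T n u / jouk u ^ n)) \<longlongrightarrow> 1) (at 0)"
      by simp
    moreover have "eventually (\<lambda>u. (1 - b (Suc n) * (1 / jouk u)) * (?T (Suc n) u / jouk u ^ Suc n)
        - of_real ((a (Suc n))\<^sup>2) * (1 / jouk u)\<^sup>2 * (?T n u / jouk u ^ n)
        = ?T k u / jouk u ^ k) (at 0)"
      using eventually_jouk_neq_0
    proof eventually_elim
      case (elim u)
      have "(1 - B * (1 / z)) * (p / z ^ Suc n) - A * (1 / z)\<^sup>2 * (q / z ^ n)
          = ((z - B) * p - A * q) / z ^ Suc (Suc n)" if "z \<noteq> 0" for z B p A q :: complex
        using that by (simp add: field_simps power2_eq_square)
      from this[OF elim] show ?case by (simp only: 3) (simp add: algebra_simps)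
    qed
    ultimately show ?thesis by (rule Lim_transform_eventually)
  qed simp
qed

text \<open>A function that vanishes at infinity is analytic there, so it is of order \<open>1 /
  z\<close>. Orders of decay are raised one at a time with this lemma.\<close>
lemma removable_jouk_limit:
  assumes holo: "f holomorphic_on ball 0 1 - {0}" and lim: "(f \<longlongrightarrow> 0) (at 0)"
  obtains L where "((\<lambda>u. jouk u * f u) \<longlongrightarrow> L) (at 0)"
proof -
  define g where "g = (\<lambda>u. if u = 0 then 0 else f u)"
  have "g holomorphic_on ball 0 1"
  proof (rule no_isolated_singularity'[of "{0}"])
    show "g holomorphic_on ball 0 1 - {0}"
      using holo by (rule holomorphic_transform) (auto simp: g_def)
    show "(g \<longlongrightarrow> g z) (at z within ball 0 1)" if "z \<in> {0}" for z
    proof -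
      have "(g \<longlongrightarrow> 0) (at 0)"
        using lim by (rule Lim_transform_eventually) (auto simp: g_def eventually_at_filter)
      then show ?thesis using that by (auto simp: g_def intro: tendsto_within_subset)
    qed
  qed auto
  then have "(g has_field_derivative deriv g 0) (at 0)"
    by (rule holomorphic_derivI) auto
  then have "((\<lambda>u. (g u - g 0) / (u - 0)) \<longlongrightarrow> deriv g 0) (at 0)"
    by (simp only: has_field_derivative_iff)
  then have "((\<lambda>u. (u\<^sup>2 + 1) / 2 * ((g u - g 0) / (u - 0))) \<longlongrightarrow> (0\<^sup>2 + 1) / 2 * deriv g 0) (at 0)"
    by (intro tendsto_intros) auto
  moreover have "eventually (\<lambda>u. (u\<^sup>2 + 1) / 2 * ((g u - g 0) / (u - 0)) = jouk u * f u) (at 0)"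
    by (auto simp: g_def jouk_def eventually_at_filter field_simps power2_eq_square)
  ultimately have "((\<lambda>u. jouk u * f u) \<longlongrightarrow> (0\<^sup>2 + 1) / 2 * deriv g 0) (at 0)"
    by (rule Lim_transform_eventually)
  then show ?thesis by (rule that)
qed

text \<open>The residue at infinity: the differential of the Joukowski map is \<open>- jouk u /
  u\<close> to leading order.\<close>
lemma residue_at_0:
  assumes "open S" "0 \<in> S" "F holomorphic_on S - {0}" "((\<lambda>u. jouk u * F u) \<longlongrightarrow> L) (at 0)"
  shows "residue (\<lambda>u. F u * djouk u) 0 = - L"
proof (rule residue_simple'[OF assms(1,2)])
  show "(\<lambda>u. F u * djouk u) holomorphic_on S - {0}"
    unfolding djouk_def by (intro holomorphic_intros assms) auto
  have "((\<lambda>u. (jouk u * F u) * (djouk u * u / jouk u)) \<longlongrightarrow> L * -1) (at 0)"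
    by (intro tendsto_intros assms djouk_over_jouk_tendsto)
  moreover have "eventually (\<lambda>u. (jouk u * F u) * (djouk u * u / jouk u) = F u * djouk u * (u - 0)) (at 0)"
    using eventually_jouk_neq_0 by eventually_elim simp
  ultimately show "((\<lambda>u. F u * djouk u * (u - 0)) \<longlongrightarrow> - L) (at 0)"
    using Lim_transform_eventually by fastforce
qed

text \<open>For a family orthogonal with respect to the Grosjean weight this is the integral of
  \<open>P k x / (z - x)\<close> against the weight, written with the numerator
  polynomials.\<close>
definition second_kind :: "real \<Rightarrow> (nat \<Rightarrow> real) \<Rightarrow> (nat \<Rightarrow> real) \<Rightarrow> nat \<Rightarrow> complex \<Rightarrow> complex" where
  "second_kind \<alpha> b a k u = cpoly (ttr_poly b a k) (jouk u) * stieltjes \<alpha> u - cpoly (ttr_numerator b a k) (jouk u)"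

lemma second_kind_rec:
  "second_kind \<alpha> b a (Suc (Suc k)) u = (jouk u - b (Suc k)) * second_kind \<alpha> b a (Suc k) u
     - of_real ((a (Suc k))\<^sup>2) * second_kind \<alpha> b a k u"
  by (simp add: second_kind_def algebra_simps)

lemma set_integral_eq_integral:
  fixes y :: "real \<Rightarrow> real"
  assumes "y absolutely_integrable_on S" "y \<in> borel_measurable borel" "S \<in> sets borel"
  shows "set_integrable lborel S y" "(LINT x:S|lborel. y x) = integral S y"
proof -
  have m: "(\<lambda>x. indicator S x *\<^sub>R y x) \<in> borel_measurable lborel"
    using assms by (intro borel_measurable_scaleR borel_measurable_indicator) auto
  show "set_integrable lborel S y"
    using assms(1) integrable_completion[OF m] by (simp add: set_integrable_def)
  have "(LINT x:S|lborel. y x) = (LINT x:S|lebesgue. y x)"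
    using integral_completion[OF m] by (simp add: set_lebesgue_integral_def)
  then show "(LINT x:S|lborel. y x) = integral S y"
    using set_lebesgue_integral_eq_integral(2)[OF assms(1)] by simp
qed

lemma measurable_poly [measurable]: "poly p \<in> borel_measurable borel" for p :: "real poly"
  by (intro borel_measurable_continuous_onI continuous_intros)

lemma measurable_jacobi [measurable]: "jacobi \<alpha> \<in> borel_measurable borel"
  unfolding jacobi_def[abs_def] by measurable

lemma jacobi_nonneg: "0 \<le> jacobi \<alpha> x" by (simp add: jacobi_def)

lemma grosjean_weight_eq:
  assumes "-1 < x" "x < 1"
  shows "grosjean_weight \<alpha> x = sin (- pi * \<alpha>) / pi * jacobi \<alpha> x"
  using assms by (simp add: grosjean_weight_def jacobi_def powr_divide powr_add)

lemma grosjean_LINT: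
  assumes \<alpha>: "-1 < \<alpha>" "\<alpha> < 0" and f: "f \<in> borel_measurable borel"
  shows "(LINT x|grosjean_measure \<alpha>. f x)
     = (LINT x:{-1<..<1}|lborel. f x * (sin (- pi * \<alpha>) * jacobi \<alpha> x)) / pi"
proof -
  have s: "sin (- pi * \<alpha>) > 0"
    using \<alpha> mult_strict_left_mono[of "- \<alpha>" 1 pi] by (intro sin_gt_zero) (auto intro: mult_pos_neg)
  have "(LINT x|grosjean_measure \<alpha>. f x)
     = (LINT x|lborel. (grosjean_weight \<alpha> x * indicator {-1<..<1} x) *\<^sub>R f x)"
    unfolding grosjean_measure_def
  proof (rule integral_density)
    show "(\<lambda>x. grosjean_weight \<alpha> x * indicator {-1<..<1} x) \<in> borel_measurable lborel"
      unfolding grosjean_weight_def by measurable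
    show "AE x in lborel. 0 \<le> grosjean_weight \<alpha> x * indicator {-1<..<1} x"
    proof (intro AE_I2)
      fix x
      have "0 \<le> sin (- pi * \<alpha>) / pi * jacobi \<alpha> x"
        using s by (intro mult_nonneg_nonneg divide_nonneg_pos jacobi_nonneg) auto
      then show "0 \<le> grosjean_weight \<alpha> x * indicator {-1<..<1} x"
        by (cases "-1 < x \<and> x < 1") (simp_all only: grosjean_weight_eq, simp_all)
    qed
  qed (use f in simp)
  also have "\<dots> = (LINT x|lborel. indicator {-1<..<1} x *\<^sub>R (f x * (sin (- pi * \<alpha>) * jacobi \<alpha> x)) / pi)"
  proof (intro Bochner_Integration.integral_cong refl)
    fix x
    show "(grosjean_weight \<alpha> x * indicator {-1<..<1} x) *\<^sub>R f x
        = indicator {-1<..<1} x *\<^sub>R (f x * (sin (- pi * \<alpha>) * jacobi \<alpha> x)) / pi"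
      by (cases "-1 < x \<and> x < 1") (simp_all only: grosjean_weight_eq, simp_all)
  qed
  finally show ?thesis by (simp add: set_lebesgue_integral_def)
qed

lemma Im_stieltjes_cis:
  assumes "0 < t" "t < pi"
  shows "Im (stieltjes \<alpha> (cis t)) = sin (- pi * \<alpha>) * jacobi \<alpha> (cos t)"
  using stieltjes_cis[OF assms] by (simp add: mult.commute)

text \<open>Along the cut the imaginary part of the function of the second kind is the
  polynomial times the weight, so the residue at infinity is an orthogonality integral.\<close>
lemma second_kind_residue_0:
  assumes \<alpha>: "-1 < \<alpha>" "\<alpha> < 0" and G: "grosjean_polys \<alpha> (ttr_poly b a)" and "j \<noteq> k"
  shows "residue (\<lambda>u. cpoly (ttr_poly b a j) (jouk u) * second_kind \<alpha> b a k u * djouk u) 0 = 0"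
proof -
  define Y where "Y = (\<lambda>u. cpoly (ttr_poly b a j) (jouk u) * second_kind \<alpha> b a k u)"
  define y where "y = (\<lambda>x. poly (ttr_poly b a j) x * poly (ttr_poly b a k) x * (sin (- pi * \<alpha>) * jacobi \<alpha> x))"
  obtain B1 where B1: "B1 \<ge> 0" "\<And>u. 1/2 \<le> cmod u \<Longrightarrow> cmod u \<le> 1 \<Longrightarrow>
      cmod (cpoly (ttr_poly b a j * ttr_poly b a k) (jouk u)) \<le> B1"
    using cpoly_jouk_bounded by blast
  obtain B2 where B2: "B2 \<ge> 0" "\<And>u. 1/2 \<le> cmod u \<Longrightarrow> cmod u \<le> 1 \<Longrightarrow>
      cmod (cpoly (ttr_poly b a j * ttr_numerator b a k) (jouk u)) \<le> B2"
    using cpoly_jouk_bounded by blast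
  have 1: "Y holomorphic_on ball 0 1 - {0}"
    unfolding Y_def second_kind_def
    by (intro holomorphic_intros holomorphic_on_subset[OF stieltjes_holomorphic]) auto
  have 2: "continuous_on (cball 0 1 - {0} - {1, -1}) Y"
    unfolding Y_def second_kind_def
    by (intro continuous_intros continuous_on_subset[OF stieltjes_continuous_on]) auto
  have 3: "Y (cnj u) = cnj (Y u)" if "u \<in> ball 0 1 - {0}" for u
    proof -
    have "stieltjes \<alpha> (cnj u) = cnj (stieltjes \<alpha> u)" using that by (intro stieltjes_cnj) auto
    then show ?thesis by (simp add: Y_def second_kind_def jouk_cnj)
  qed
  have 4: "cmod (Y u) \<le> (B1 + B2) * (1 + cmod (stieltjes \<alpha> u))"
    if "1/2 \<le> cmod u" "u \<in> ball 0 1 - {0}" for u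
  proof -
    have "Y u = cpoly (ttr_poly b a j * ttr_poly b a k) (jouk u) * stieltjes \<alpha> u
        - cpoly (ttr_poly b a j * ttr_numerator b a k) (jouk u)"
      by (simp add: Y_def second_kind_def algebra_simps)
    also have "cmod \<dots> \<le> cmod (cpoly (ttr_poly b a j * ttr_poly b a k) (jouk u)) * cmod (stieltjes \<alpha> u)
        + cmod (cpoly (ttr_poly b a j * ttr_numerator b a k) (jouk u))"
      by (metis norm_triangle_ineq4 norm_mult)
    also have "\<dots> \<le> B1 * cmod (stieltjes \<alpha> u) + B2"
      using that B1 B2 by (intro add_mono mult_right_mono) auto
    also have "\<dots> \<le> (B1 + B2) * (1 + cmod (stieltjes \<alpha> u))"
      using B1(1) B2(1) by (simp add: algebra_simps)
    finally show ?thesis .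
  qed
  have 5: "Im (Y (cis t)) = y (cos t)" if "0 < t" "t < pi" for t
    using that unfolding Y_def y_def second_kind_def by (simp add: jouk_cis Im_stieltjes_cis)
  have int: "y absolutely_integrable_on {-1<..<1}"
    and val: "of_real (integral {-1<..<1} y) = - pi * (\<Sum>p\<in>{0}. residue (\<lambda>u. Y u * djouk u) p)"
    using boundary_residues[where Y=Y and y=y and S="{0}" and \<rho>="1/2" and C="B1+B2", OF \<alpha> _ _ _ 1 2 3 _ 4 5]
    by auto
  have "y \<in> borel_measurable borel" unfolding y_def by measurable
  then have "integral {-1<..<1} y = (LINT x:{-1<..<1}|lborel. y x)"
    using set_integral_eq_integral(2)[OF int] by simp
  also have "\<dots> = pi * (LINT x|grosjean_measure \<alpha>. poly (ttr_poly b a j) x * poly (ttr_poly b a k) x)"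
    by (subst grosjean_LINT[OF \<alpha>]) (auto simp: y_def)
  also have "\<dots> = 0"
    using G \<open>j \<noteq> k\<close> by (simp add: grosjean_polys_def monic_orthogonal_polys_def orthogonal_polys_def)
  finally show ?thesis using val by (simp add: Y_def)
qed

lemma second_kind_holomorphic: "second_kind \<alpha> b a k holomorphic_on ball 0 1 - {0}"
  unfolding second_kind_def[abs_def]
  by (intro holomorphic_intros holomorphic_on_subset[OF stieltjes_holomorphic]) auto

text \<open>Orthogonality to all lower degrees gives decay of order \<open>k + 1\<close>: as
  long as the order is at most \<open>k\<close>, its leading coefficient is a residue at
  infinity of the function times a monic polynomial of lower degree, hence zero, and the order
  rises by one. Only for \<open>k\<close> at most 1 does the start, decay to zero, need the
  transform itself; afterwards the recurrence gives it.\<close>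
lemma second_kind_limit_exists:
  assumes \<alpha>: "-1 < \<alpha>" "\<alpha> < 0" and G: "grosjean_polys \<alpha> (ttr_poly b a)"
  shows "\<exists>L. ((\<lambda>u. jouk u ^ Suc k * second_kind \<alpha> b a k u) \<longlongrightarrow> L) (at 0)"
proof (induction k rule: less_induct)
  case (less k)
  have gst0: "(stieltjes \<alpha> \<longlongrightarrow> 0) (at 0)"
    using jouk_power_tendsto_less[of 1 "stieltjes \<alpha>" 1 0] jouk_stieltjes_tendsto by simp
  have base: "(second_kind \<alpha> b a k \<longlongrightarrow> 0) (at 0)"
  proof -
    consider "k = 0" | "k = Suc 0" | n where "k = Suc (Suc n)" by (metis not0_implies_Suc)
    then show ?thesis
    proof cases
      case 1
      then show ?thesis using gst0 by (simp add: second_kind_def[abs_def])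
    next
      case 2
      have "((\<lambda>u. jouk u * stieltjes \<alpha> u - b 0 * stieltjes \<alpha> u - 1) \<longlongrightarrow> 1 - of_real (b 0) * 0 - 1) (at 0)"
        by (intro tendsto_intros jouk_stieltjes_tendsto gst0)
      then show ?thesis using 2 by (simp add: second_kind_def[abs_def] algebra_simps)
    next
      case (3 n)
      obtain L1 where L1: "((\<lambda>u. jouk u ^ Suc (Suc n) * second_kind \<alpha> b a (Suc n) u) \<longlongrightarrow> L1) (at 0)"
        using less.IH[of "Suc n"] 3 by auto
      obtain L2 where L2: "((\<lambda>u. jouk u ^ Suc n * second_kind \<alpha> b a n u) \<longlongrightarrow> L2) (at 0)"
        using less.IH[of n] 3 by auto
      have "((\<lambda>u. jouk u ^ 1 * second_kind \<alpha> b a (Suc n) u - b (Suc n) * (jouk u ^ 0 * second_kind \<alpha> b a (Suc n) u)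
         - of_real ((a (Suc n))\<^sup>2) * (jouk u ^ 0 * second_kind \<alpha> b a n u))
         \<longlongrightarrow> 0 - of_real (b (Suc n)) * 0 - of_real ((a (Suc n))\<^sup>2) * 0) (at 0)"
        by (intro tendsto_intros jouk_power_tendsto_less[OF L1] jouk_power_tendsto_less[OF L2]) auto
      then show ?thesis
        unfolding 3 second_kind_rec[abs_def] by (simp add: algebra_simps)
    qed
  qed
  have holo: "(\<lambda>u. jouk u ^ j * second_kind \<alpha> b a k u) holomorphic_on ball 0 1 - {0}" for j
    by (intro holomorphic_intros second_kind_holomorphic) auto
  have "((\<lambda>u. jouk u ^ j * second_kind \<alpha> b a k u) \<longlongrightarrow> 0) (at 0)" if "j \<le> k" for j
    using that
  proof (induction j)
    case 0
    then show ?case using base by simp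
  next
    case (Suc j)
    (* L is the coefficient that obstructs decay of the next order. *)
    obtain L where L: "((\<lambda>u. jouk u * (jouk u ^ j * second_kind \<alpha> b a k u)) \<longlongrightarrow> L) (at 0)"
      using removable_jouk_limit[OF holo Suc.IH] Suc.prems by auto
    have "((\<lambda>u. (cpoly (ttr_poly b a j) (jouk u) / jouk u ^ j) *
        (jouk u * (jouk u ^ j * second_kind \<alpha> b a k u))) \<longlongrightarrow> 1 * L) (at 0)"
      by (intro tendsto_mult ttr_poly_jouk_tendsto L)
    moreover have "eventually (\<lambda>u. (cpoly (ttr_poly b a j) (jouk u) / jouk u ^ j) *
        (jouk u * (jouk u ^ j * second_kind \<alpha> b a k u))
        = jouk u * (cpoly (ttr_poly b a j) (jouk u) * second_kind \<alpha> b a k u)) (at 0)"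
      using eventually_jouk_neq_0 by eventually_elim simp
    ultimately have "((\<lambda>u. jouk u * (cpoly (ttr_poly b a j) (jouk u) * second_kind \<alpha> b a k u)) \<longlongrightarrow> 1 * L) (at 0)"
      by (rule Lim_transform_eventually)
    then have "residue (\<lambda>u. cpoly (ttr_poly b a j) (jouk u) * second_kind \<alpha> b a k u * djouk u) 0 = - (1 * L)"
      by (intro residue_at_0[of "ball 0 1"] holomorphic_intros second_kind_holomorphic) auto
    then have "L = 0"
      using second_kind_residue_0[OF \<alpha> G, of j k] Suc.prems by simp
    then show ?case using L by (simp add: mult.assoc)
  qed
  from this[of k] obtain L where "((\<lambda>u. jouk u * (jouk u ^ k * second_kind \<alpha> b a k u)) \<longlongrightarrow> L) (at 0)"
    using removable_jouk_limit[OF holo] by auto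
  then show ?case by (auto simp: mult.assoc)
qed

text \<open>The leading coefficients are the squared norms. They are read off the recurrence, in
  which the two terms of lower order must cancel.\<close>
lemma second_kind_limit:
  assumes \<alpha>: "-1 < \<alpha>" "\<alpha> < 0" and G: "grosjean_polys \<alpha> (ttr_poly b a)"
  shows "((\<lambda>u. jouk u ^ Suc k * second_kind \<alpha> b a k u) \<longlongrightarrow> of_real (\<Prod>j=1..k. (a j)\<^sup>2)) (at 0)"
proof (induction k)
  case 0
  then show ?case using jouk_stieltjes_tendsto by (simp add: second_kind_def)
next
  case (Suc k)
  let ?E = "second_kind \<alpha> b a"
  obtain L1 where L1: "((\<lambda>u. jouk u ^ Suc (Suc k) * ?E (Suc k) u) \<longlongrightarrow> L1) (at 0)"
    using second_kind_limit_exists[OF assms] by blast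
  obtain L2 where L2: "((\<lambda>u. jouk u ^ Suc (Suc (Suc k)) * ?E (Suc (Suc k)) u) \<longlongrightarrow> L2) (at 0)"
    using second_kind_limit_exists[OF assms] by blast
  have "((\<lambda>u. jouk u ^ Suc k * ?E (Suc (Suc k)) u + b (Suc k) * (jouk u ^ Suc k * ?E (Suc k) u)
      + of_real ((a (Suc k))\<^sup>2) * (jouk u ^ Suc k * ?E k u))
      \<longlongrightarrow> 0 + of_real (b (Suc k)) * 0 + of_real ((a (Suc k))\<^sup>2) * of_real (\<Prod>j=1..k. (a j)\<^sup>2)) (at 0)"
    by (intro tendsto_intros jouk_power_tendsto_less[OF L1] jouk_power_tendsto_less[OF L2] Suc.IH) auto
  moreover have "jouk u ^ Suc k * ?E (Suc (Suc k)) u + b (Suc k) * (jouk u ^ Suc k * ?E (Suc k) u)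
      + of_real ((a (Suc k))\<^sup>2) * (jouk u ^ Suc k * ?E k u) = jouk u ^ Suc (Suc k) * ?E (Suc k) u" for u
    unfolding second_kind_rec by (simp add: algebra_simps)
  ultimately show ?case by (simp add: mult.commute)
qed

section \<open>The real line outside the interval\<close>

text \<open>Counting the elements of \<open>R\<close> below a point is strictly increasing on
  \<open>Y\<close> and takes at most \<open>card R + 1\<close> values.\<close>
lemma card_le_Suc_card_separating:
  fixes Y R :: "real set"
  assumes "finite R" and sep: "\<And>x y. x \<in> Y \<Longrightarrow> y \<in> Y \<Longrightarrow> x < y \<Longrightarrow> \<exists>z\<in>R. x < z \<and> z < y"
  shows "finite Y" "card Y \<le> Suc (card R)"
proof -
  define f where "f = (\<lambda>y. card {z\<in>R. z < y})"
  have less: "f x < f y" if "x \<in> Y" "y \<in> Y" "x < y" for x y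
  proof -
    from sep[OF that] obtain z where "z \<in> R" "x < z" "z < y" by blast
    then have "z \<in> {z\<in>R. z < y}" "z \<notin> {z\<in>R. z < x}" by simp_all
    moreover have "{z\<in>R. z < x} \<subseteq> {z\<in>R. z < y}" using that by auto
    ultimately have "{z\<in>R. z < x} \<subset> {z\<in>R. z < y}" by blast
    then show ?thesis unfolding f_def using assms(1) by (intro psubset_card_mono) auto
  qed
  have "inj_on f Y"
  proof (rule inj_onI)
    fix x y assume "x \<in> Y" "y \<in> Y" "f x = f y"
    then show "x = y" using less[of x y] less[of y x] by (cases x y rule: linorder_cases) auto
  qed
  moreover have "f ` Y \<subseteq> {..card R}"
    unfolding f_def using assms(1) by (auto intro!: card_mono)
  ultimately show "finite Y" "card Y \<le> Suc (card R)"
    using inj_on_finite[of f Y "{..card R}"] card_inj_on_le[of f Y "{..card R}"] by auto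
qed

lemma stieltjes_real_DERIV:
  assumes "x \<notin> {-1..1}"
  shows "(stieltjes_real \<alpha> has_real_derivative stieltjes_real \<alpha> x * (2 * \<alpha> + 1 - x) / (x\<^sup>2 - 1)) (at x)"
proof -
  have x2: "x\<^sup>2 - 1 = (x - 1) * (x + 1)" by (simp add: power2_eq_square algebra_simps)
  consider "x > 1" | "x < -1" using assms by force
  then show ?thesis
  proof cases
    case 1
    have "((\<lambda>y. (y - 1) powr \<alpha> / (y + 1) powr (\<alpha> + 1)) has_real_derivative
        (\<alpha> * (x - 1) powr (\<alpha> - 1) * (x + 1) powr (\<alpha> + 1)
         - (x - 1) powr \<alpha> * ((\<alpha> + 1) * (x + 1) powr \<alpha>)) / ((x + 1) powr (\<alpha> + 1) * (x + 1) powr (\<alpha> + 1))) (at x)"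
      using 1 by (auto intro!: derivative_eq_intros)
    moreover have "(\<alpha> * (x - 1) powr (\<alpha> - 1) * (x + 1) powr (\<alpha> + 1)
         - (x - 1) powr \<alpha> * ((\<alpha> + 1) * (x + 1) powr \<alpha>)) / ((x + 1) powr (\<alpha> + 1) * (x + 1) powr (\<alpha> + 1))
        = stieltjes_real \<alpha> x * (2 * \<alpha> + 1 - x) / (x\<^sup>2 - 1)"
    proof -
      define p q where "p = (x - 1) powr \<alpha>" and "q = (x + 1) powr \<alpha>"
      have pq: "p > 0" "q > 0" using 1 by (auto simp: p_def q_def)
      have e: "(x - 1) powr (\<alpha> - 1) = p / (x - 1)" "(x + 1) powr (\<alpha> + 1) = q * (x + 1)"
        using 1 by (simp_all add: p_def q_def powr_diff powr_add)
      have "(\<alpha> * (p / s) * (q * t) - p * ((\<alpha> + 1) * q)) / (q * t * (q * t))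
          = p / (q * t) * (\<alpha> * t - (\<alpha> + 1) * s) / (s * t)"
        if "s > 0" "t > 0" for s t
        using that pq by (simp add: field_simps)
      from this[of "x - 1" "x + 1"]
      have "(\<alpha> * (p / (x - 1)) * (q * (x + 1)) - p * ((\<alpha> + 1) * q)) / (q * (x + 1) * (q * (x + 1)))
          = p / (q * (x + 1)) * (\<alpha> * (x + 1) - (\<alpha> + 1) * (x - 1)) / ((x - 1) * (x + 1))"
        using 1 by simp
      moreover have "\<alpha> * (x + 1) - (\<alpha> + 1) * (x - 1) = 2 * \<alpha> + 1 - x"
        by (simp add: algebra_simps)
      moreover have "stieltjes_real \<alpha> x = p / (q * (x + 1))"
        using 1 e(2) by (simp add: stieltjes_real_def p_def)
      ultimately show ?thesis
        unfolding e x2 p_def[symmetric] q_def[symmetric] by metis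
    qed
    ultimately have "((\<lambda>y. (y - 1) powr \<alpha> / (y + 1) powr (\<alpha> + 1)) has_real_derivative
        stieltjes_real \<alpha> x * (2 * \<alpha> + 1 - x) / (x\<^sup>2 - 1)) (at x)" by metis
    then show ?thesis
      by (rule has_field_derivative_transform_within_open[of _ _ _ "{1<..}"])
         (use 1 in \<open>auto simp: stieltjes_real_def\<close>)
  next
    case 2
    have "((\<lambda>y. - ((1 - y) powr \<alpha> / (- 1 - y) powr (\<alpha> + 1))) has_real_derivative
        - ((- (\<alpha> * (1 - x) powr (\<alpha> - 1)) * (- 1 - x) powr (\<alpha> + 1)
         - (1 - x) powr \<alpha> * (- ((\<alpha> + 1) * (- 1 - x) powr \<alpha>))) / ((- 1 - x) powr (\<alpha> + 1) * (- 1 - x) powr (\<alpha> + 1)))) (at x)"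
      using 2 by (auto intro!: derivative_eq_intros)
    moreover have "- ((- (\<alpha> * (1 - x) powr (\<alpha> - 1)) * (- 1 - x) powr (\<alpha> + 1)
         - (1 - x) powr \<alpha> * (- ((\<alpha> + 1) * (- 1 - x) powr \<alpha>))) / ((- 1 - x) powr (\<alpha> + 1) * (- 1 - x) powr (\<alpha> + 1)))
        = stieltjes_real \<alpha> x * (2 * \<alpha> + 1 - x) / (x\<^sup>2 - 1)"
    proof -
      define p q where "p = (1 - x) powr \<alpha>" and "q = (- 1 - x) powr \<alpha>"
      have pq: "p > 0" "q > 0" using 2 by (auto simp: p_def q_def)
      have e: "(1 - x) powr (\<alpha> - 1) = p / (1 - x)" "(- 1 - x) powr (\<alpha> + 1) = q * (- 1 - x)"
        using 2 by (simp_all add: p_def q_def powr_diff powr_add)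
      have "- ((- (\<alpha> * (p / s)) * (q * t) - p * (- ((\<alpha> + 1) * q))) / (q * t * (q * t)))
          = - (p / (q * t)) * ((\<alpha> + 1) * s - \<alpha> * t) / (s * t)"
        if "s > 0" "t > 0" for s t
        using that pq by (simp add: field_simps)
      from this[of "1 - x" "- 1 - x"] have "- ((- (\<alpha> * (p / (1 - x))) * (q * (- 1 - x)) - p * (- ((\<alpha> + 1) * q))) / (q * (- 1 - x) * (q * (- 1 - x))))
          = - (p / (q * (- 1 - x))) * ((\<alpha> + 1) * (1 - x) - \<alpha> * (- 1 - x)) / ((1 - x) * (- 1 - x))"
        using 2 by simp
      moreover have "(1 - x) * (- 1 - x) = (x - 1) * (x + 1)"
        "(\<alpha> + 1) * (1 - x) - \<alpha> * (- 1 - x) = 2 * \<alpha> + 1 - x" by (simp_all add: algebra_simps)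
      moreover have "stieltjes_real \<alpha> x = - (p / (q * (- 1 - x)))"
      proof -
        have "\<bar>x - 1\<bar> = 1 - x" "\<bar>x + 1\<bar> = - 1 - x" "sgn x = -1" using 2 by auto
        then show ?thesis unfolding stieltjes_real_def by (simp only: e(2) p_def)
      qed
      ultimately show ?thesis
        unfolding e x2 p_def[symmetric] q_def[symmetric] by metis
    qed
    ultimately have "((\<lambda>y. - ((1 - y) powr \<alpha> / (- 1 - y) powr (\<alpha> + 1))) has_real_derivative
        stieltjes_real \<alpha> x * (2 * \<alpha> + 1 - x) / (x\<^sup>2 - 1)) (at x)" by metis
    then show ?thesis
    proof (rule has_field_derivative_transform_within_open[of _ _ _ "{..<-1}"])
      fix y :: real assume "y \<in> {..<-1}"
      then have "\<bar>y - 1\<bar> = 1 - y" "\<bar>y + 1\<bar> = - 1 - y" "sgn y = -1" by auto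
      then show "- ((1 - y) powr \<alpha> / (- 1 - y) powr (\<alpha> + 1)) = stieltjes_real \<alpha> y"
        by (simp add: stieltjes_real_def)
    qed (use 2 in auto)
  qed
qed

text \<open>The logarithmic derivative has the numerator \<open>2 * \<alpha> + 1 - x\<close>,
  whose sign is opposite to that of the transform since \<open>\<bar>2 * \<alpha> + 1\<bar> <
  1\<close>.\<close>
lemma stieltjes_real_deriv_neg:
  assumes "-1 < \<alpha>" "\<alpha> < 0" "x \<notin> {-1..1}"
  shows "stieltjes_real \<alpha> x * (2 * \<alpha> + 1 - x) / (x\<^sup>2 - 1) < 0"
proof -
  have x2: "x\<^sup>2 - 1 > 0"
    using assms(3) abs_le_square_iff[of x 1] by (auto simp: not_le[symmetric] abs_le_iff)
  consider "x > 1" | "x < -1" using assms by force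
  then have "stieltjes_real \<alpha> x * (2 * \<alpha> + 1 - x) < 0"
  proof cases
    case 1
    then have "stieltjes_real \<alpha> x > 0" by (simp add: stieltjes_real_def)
    then show ?thesis using 1 assms by (intro mult_pos_neg) auto
  next
    case 2
    then have "stieltjes_real \<alpha> x < 0" by (simp add: stieltjes_real_def)
    then show ?thesis using 2 assms by (intro mult_neg_pos) auto
  qed
  then show ?thesis using x2 by (rule divide_neg_pos)
qed

definition jouk_inv :: "real \<Rightarrow> real" where "jouk_inv x = x - sgn x * sqrt (x\<^sup>2 - 1)"

lemma jouk_inv:
  assumes "x \<notin> {-1..1}"
  shows "jouk_real (jouk_inv x) = x" "jouk_inv x \<noteq> 0" "\<bar>jouk_inv x\<bar> < 1"
proof -
  have x2: "x\<^sup>2 - 1 > 0"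
    using assms abs_le_square_iff[of x 1] by (auto simp: not_le[symmetric] abs_le_iff)
  define s where "s = sqrt (x\<^sup>2 - 1)"
  have s: "s > 0" "s\<^sup>2 = x\<^sup>2 - 1" using x2 by (auto simp: s_def)
  have sg: "sgn x * sgn x = 1" using assms by (auto simp: sgn_if)
  have uj: "jouk_inv x = x - sgn x * s" by (simp add: jouk_inv_def s_def)
  define v where "v = x + sgn x * s"
  have prod: "jouk_inv x * v = 1"
  proof -
    have "jouk_inv x * v = x\<^sup>2 - (sgn x * sgn x) * s\<^sup>2"
      unfolding uj v_def by (simp add: power2_eq_square algebra_simps)
    then show ?thesis using s sg by simp
  qed
  then show "jouk_inv x \<noteq> 0" by auto
  have "1 / jouk_inv x = v" using prod by (metis \<open>jouk_inv x \<noteq> 0\<close> nonzero_mult_div_cancel_left)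
  then show "jouk_real (jouk_inv x) = x" by (simp add: jouk_real_def v_def uj)
  have "\<bar>v\<bar> > 1"
    using assms s(1) by (auto simp: v_def sgn_if)
  then show "\<bar>jouk_inv x\<bar> < 1"
    using prod abs_mult[of "jouk_inv x" v] \<open>jouk_inv x \<noteq> 0\<close>
    by (metis abs_ge_zero abs_one less_le_trans mult_less_cancel_left1 mult_less_cancel_left2 not_less zero_less_abs_iff)
qed

lemma jouk_real_outside:
  assumes "\<bar>u\<bar> < 1" "u \<noteq> 0"
  shows "jouk_real u \<notin> {-1..1}"
proof -
  have "(jouk_real u)\<^sup>2 - 1 = ((1 - u\<^sup>2) / (2 * u))\<^sup>2"
    using assms by (simp add: jouk_real_def field_simps power2_eq_square)
  also have "\<dots> > 0"
    using assms by (auto simp: power2_eq_1_iff)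
  finally have "(jouk_real u)\<^sup>2 > 1" by simp
  then show ?thesis
    using abs_le_square_iff[of "jouk_real u" 1] by (auto simp: abs_le_iff)
qed

text \<open>Two points with the same image are equal or reciprocal, and reciprocals do not both
  lie in the disc.\<close>
lemma jouk_inj:
  assumes "cmod u < 1" "cmod v < 1" "u \<noteq> 0" "v \<noteq> 0" "jouk u = jouk v"
  shows "u = v"
proof -
  have "u + 1 / u = v + 1 / v" using assms(5) unfolding jouk_def by (metis divide_cancel_right zero_neq_numeral)
  then have "(u - v) * (u * v - 1) = 0"
    using assms(3,4) by (simp add: field_simps)
  moreover have "u * v \<noteq> 1"
  proof
    assume "u * v = 1"
    then have "cmod u * cmod v = 1" by (metis norm_mult norm_one)
    moreover have "cmod u * cmod v < 1 * 1" using assms by (intro mult_strict_mono) auto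
    ultimately show False by simp
  qed
  ultimately show ?thesis by simp
qed

text \<open>At both endpoints the transform is infinite, but less so than a simple pole. This is
  what excludes point masses at -1 and 1.\<close>
lemma stieltjes_at_endpoints:
  assumes \<alpha>: "-1 < \<alpha>" "\<alpha> < 0" and p: "p = 1 \<or> p = -1"
  defines "F \<equiv> at p within ball (0::complex) 1"
  shows "((\<lambda>u. 1 / stieltjes \<alpha> u) \<longlongrightarrow> 0) F" "((\<lambda>u. (jouk u - p) * stieltjes \<alpha> u) \<longlongrightarrow> 0) F"
proof -
  have ev: "eventually (\<lambda>u. u \<in> ball 0 1 \<and> u \<noteq> 0) F"
  proof -
    have "eventually (\<lambda>u. u \<in> - {0}) F" unfolding F_def
      using p by (intro eventually_at_topological[THEN iffD2] exI[of _ "- {0}"]) auto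
    moreover have "eventually (\<lambda>u. u \<in> ball 0 1) F"
      unfolding F_def by (simp add: eventually_at_filter)
    ultimately show ?thesis by eventually_elim auto
  qed
  have ngst: "cmod (stieltjes \<alpha> u) = cmod (1 - u) powr (2 * \<alpha>) * cmod (1 + u) powr (- (2 * \<alpha> + 2)) * (2 * cmod u)"
    if u: "u \<in> ball 0 1" for u
  proof -
    have "u \<noteq> 1" "u \<noteq> -1" using u by auto
    then have pos: "cmod (1 - u) > 0" "cmod (1 + u) > 0" by (auto simp: one_plus_eq_0_iff)
    have "cmod (stieltjes \<alpha> u) = cmod (cayley u) powr (2 * \<alpha>) * (2 * cmod u / (cmod (1 + u))\<^sup>2)"
      unfolding stieltjes_alt[OF \<open>u \<noteq> 1\<close> \<open>u \<noteq> -1\<close>]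
      by (simp only: norm_mult norm_divide norm_power norm_powr_complex norm_numeral
          Re_complex_of_real Im_complex_of_real) simp
    also have "cmod (cayley u) = cmod (1 - u) / cmod (1 + u)" by (simp add: cayley_def norm_divide)
    also have "(cmod (1 - u) / cmod (1 + u)) powr (2 * \<alpha>) * (2 * cmod u / (cmod (1 + u))\<^sup>2)
       = cmod (1 - u) powr (2 * \<alpha>) / (cmod (1 + u) powr (2 * \<alpha>) * (cmod (1 + u))\<^sup>2) * (2 * cmod u)"
      using pos by (simp add: powr_divide)
    also have "cmod (1 + u) powr (2 * \<alpha>) * (cmod (1 + u))\<^sup>2 = cmod (1 + u) powr (2 * \<alpha> + 2)"
      using pos by (simp add: powr_add)
    finally show ?thesis unfolding powr_minus_divide by simp
  qed
  have lim_id: "((\<lambda>u. u) \<longlongrightarrow> p) F" unfolding F_def by (rule tendsto_ident_at)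
  have p0: "p \<noteq> 0" using p by auto
  have g1: "((\<lambda>u. cmod (1 - u) powr s * cmod (1 + u) powr t) \<longlongrightarrow> 0) F"
    if "p = 1 \<and> s > 0 \<or> p = -1 \<and> t > 0" for s t
  proof -
    have l1: "((\<lambda>u. cmod (1 - u)) \<longlongrightarrow> cmod (1 - p)) F" "((\<lambda>u. cmod (1 + u)) \<longlongrightarrow> cmod (1 + p)) F"
      by (intro tendsto_norm tendsto_diff tendsto_add tendsto_const lim_id)+
    show ?thesis
    proof (cases "p = 1")
      case True
      then have "((\<lambda>u. cmod (1 - u) powr s) \<longlongrightarrow> 0 powr s) F"
        using that l1(1) by (intro tendsto_powr2) auto
      moreover have "((\<lambda>u. cmod (1 + u) powr t) \<longlongrightarrow> cmod (1 + p) powr t) F"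
        using True by (intro tendsto_powr l1(2) tendsto_const) auto
      ultimately show ?thesis using tendsto_mult by fastforce
    next
      case False
      then have pm: "p = -1" using p by simp
      then have "((\<lambda>u. cmod (1 + u) powr t) \<longlongrightarrow> 0 powr t) F"
        using that l1(2) by (intro tendsto_powr2) auto
      moreover have "((\<lambda>u. cmod (1 - u) powr s) \<longlongrightarrow> cmod (1 - p) powr s) F"
        using pm by (intro tendsto_powr l1(1) tendsto_const) auto
      ultimately show ?thesis using tendsto_mult by fastforce
    qed
  qed
  have "((\<lambda>u. cmod (1 - u) powr (- (2 * \<alpha>)) * cmod (1 + u) powr (2 * \<alpha> + 2) * (1 / (2 * cmod u)))
      \<longlongrightarrow> 0 * (1 / (2 * cmod p))) F"
    using p \<alpha> p0 by (intro tendsto_mult g1 tendsto_divide tendsto_const tendsto_norm lim_id) auto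
  moreover have "eventually (\<lambda>u. cmod (1 - u) powr (- (2 * \<alpha>)) * cmod (1 + u) powr (2 * \<alpha> + 2) * (1 / (2 * cmod u))
      = cmod (1 / stieltjes \<alpha> u)) F"
    using ev
  proof eventually_elim
    case (elim u)
    then show ?case
      by (simp only: norm_divide ngst norm_one powr_minus_divide) (simp add: divide_simps powr_minus_divide)
  qed
  ultimately have "((\<lambda>u. cmod (1 / stieltjes \<alpha> u)) \<longlongrightarrow> 0) F"
    using Lim_transform_eventually by fastforce
  then show "((\<lambda>u. 1 / stieltjes \<alpha> u) \<longlongrightarrow> 0) F" by (rule tendsto_norm_zero_cancel)
  have jp: "jouk u - p = (1 - p * u)\<^sup>2 / (2 * u)" if "u \<noteq> 0" for u
    using p that by (auto simp: jouk_def field_simps power2_eq_square)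
  define s where "s = (if p = 1 then 2 * \<alpha> + 2 else 2 * \<alpha>)"
  define t where "t = (if p = 1 then - (2 * \<alpha> + 2) else - (2 * \<alpha>))"
  have "((\<lambda>u. cmod (1 - u) powr s * cmod (1 + u) powr t) \<longlongrightarrow> 0) F"
    using p \<alpha> by (intro g1) (auto simp: s_def t_def)
  moreover have "eventually (\<lambda>u. cmod (1 - u) powr s * cmod (1 + u) powr t
      = cmod ((jouk u - p) * stieltjes \<alpha> u)) F"
    using ev
  proof eventually_elim
    case (elim u)
    then have "u \<noteq> 1" "u \<noteq> -1" and ub: "u \<in> ball 0 1" and u0: "u \<noteq> 0" by auto
    then have pos: "cmod (1 - u) > 0" "cmod (1 + u) > 0" by (auto simp: one_plus_eq_0_iff)
    have cancel: "A / (2 * c) * (B * (2 * c)) = A * B" if "c \<noteq> 0" for A B c :: real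
      using that by simp
    have sq: "x powr (c + 2) = x powr c * x\<^sup>2" "x powr (- (c + 2)) * x\<^sup>2 = x powr (- c)" if "x > 0" for x c :: real
      unfolding powr_minus_divide powr_add using that by simp_all
    have "cmod ((jouk u - p) * stieltjes \<alpha> u) = (cmod (1 - p * u))\<^sup>2 / (2 * cmod u) * cmod (stieltjes \<alpha> u)"
      by (simp only: jp[OF u0] norm_mult norm_divide norm_power norm_numeral)
    also have "\<dots> = (cmod (1 - p * u))\<^sup>2 * (cmod (1 - u) powr (2 * \<alpha>) * cmod (1 + u) powr (- (2 * \<alpha> + 2)))"
      unfolding ngst[OF ub] using u0 by (intro cancel) simp
    also have "\<dots> = cmod (1 - u) powr s * cmod (1 + u) powr t"
    proof (cases "p = 1")
      case True
      then show ?thesis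
        unfolding s_def t_def if_P[OF True] sq(1)[OF pos(1)] by (simp only: True mult_ac mult_1)
    next
      case False
      then have "p = -1" using p by simp
      have "(cmod (1 + u))\<^sup>2 * (A * cmod (1 + u) powr (- (2 * \<alpha> + 2)))
          = A * cmod (1 + u) powr (- (2 * \<alpha>))" for A
        using sq(2)[OF pos(2), of "2 * \<alpha>"] by (simp only: mult_ac)
      moreover have "cmod (1 - p * u) = cmod (1 + u)" using \<open>p = -1\<close> by simp
      ultimately show ?thesis
        unfolding s_def t_def if_not_P[OF False] by (simp only:)
    qed
    finally show ?case by (rule sym)
  qed
  ultimately have "((\<lambda>u. cmod ((jouk u - p) * stieltjes \<alpha> u)) \<longlongrightarrow> 0) F"
    by (rule Lim_transform_eventually)
  then show "((\<lambda>u. (jouk u - p) * stieltjes \<alpha> u) \<longlongrightarrow> 0) F" by (rule tendsto_norm_zero_cancel)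
qed

section \<open>The Weyl quotient of the anti-associated family\<close>

text \<open>The sequences are those of the anti-associated family of order \<open>Suc m\<close>,
  indexed from 0; the original family starts at index \<open>Suc m\<close>. The coefficient
  \<open>a (Suc m)\<close> is the parameter that couples the new rows to the old matrix.\<close>
locale antiassociation =
  fixes \<alpha> :: real and b a :: "nat \<Rightarrow> real" and m :: nat
  assumes alpha: "-1 < \<alpha>" "\<alpha> < 0"
    and a_pos: "\<And>k. k \<ge> 1 \<Longrightarrow> a k > 0"
    and grosjean: "grosjean_polys \<alpha> (ttr_poly (\<lambda>k. b (k + Suc m)) (\<lambda>k. a (k + Suc m)))"
begin

abbreviation "T \<equiv> ttr_poly b a"
abbreviation "V \<equiv> ttr_numerator b a"

text \<open>The squared norm of the monic polynomial of degree \<open>n\<close>.\<close>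
definition \<gamma> :: "nat \<Rightarrow> real" where "\<gamma> n = (\<Prod>k=1..n. (a k)\<^sup>2)"

text \<open>The continued fraction of the new matrix is cut after \<open>Suc m\<close> levels
  and the transform of the old matrix is put in the tail. Numerator and denominator of the
  resulting quotient give the Stieltjes transform of the new measure.\<close>
definition weyl_den :: "complex \<Rightarrow> complex" where
  "weyl_den u = cpoly (T (Suc m)) (jouk u) - of_real ((a (Suc m))\<^sup>2) * cpoly (T m) (jouk u) * stieltjes \<alpha> u"

definition weyl_num :: "complex \<Rightarrow> complex" where
  "weyl_num u = cpoly (V (Suc m)) (jouk u) - of_real ((a (Suc m))\<^sup>2) * cpoly (V m) (jouk u) * stieltjes \<alpha> u"

text \<open>The denominator times the function of the second kind of the new family.\<close>
definition second_num :: "nat \<Rightarrow> complex \<Rightarrow> complex" where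
  "second_num n u = cpoly (T n) (jouk u) * weyl_num u - cpoly (V n) (jouk u) * weyl_den u"

definition weyl_den_real :: "real \<Rightarrow> real" where
  "weyl_den_real x = poly (T (Suc m)) x - (a (Suc m))\<^sup>2 * poly (T m) x * stieltjes_real \<alpha> x"

definition zeros :: "real set" where "zeros = {x. x \<notin> {-1..1} \<and> weyl_den_real x = 0}"

definition wronskian :: "real \<Rightarrow> real" where
  "wronskian x = poly (pderiv (T (Suc m)) * T m - T (Suc m) * pderiv (T m)) x"

text \<open>The residue of the quotient at a zero of the denominator, simplified by means of the
  Casoratian; in this form it is visibly positive.\<close>
definition mass :: "real \<Rightarrow> real" where
  "mass x = \<gamma> m / (wronskian x - (a (Suc m))\<^sup>2 * (poly (T m) x)\<^sup>2 * (stieltjes_real \<alpha> x * (2 * \<alpha> + 1 - x) / (x\<^sup>2 - 1)))"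

text \<open>The imaginary part of the quotient below the cut, divided by \<open>pi\<close>. Up
  to the normalisation of the polynomials it is the density of the theorem.\<close>
definition ac_density :: "real \<Rightarrow> real" where
  "ac_density x = sin (- pi * \<alpha>) / pi * jacobi \<alpha> x * \<gamma> (Suc m) /
     (cmod (of_real (poly (T (Suc m)) x)
        - of_real ((a (Suc m))\<^sup>2 * poly (T m) x * jacobi \<alpha> x) * cis (\<alpha> * pi)))\<^sup>2"

lemma \<gamma>_pos: "\<gamma> n > 0"
  unfolding \<gamma>_def
proof (rule prod_pos)
  fix k assume "k \<in> {1..n}"
  then show "(a k)\<^sup>2 > 0" using a_pos[of k] by simp
qed

lemma \<gamma>_Suc: "\<gamma> (Suc n) = (a (Suc n))\<^sup>2 * \<gamma> n"
  by (simp add: \<gamma>_def mult.commute)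

lemma a2_pos: "(a (Suc n))\<^sup>2 > 0" using a_pos[of "Suc n"] by simp

lemma wronskian_pos: "wronskian x > 0"
  unfolding wronskian_def by (rule ttr_wronskian_pos) (rule a_pos)

lemma mass_pos: "x \<notin> {-1..1} \<Longrightarrow> mass x > 0"
proof -
  assume x: "x \<notin> {-1..1}"
  have "(a (Suc m))\<^sup>2 * (poly (T m) x)\<^sup>2 * (stieltjes_real \<alpha> x * (2 * \<alpha> + 1 - x) / (x\<^sup>2 - 1)) \<le> 0"
    using stieltjes_real_deriv_neg[OF alpha x] by (intro mult_nonneg_nonpos mult_nonneg_nonneg) auto
  then show ?thesis
    unfolding mass_def using wronskian_pos[of x] \<gamma>_pos[of m] by (intro divide_pos_pos) linarith+
qed

lemma casoratian:
  "cpoly (T n) z * cpoly (V (Suc n)) z - cpoly (T (Suc n)) z * cpoly (V n) z = of_real (\<gamma> n)"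
  unfolding \<gamma>_def by (rule ttr_casoratian_cpoly)

lemma T_no_common_root:
  assumes "poly (T m) x = 0" shows "poly (T (Suc m)) x \<noteq> 0"
proof
  assume "poly (T (Suc m)) x = 0"
  then have "complex_of_real (\<gamma> m) = 0"
    using casoratian[of m "of_real x"] assms by (simp only: cpoly_of_real) simp
  then show False using \<gamma>_pos[of m] by simp
qed

lemma second_num_rec:
  "second_num (Suc (Suc n)) u = (jouk u - of_real (b (Suc n))) * second_num (Suc n) u - of_real ((a (Suc n))\<^sup>2) * second_num n u"
  by (simp add: second_num_def algebra_simps)

text \<open>At the two indices where the old matrix begins, the Casoratian identity removes
  everything but the transform. From there on the recurrence is that of the original
  family.\<close>
lemma second_num_m: "second_num m u = of_real (\<gamma> m)"
proof -
  have "second_num m u = cpoly (T m) (jouk u) * cpoly (V (Suc m)) (jouk u)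
      - cpoly (T (Suc m)) (jouk u) * cpoly (V m) (jouk u)"
    unfolding second_num_def weyl_num_def weyl_den_def by (simp only: algebra_simps)
  then show ?thesis by (simp only: casoratian)
qed

lemma second_num_Suc_m: "second_num (Suc m) u = of_real (\<gamma> (Suc m)) * stieltjes \<alpha> u"
proof -
  have "second_num (Suc m) u = of_real ((a (Suc m))\<^sup>2) * stieltjes \<alpha> u *
    (cpoly (T m) (jouk u) * cpoly (V (Suc m)) (jouk u) - cpoly (T (Suc m)) (jouk u) * cpoly (V m) (jouk u))"
    unfolding second_num_def weyl_num_def weyl_den_def by (simp only: algebra_simps)
  then show ?thesis by (simp only: casoratian \<gamma>_Suc) simp
qed

lemma second_num_eq_second_kind:
  "second_num (Suc m + k) u
     = of_real (\<gamma> (Suc m)) * second_kind \<alpha> (\<lambda>k. b (k + Suc m)) (\<lambda>k. a (k + Suc m)) k u"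
proof (induction k rule: less_induct)
  case (less k)
  let ?E = "second_kind \<alpha> (\<lambda>k. b (k + Suc m)) (\<lambda>k. a (k + Suc m))"
  consider "k = 0" | "k = Suc 0" | n where "k = Suc (Suc n)" by (metis not0_implies_Suc)
  then show ?case
  proof cases
    case 1
    then show ?thesis using second_num_Suc_m by (simp add: second_kind_def)
  next
    case 2
    have "second_num (Suc (Suc m)) u = of_real (\<gamma> (Suc m)) * ((jouk u - of_real (b (Suc m))) * stieltjes \<alpha> u - 1)"
      unfolding second_num_rec second_num_m second_num_Suc_m by (simp add: \<gamma>_Suc algebra_simps)
    then show ?thesis using 2 by (simp add: second_kind_def algebra_simps)
  next
    case (3 n)
    have "second_num (Suc (Suc (Suc m + n))) u
       = (jouk u - of_real (b (Suc (Suc m + n)))) * second_num (Suc m + Suc n) u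
         - of_real ((a (Suc (Suc m + n)))\<^sup>2) * second_num (Suc m + n) u"
      unfolding second_num_rec by simp
    also have "second_num (Suc m + Suc n) u = of_real (\<gamma> (Suc m)) * ?E (Suc n) u"
      using 3 by (intro less.IH) simp
    also have "second_num (Suc m + n) u = of_real (\<gamma> (Suc m)) * ?E n u"
      using 3 by (intro less.IH) simp
    also have "(jouk u - of_real (b (Suc (Suc m + n)))) * (of_real (\<gamma> (Suc m)) * ?E (Suc n) u)
         - of_real ((a (Suc (Suc m + n)))\<^sup>2) * (of_real (\<gamma> (Suc m)) * ?E n u)
       = of_real (\<gamma> (Suc m)) * ?E (Suc (Suc n)) u"
      unfolding second_kind_rec by (simp add: algebra_simps)
    finally show ?thesis using 3 by (simp add: add.commute)
  qed
qed

lemma \<gamma>_add: "\<gamma> (Suc m + k) = \<gamma> (Suc m) * (\<Prod>j=1..k. (a (j + Suc m))\<^sup>2)"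
  by (induction k) (simp_all add: \<gamma>_Suc mult_ac add.commute)

text \<open>Above the index \<open>m\<close> the decay is that of the original functions of the
  second kind; below, the recurrence is run backwards, where the term with \<open>z\<close>
  dominates.\<close>
lemma second_num_limit: "((\<lambda>u. jouk u ^ Suc n * second_num n u / jouk u ^ Suc m) \<longlongrightarrow> of_real (\<gamma> n)) (at 0)"
proof -
  let ?P = "\<lambda>n. ((\<lambda>u. jouk u ^ Suc n * second_num n u / jouk u ^ Suc m) \<longlongrightarrow> of_real (\<gamma> n)) (at 0)"
  have up: "?P (Suc m + k)" for k
  proof -
    let ?E = "second_kind \<alpha> (\<lambda>k. b (k + Suc m)) (\<lambda>k. a (k + Suc m))"
    have "((\<lambda>u. of_real (\<gamma> (Suc m)) * (jouk u ^ Suc k * ?E k u))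
        \<longlongrightarrow> of_real (\<gamma> (Suc m)) * of_real (\<Prod>j=1..k. (a (j + Suc m))\<^sup>2)) (at 0)"
      by (intro tendsto_mult tendsto_const second_kind_limit[OF alpha grosjean])
    moreover have "eventually (\<lambda>u. of_real (\<gamma> (Suc m)) * (jouk u ^ Suc k * ?E k u)
        = jouk u ^ Suc (Suc m + k) * second_num (Suc m + k) u / jouk u ^ Suc m) (at 0)"
      using eventually_jouk_neq_0
    proof eventually_elim
      case (elim u)
      have "jouk u ^ Suc (Suc m + k) = jouk u ^ Suc k * jouk u ^ Suc m"
        by (simp add: power_add)
      then show ?case unfolding second_num_eq_second_kind using elim by simp
    qed
    ultimately show ?thesis unfolding \<gamma>_add of_real_mult by (rule Lim_transform_eventually)
  qed
  have at_m: "?P m"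
  proof -
    have "eventually (\<lambda>u. of_real (\<gamma> m) = jouk u ^ Suc m * second_num m u / jouk u ^ Suc m) (at 0)"
      using eventually_jouk_neq_0 by eventually_elim (simp add: second_num_m)
    then show ?thesis by (rule Lim_transform_eventually[OF tendsto_const])
  qed
  have down: "?P (m - i) \<and> ?P (Suc (m - i))" if "i \<le> m" for i
    using that
  proof (induction i)
    case 0
    then show ?case using at_m up[of 0] by simp
  next
    case (Suc i)
    define n where "n = m - Suc i"
    have n: "m - i = Suc n" using Suc.prems by (simp add: n_def)
    have P1: "?P (Suc n)" and P2: "?P (Suc (Suc n))"
      using Suc unfolding n by auto
    have lim: "((\<lambda>u. 1 / of_real ((a (Suc n))\<^sup>2) *
        (jouk u ^ Suc (Suc n) * second_num (Suc n) u / jouk u ^ Suc m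
          - of_real (b (Suc n)) * (1 / jouk u) * (jouk u ^ Suc (Suc n) * second_num (Suc n) u / jouk u ^ Suc m)
          - (1 / jouk u)\<^sup>2 * (jouk u ^ Suc (Suc (Suc n)) * second_num (Suc (Suc n)) u / jouk u ^ Suc m)))
        \<longlongrightarrow> 1 / of_real ((a (Suc n))\<^sup>2) * (of_real (\<gamma> (Suc n)) - of_real (b (Suc n)) * 0 * of_real (\<gamma> (Suc n))
          - 0\<^sup>2 * of_real (\<gamma> (Suc (Suc n))))) (at 0)"
      by (intro tendsto_mult tendsto_diff tendsto_const tendsto_power inverse_jouk_tendsto P1 P2)
    have val: "1 / of_real ((a (Suc n))\<^sup>2) * (of_real (\<gamma> (Suc n)) - of_real (b (Suc n)) * 0 * of_real (\<gamma> (Suc n))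
          - 0\<^sup>2 * of_real (\<gamma> (Suc (Suc n)))) = complex_of_real (\<gamma> n)"
      using a2_pos[of n] by (simp add: \<gamma>_Suc[of n])
    have ev: "eventually (\<lambda>u. 1 / of_real ((a (Suc n))\<^sup>2) *
        (jouk u ^ Suc (Suc n) * second_num (Suc n) u / jouk u ^ Suc m
          - of_real (b (Suc n)) * (1 / jouk u) * (jouk u ^ Suc (Suc n) * second_num (Suc n) u / jouk u ^ Suc m)
          - (1 / jouk u)\<^sup>2 * (jouk u ^ Suc (Suc (Suc n)) * second_num (Suc (Suc n)) u / jouk u ^ Suc m))
        = jouk u ^ Suc n * second_num n u / jouk u ^ Suc m) (at 0)"
      using eventually_jouk_neq_0
    proof eventually_elim
      case (elim u)
      have "1 / A * (z ^ Suc (Suc n) * s / z ^ Suc m - B * (1 / z) * (z ^ Suc (Suc n) * s / z ^ Suc m)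
          - (1 / z)\<^sup>2 * (z ^ Suc (Suc (Suc n)) * ((z - B) * s - A * t) / z ^ Suc m))
          = z ^ Suc n * t / z ^ Suc m" if "z \<noteq> 0" "A \<noteq> 0" for z A B s t :: complex
      proof -
        have P: "z ^ Suc (Suc n) = z * z ^ Suc n" "z ^ Suc (Suc (Suc n)) = z * (z * z ^ Suc n)"
          by simp_all
        have aux: "z * X * s / Y - B * (1 / z) * (z * X * s / Y) - (1 / z)\<^sup>2 * (z * (z * X) * w / Y)
            = X / Y * (z * s - B * s - w)" if "Y \<noteq> 0" for X Y w :: complex
          using that \<open>z \<noteq> 0\<close> by (simp add: power2_eq_square diff_divide_distrib right_diff_distrib mult_ac)
        have nz: "z ^ Suc m \<noteq> 0" using that by simp
        have "z ^ Suc (Suc n) * s / z ^ Suc m - B * (1 / z) * (z ^ Suc (Suc n) * s / z ^ Suc m)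
          - (1 / z)\<^sup>2 * (z ^ Suc (Suc (Suc n)) * ((z - B) * s - A * t) / z ^ Suc m)
          = z ^ Suc n / z ^ Suc m * (z * s - B * s - ((z - B) * s - A * t))"
          unfolding P by (rule aux[OF nz])
        also have "z * s - B * s - ((z - B) * s - A * t) = A * t" by (simp add: algebra_simps)
        also have "z ^ Suc n / z ^ Suc m * (A * t) = A * (z ^ Suc n * t / z ^ Suc m)"
          by (simp only: times_divide_eq_left times_divide_eq_right mult_ac)
        finally show ?thesis using that by simp
      qed
      from this[OF elim, of "of_real ((a (Suc n))\<^sup>2)" "second_num (Suc n) u" "of_real (b (Suc n))" "second_num n u"]
      show ?case unfolding second_num_rec using a2_pos[of n] by simp
    qed
    have "?P n" using Lim_transform_eventually[OF lim ev] unfolding val .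
    then show ?case using P1 by (simp add: n_def[symmetric])
  qed
  show ?thesis
  proof (cases "n \<le> m")
    case True
    then show ?thesis using down[of "m - n"] by simp
  next
    case False
    then show ?thesis using up[of "n - Suc m"] by simp
  qed
qed

lemma weyl_den_limit: "((\<lambda>u. weyl_den u / jouk u ^ Suc m) \<longlongrightarrow> 1) (at 0)"
proof -
  have "((\<lambda>u. cpoly (T (Suc m)) (jouk u) / jouk u ^ Suc m - of_real ((a (Suc m))\<^sup>2) *
     (cpoly (T m) (jouk u) / jouk u ^ m) * (jouk u * stieltjes \<alpha> u) * (1 / jouk u)\<^sup>2)
     \<longlongrightarrow> 1 - of_real ((a (Suc m))\<^sup>2) * 1 * 1 * 0\<^sup>2) (at 0)"
    by (intro tendsto_mult tendsto_diff tendsto_const tendsto_power inverse_jouk_tendsto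
        jouk_stieltjes_tendsto ttr_poly_jouk_tendsto)
  moreover have "eventually (\<lambda>u. cpoly (T (Suc m)) (jouk u) / jouk u ^ Suc m - of_real ((a (Suc m))\<^sup>2) *
     (cpoly (T m) (jouk u) / jouk u ^ m) * (jouk u * stieltjes \<alpha> u) * (1 / jouk u)\<^sup>2 = weyl_den u / jouk u ^ Suc m) (at 0)"
    using eventually_jouk_neq_0
  proof eventually_elim
    case (elim u)
    have "p / z ^ Suc m - c * (q / z ^ m) * (z * g) * (1 / z)\<^sup>2 = (p - c * q * g) / z ^ Suc m"
      if "z \<noteq> 0" for p q c g z :: complex
      using that by (simp add: power2_eq_square diff_divide_distrib mult_ac)
    from this[OF elim] show ?case unfolding weyl_den_def .
  qed
  ultimately show ?thesis using Lim_transform_eventually by fastforce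
qed

text \<open>The function of the second kind of degree \<open>n\<close> is \<open>\<gamma> n / z
  ^ (n + 1)\<close> to leading order. This expresses the orthogonality that is to be proved, and
  the norms.\<close>
lemma theta_limit: "((\<lambda>u. jouk u ^ Suc n * (second_num n u / weyl_den u)) \<longlongrightarrow> of_real (\<gamma> n)) (at 0)"
proof -
  have "((\<lambda>u. (jouk u ^ Suc n * second_num n u / jouk u ^ Suc m) / (weyl_den u / jouk u ^ Suc m))
      \<longlongrightarrow> of_real (\<gamma> n) / 1) (at 0)"
    by (intro tendsto_divide second_num_limit weyl_den_limit) simp
  moreover have "eventually (\<lambda>u. (jouk u ^ Suc n * second_num n u / jouk u ^ Suc m) / (weyl_den u / jouk u ^ Suc m)
     = jouk u ^ Suc n * (second_num n u / weyl_den u)) (at 0)"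
    using eventually_jouk_neq_0 by eventually_elim simp
  ultimately show ?thesis using Lim_transform_eventually by fastforce
qed

section \<open>Zeros of the denominator\<close>

lemma weyl_den_cnj: "cmod u \<le> 1 \<Longrightarrow> u \<noteq> 1 \<Longrightarrow> u \<noteq> -1 \<Longrightarrow> weyl_den (cnj u) = cnj (weyl_den u)"
  and weyl_num_cnj: "cmod u \<le> 1 \<Longrightarrow> u \<noteq> 1 \<Longrightarrow> u \<noteq> -1 \<Longrightarrow> weyl_num (cnj u) = cnj (weyl_num u)"
  by (simp_all add: weyl_den_def weyl_num_def stieltjes_cnj jouk_cnj)

text \<open>At a zero the quotient of consecutive polynomials equals a positive multiple of the
  transform, but the two map a half-plane to opposite half-planes.\<close>
lemma weyl_den_neq_0_upper:
  assumes "cmod u < 1" "Im u > 0"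
  shows "weyl_den u \<noteq> 0"
proof
  assume "weyl_den u = 0"
  define z where "z = jouk u"
  define p q where "p = cpoly (T (Suc m)) z" and "q = cpoly (T m) z"
  have "p = of_real ((a (Suc m))\<^sup>2) * q * stieltjes \<alpha> u"
    using \<open>weyl_den u = 0\<close> by (simp add: weyl_den_def p_def q_def z_def)
  then have "p * cnj q = of_real ((a (Suc m))\<^sup>2) * (q * cnj q) * stieltjes \<alpha> u" by simp
  also have "q * cnj q = of_real ((cmod q)\<^sup>2)" by (rule complex_norm_square[symmetric])
  finally have "p * cnj q = of_real ((a (Suc m))\<^sup>2 * (cmod q)\<^sup>2) * stieltjes \<alpha> u"
    by (simp only: of_real_mult)
  then have "Im (p * cnj q) = (a (Suc m))\<^sup>2 * (cmod q)\<^sup>2 * Im (stieltjes \<alpha> u)"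
    by (simp add: algebra_simps)
  then have 1: "Im (p * cnj q) \<ge> 0"
    using stieltjes_Im_pos[OF alpha assms] by simp
  have "Im (cnj z) > 0" using jouk_Im_neg[OF assms] by (simp add: z_def)
  then have "Im (cpoly (T (Suc m)) (cnj z) * cnj (cpoly (T m) (cnj z))) > 0"
    by (intro ttr_Im_pos a_pos)
  then have "Im (cnj (p * cnj q)) > 0" by (simp only: cpoly_cnj p_def q_def complex_cnj_mult)
  then show False using 1 by simp
qed

lemma weyl_den_zero_real:
  assumes "cmod u < 1" "u \<noteq> 0" "weyl_den u = 0"
  shows "Im u = 0"
proof (rule ccontr)
  assume "Im u \<noteq> 0"
  then consider "Im u > 0" | "Im (cnj u) > 0" by force
  then show False
  proof cases
    case 2
    have "u \<noteq> 1" "u \<noteq> -1" using assms by auto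
    then have "weyl_den (cnj u) = 0" using assms weyl_den_cnj[of u] by simp
    then show False using weyl_den_neq_0_upper[of "cnj u"] 2 assms by simp
  qed (use weyl_den_neq_0_upper assms in auto)
qed

lemma weyl_den_of_real:
  assumes "\<bar>u\<bar> < 1" "u \<noteq> 0"
  shows "weyl_den (of_real u) = of_real (weyl_den_real (jouk_real u))"
  by (simp add: weyl_den_def weyl_den_real_def stieltjes_of_real[OF assms] jouk_of_real)

lemma sin_alpha_pos: "sin (- pi * \<alpha>) > 0"
  using alpha mult_strict_left_mono[of "- \<alpha>" 1 pi] by (intro sin_gt_zero) (auto intro: mult_pos_neg)

lemma jacobi_pos: "-1 < x \<Longrightarrow> x < 1 \<Longrightarrow> jacobi \<alpha> x > 0"
  unfolding jacobi_def by (intro divide_pos_pos) auto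

lemma cos_inside: "0 < t \<Longrightarrow> t < pi \<Longrightarrow> -1 < cos t \<and> cos t < 1"
  using cos_monotone_0_pi[of t pi] cos_monotone_0_pi[of 0 t] by auto

text \<open>On the cut the polynomials are real and the transform is not, so both polynomials
  would have to vanish.\<close>
lemma weyl_den_cis_neq_0:
  assumes "0 < t" "t < pi"
  shows "weyl_den (cis t) \<noteq> 0"
proof
  assume d: "weyl_den (cis t) = 0"
  let ?x = "cos t" and ?\<phi> = "stieltjes \<alpha> (cis t)"
  have "of_real (poly (T (Suc m)) ?x) = of_real ((a (Suc m))\<^sup>2 * poly (T m) ?x) * ?\<phi>"
    using d by (simp add: weyl_den_def jouk_cis)
  then have "Im (of_real ((a (Suc m))\<^sup>2 * poly (T m) ?x) * ?\<phi>) = 0"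
    by (metis Im_complex_of_real)
  then have "(a (Suc m))\<^sup>2 * poly (T m) ?x * Im ?\<phi> = 0" by simp
  moreover have "Im ?\<phi> > 0"
    unfolding Im_stieltjes_cis[OF assms] using sin_alpha_pos jacobi_pos[of "cos t"] cos_inside[OF assms] by (intro mult_pos_pos) auto
  ultimately have "poly (T m) ?x = 0" using a2_pos[of m] by simp
  moreover from this have "poly (T (Suc m)) ?x = 0" using d by (simp add: weyl_den_def jouk_cis)
  ultimately show False using T_no_common_root by blast
qed

lemma unit_circle_cases:
  assumes "cmod u = 1" "u \<noteq> 1" "u \<noteq> -1"
  obtains t where "0 < t" "t < pi" "u = cis t \<or> cnj u = cis t"
proof -
  define t where "t = \<bar>Arg u\<bar>"
  have u: "u = cis (Arg u)" using assms rcis_cmod_Arg[of u] by (simp add: rcis_def)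
  have "Arg u \<noteq> 0" using u assms(2) by (metis cis_zero)
  moreover have "Arg u \<noteq> pi" using u assms(3) by (metis cis_pi)
  ultimately have "0 < t" "t < pi"
    using mpi_less_Arg[of u] Arg_le_pi[of u] by (auto simp: t_def)
  moreover have "u = cis t \<or> cnj u = cis t"
    using u by (auto simp: t_def abs_if cis_cnj[symmetric])
  ultimately show ?thesis by (rule that)
qed

lemma weyl_den_circle_neq_0:
  assumes "cmod u = 1" "u \<noteq> 1" "u \<noteq> -1"
  shows "weyl_den u \<noteq> 0"
proof -
  obtain t where t: "0 < t" "t < pi" "u = cis t \<or> cnj u = cis t"
    using unit_circle_cases[OF assms] .
  have "weyl_den (cnj u) = cnj (weyl_den u)" using assms by (intro weyl_den_cnj) auto
  then show ?thesis using weyl_den_cis_neq_0[OF t(1,2)] t(3) by auto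
qed

lemma weyl_den_continuous_on: "continuous_on (cball 0 1 - {0, 1, -1}) weyl_den"
  and weyl_num_continuous_on: "continuous_on (cball 0 1 - {0, 1, -1}) weyl_num"
  unfolding weyl_den_def[abs_def] weyl_num_def[abs_def]
  by (intro continuous_on_diff continuous_on_mult continuous_on_const cpoly_continuous_on
      jouk_continuous_on continuous_on_subset[OF stieltjes_continuous_on]; auto)+

lemma weyl_den_holomorphic: "weyl_den holomorphic_on ball 0 1 - {0}"
  and weyl_num_holomorphic: "weyl_num holomorphic_on ball 0 1 - {0}"
  unfolding weyl_den_def[abs_def] weyl_num_def[abs_def]
  by (intro holomorphic_intros holomorphic_on_subset[OF stieltjes_holomorphic]; auto)+

text \<open>Away from the endpoints this is continuity. At an endpoint the denominator is
  infinite if \<open>T m\<close> does not vanish there; if it does, its zero outweighs the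
  singularity of the transform and the limit is the value of \<open>T (Suc m)\<close>, which is
  not zero.\<close>
lemma weyl_den_lower_bound_local:
  assumes "cmod p = 1"
  shows "\<exists>c>0. eventually (\<lambda>u. cmod (weyl_den u) \<ge> c) (at p within ball 0 1)"
proof (cases "p = 1 \<or> p = -1")
  case False
  then have p: "p \<noteq> 1" "p \<noteq> -1" by auto
  have "p \<in> cball 0 1 - {0, 1, -1}" using p assms by auto
  then have "(weyl_den \<longlongrightarrow> weyl_den p) (at p within (cball 0 1 - {0, 1, -1}))"
    using weyl_den_continuous_on by (simp add: continuous_on_def)
  then have "((\<lambda>u. cmod (weyl_den u)) \<longlongrightarrow> cmod (weyl_den p)) (at p within (cball 0 1 - {0, 1, -1}))"
    by (rule tendsto_norm)
  moreover have dp: "cmod (weyl_den p) / 2 < cmod (weyl_den p)"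
    using weyl_den_circle_neq_0[OF assms p] by simp
  ultimately have "eventually (\<lambda>u. cmod (weyl_den p) / 2 < cmod (weyl_den u)) (at p within (cball 0 1 - {0, 1, -1}))"
    by (rule order_tendstoD(1))
  moreover have "eventually (\<lambda>u. u \<noteq> 0) (at p within ball 0 1)"
    using assms by (intro eventually_at_topological[THEN iffD2] exI[of _ "- {0}"]) auto
  ultimately have "eventually (\<lambda>u. cmod (weyl_den u) \<ge> cmod (weyl_den p) / 2) (at p within ball 0 1)"
    unfolding eventually_at_filter by eventually_elim auto
  then show ?thesis using dp by (intro exI[of _ "cmod (weyl_den p) / 2"]) auto
next
  case True
  define F where "F = at p within ball (0::complex) 1"
  have p0: "p \<noteq> 0" using True by auto
  have jp: "jouk p = p" using True by (auto simp: jouk_def)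
  have jl: "(jouk \<longlongrightarrow> p) F"
  proof -
    have "((\<lambda>u. (u + 1 / u) / 2) \<longlongrightarrow> (p + 1 / p) / 2) F"
      unfolding F_def using p0 by (intro tendsto_intros) auto
    then show ?thesis using jp by (simp add: jouk_def[abs_def])
  qed
  have ev: "eventually (\<lambda>u. u \<in> ball 0 1 \<and> u \<noteq> 0) F"
  proof -
    have "eventually (\<lambda>u. u \<in> - {0}) F" unfolding F_def
      using p0 by (intro eventually_at_topological[THEN iffD2] exI[of _ "- {0}"]) auto
    moreover have "eventually (\<lambda>u. u \<in> ball 0 1) F"
      unfolding F_def by (simp add: eventually_at_filter)
    ultimately show ?thesis by eventually_elim auto
  qed
  note gl = stieltjes_at_endpoints[OF alpha True, folded F_def]
  have Tl: "((\<lambda>u. cpoly (T k) (jouk u)) \<longlongrightarrow> cpoly (T k) p) F" for k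
    by (intro cpoly_tendsto jl)
  define A where "A = complex_of_real ((a (Suc m))\<^sup>2)"
  have A0: "A \<noteq> 0" using a2_pos[of m] unfolding A_def by (metis less_irrefl of_real_eq_0_iff)
  have real_p: "p = of_real (Re p)" using True by auto
  show ?thesis
  proof (cases "cpoly (T m) p = 0")
    case False
    define c where "c = cmod (A * cpoly (T m) p) / 2"
    have c: "c > 0" using False A0 by (simp add: c_def)
    have "((\<lambda>u. cmod (cpoly (T (Suc m)) (jouk u) * (1 / stieltjes \<alpha> u) - A * cpoly (T m) (jouk u)))
        \<longlongrightarrow> cmod (cpoly (T (Suc m)) p * 0 - A * cpoly (T m) p)) F"
      by (intro tendsto_norm tendsto_diff tendsto_mult tendsto_const Tl gl(1))
    moreover have "c < cmod (cpoly (T (Suc m)) p * 0 - A * cpoly (T m) p)"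
      using c by (simp add: c_def)
    ultimately have "eventually (\<lambda>u. c < cmod (cpoly (T (Suc m)) (jouk u) * (1 / stieltjes \<alpha> u) - A * cpoly (T m) (jouk u))) F"
      by (rule order_tendstoD(1))
    moreover have "eventually (\<lambda>u. cmod (1 / stieltjes \<alpha> u) < 1) F"
      using order_tendstoD(2)[OF tendsto_norm[OF gl(1)], of 1] by simp
    ultimately have "eventually (\<lambda>u. c \<le> cmod (weyl_den u)) F"
      using ev
    proof eventually_elim
      case (elim u)
      have u: "u \<noteq> 1" "u \<noteq> -1" "cmod u < 1" "u \<noteq> 0" using elim by auto
      then have "cayley u \<noteq> 0" "1 + u \<noteq> 0" using Re_cayley_pos[of u] by (auto simp: one_plus_eq_0_iff)
      then have g: "stieltjes \<alpha> u \<noteq> 0" using u by (simp add: stieltjes_alt)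
      have "weyl_den u = stieltjes \<alpha> u * (cpoly (T (Suc m)) (jouk u) * (1 / stieltjes \<alpha> u) - A * cpoly (T m) (jouk u))"
        using g unfolding weyl_den_def A_def by (simp add: right_diff_distrib mult.commute)
      then have e: "cmod (weyl_den u) = cmod (stieltjes \<alpha> u) * cmod (cpoly (T (Suc m)) (jouk u) * (1 / stieltjes \<alpha> u) - A * cpoly (T m) (jouk u))"
        by (simp only: norm_mult)
      have "1 < cmod (stieltjes \<alpha> u)"
        using elim(2) g by (simp add: norm_divide)
      then have "1 * c \<le> cmod (stieltjes \<alpha> u) * cmod (cpoly (T (Suc m)) (jouk u) * (1 / stieltjes \<alpha> u) - A * cpoly (T m) (jouk u))"
        using elim(1) c by (intro mult_mono) auto
      then show ?case unfolding e by simp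
    qed
    then show ?thesis using c unfolding F_def by auto
  next
    case True
    have "poly (T m) (Re p) = 0"
      using True real_p by (metis cpoly_of_real of_real_eq_0_iff)
    then have "poly (T (Suc m)) (Re p) \<noteq> 0" by (rule T_no_common_root)
    then have Tp: "cpoly (T (Suc m)) p \<noteq> 0"
      using real_p by (metis cpoly_of_real of_real_eq_0_iff)
    define D where "D = cpoly (pderiv (T m)) p"
    have "(cpoly (T m) has_field_derivative D) (at p)"
      using cpoly_has_field_derivative[OF DERIV_ident, of "T m" p UNIV] by (simp add: D_def)
    (* T m vanishes at p to first order at least, and the factor z - p is absorbed by the
       transform. *)
    then have dl: "((\<lambda>z. (cpoly (T m) z - cpoly (T m) p) / (z - p)) \<longlongrightarrow> D) (at p)"
      by (simp only: has_field_derivative_iff)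
    have jne: "eventually (\<lambda>u. jouk u \<noteq> p) F"
      using ev
    proof eventually_elim
      case (elim u)
      show ?case
      proof
        assume "jouk u = p"
        then have "u\<^sup>2 + 1 = 2 * u * p" using elim by (simp add: jouk_def field_simps power2_eq_square)
        then have "(u - p)\<^sup>2 = 0" using \<open>p = 1 \<or> p = -1\<close>
          by (auto simp: power2_eq_square algebra_simps)
        then have "u = p" by simp
        then show False using elim assms by simp
      qed
    qed
    have "filterlim jouk (at p) F"
      using jl jne by (simp add: filterlim_at)
    then have "((\<lambda>u. (cpoly (T m) (jouk u) - cpoly (T m) p) / (jouk u - p)) \<longlongrightarrow> D) F"
      using filterlim_compose[OF dl] by blast
    then have "((\<lambda>u. cmod (cpoly (T (Suc m)) (jouk u) - A * ((cpoly (T m) (jouk u) - cpoly (T m) p) / (jouk u - p) *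
        ((jouk u - p) * stieltjes \<alpha> u)))) \<longlongrightarrow> cmod (cpoly (T (Suc m)) p - A * (D * 0))) F"
      by (intro tendsto_norm tendsto_diff tendsto_mult tendsto_const Tl gl(2))
    moreover define c where "c = cmod (cpoly (T (Suc m)) p) / 2"
    have c: "c > 0" using Tp by (simp add: c_def)
    then have "c < cmod (cpoly (T (Suc m)) p - A * (D * 0))" by (simp add: c_def)
    ultimately have "eventually (\<lambda>u. c < cmod (cpoly (T (Suc m)) (jouk u) - A * ((cpoly (T m) (jouk u) - cpoly (T m) p) / (jouk u - p) *
        ((jouk u - p) * stieltjes \<alpha> u)))) F"
      by (rule order_tendstoD(1))
    then have "eventually (\<lambda>u. c \<le> cmod (weyl_den u)) F"
      using jne
    proof eventually_elim
      case (elim u)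
      have "x / y * (y * g) = x * g" if "y \<noteq> 0" for x y g :: complex using that by simp
      from this[of "jouk u - p"] have "cpoly (T (Suc m)) (jouk u) - A * ((cpoly (T m) (jouk u) - cpoly (T m) p) / (jouk u - p) *
        ((jouk u - p) * stieltjes \<alpha> u)) = weyl_den u"
        using elim(2) True unfolding weyl_den_def A_def by (simp add: mult.assoc)
      then show ?case using elim(1) by simp
    qed
    then show ?thesis using c unfolding F_def by auto
  qed
qed

text \<open>Compactness of the circle. The bound makes the quotient as harmless near the circle
  as the transform itself, and it keeps the zeros away from the circle.\<close>
lemma weyl_den_lower_bound:
  obtains \<rho> c where "\<rho> < 1" "c > 0" "\<And>u. \<rho> \<le> cmod u \<Longrightarrow> cmod u < 1 \<Longrightarrow> c \<le> cmod (weyl_den u)"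
proof -
  have "\<exists>n::nat. \<forall>u. 1 - 1 / real (Suc n) \<le> cmod u \<longrightarrow> cmod u < 1 \<longrightarrow> 1 / real (Suc n) \<le> cmod (weyl_den u)"
  proof (rule ccontr)
    assume "\<not> ?thesis"
    then have "\<forall>n. \<exists>u. 1 - 1 / real (Suc n) \<le> cmod u \<and> cmod u < 1 \<and> cmod (weyl_den u) < 1 / real (Suc n)"
      by (auto simp: not_le)
    then obtain f where f: "\<And>n. 1 - 1 / real (Suc n) \<le> cmod (f n)" "\<And>n. cmod (f n) < 1"
      "\<And>n. cmod (weyl_den (f n)) < 1 / real (Suc n)" by metis
    have "compact (cball (0::complex) 1)" by simp
    moreover have "\<forall>n. f n \<in> cball 0 1" using f(2) by (auto intro: less_imp_le)
    ultimately obtain p s where s: "strict_mono s" "(f \<circ> s) \<longlonglongrightarrow> p"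
      unfolding compact_def by metis
    have inv: "(\<lambda>n. 1 / real (Suc (s n))) \<longlonglongrightarrow> 0"
      using LIMSEQ_subseq_LIMSEQ[OF LIMSEQ_inverse_real_of_nat s(1)]
      by (simp add: o_def divide_inverse)
    have "(\<lambda>n. cmod (f (s n))) \<longlonglongrightarrow> cmod p"
      using tendsto_norm[OF s(2)] by (simp add: o_def)
    moreover have "(\<lambda>n. cmod (f (s n))) \<longlonglongrightarrow> 1"
    proof (rule tendsto_sandwich)
      show "(\<lambda>n. 1 - 1 / real (Suc (s n))) \<longlonglongrightarrow> 1"
        using tendsto_diff[OF tendsto_const inv, of 1] by simp
      show "eventually (\<lambda>n. 1 - 1 / real (Suc (s n)) \<le> cmod (f (s n))) sequentially"
        using f(1) by (intro always_eventually allI)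
      show "eventually (\<lambda>n. cmod (f (s n)) \<le> 1) sequentially"
        using f(2) by (intro always_eventually allI less_imp_le)
    qed simp
    ultimately have p: "cmod p = 1" by (rule LIMSEQ_unique)
    obtain c where c: "c > 0" "eventually (\<lambda>u. cmod (weyl_den u) \<ge> c) (at p within ball 0 1)"
      using weyl_den_lower_bound_local[OF p] by blast
    have "filterlim (f \<circ> s) (at p within ball 0 1) sequentially"
      unfolding filterlim_at
    proof (intro conjI s(2) always_eventually allI)
      fix n
      show "(f \<circ> s) n \<in> ball 0 1" using f(2)[of "s n"] by simp
      show "(f \<circ> s) n \<noteq> p" using p f(2)[of "s n"] by auto
    qed
    then have "eventually (\<lambda>n. cmod (weyl_den (f (s n))) \<ge> c) sequentially"
      using c(2) by (auto simp: filterlim_iff o_def)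
    moreover have "eventually (\<lambda>n. 1 / real (Suc (s n)) < c) sequentially"
      using order_tendstoD(2)[OF inv c(1)] .
    ultimately have "eventually (\<lambda>n. False) sequentially"
    proof eventually_elim
      case (elim n)
      then show False using f(3)[of "s n"] by linarith
    qed
    then show False by simp
  qed
  then obtain n :: nat where n: "\<And>u. 1 - 1 / real (Suc n) \<le> cmod u \<Longrightarrow> cmod u < 1 \<Longrightarrow> 1 / real (Suc n) \<le> cmod (weyl_den u)"
    by blast
  show ?thesis by (rule that[of "1 - 1 / real (Suc n)" "1 / real (Suc n)"]) (use n in auto)
qed

lemma T_nonzero_at_zeros: "x \<in> zeros \<Longrightarrow> poly (T m) x \<noteq> 0"
  using T_no_common_root[of x] by (auto simp: zeros_def weyl_den_real_def)

text \<open>Where \<open>T m\<close> has no zero, the quotient \<open>T (Suc m) / T m\<close>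
  increases while the transform decreases, so a positive multiple of the transform meets it at
  most once.\<close>
lemma zeros_separated:
  assumes "x \<in> zeros" "y \<in> zeros" "x < y" and out: "\<And>z. x \<le> z \<Longrightarrow> z \<le> y \<Longrightarrow> z \<notin> {-1..1}"
  shows "\<exists>z. poly (T m) z = 0 \<and> x < z \<and> z < y"
proof (rule ccontr)
  assume neg: "\<not> ?thesis"
  have nz: "poly (T m) z \<noteq> 0" if "x \<le> z" "z \<le> y" for z
    using that neg T_nonzero_at_zeros assms(1,2) by (cases "z = x \<or> z = y") force+
  define g where "g = (\<lambda>z. poly (T (Suc m)) z / poly (T m) z - (a (Suc m))\<^sup>2 * stieltjes_real \<alpha> z)"
  have "\<exists>d. (g has_real_derivative d) (at z) \<and> d > 0" if z: "x \<le> z" "z \<le> y" for z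
  proof -
    define d1 where "d1 = (poly (pderiv (T (Suc m))) z * poly (T m) z
        - poly (T (Suc m)) z * poly (pderiv (T m)) z) / (poly (T m) z * poly (T m) z)"
    define d2 where "d2 = stieltjes_real \<alpha> z * (2 * \<alpha> + 1 - z) / (z\<^sup>2 - 1)"
    have "((\<lambda>z. poly (T (Suc m)) z / poly (T m) z) has_real_derivative d1) (at z)"
      unfolding d1_def by (intro DERIV_divide poly_DERIV nz z)
    moreover have "((\<lambda>z. (a (Suc m))\<^sup>2 * stieltjes_real \<alpha> z) has_real_derivative (a (Suc m))\<^sup>2 * d2) (at z)"
      unfolding d2_def by (intro DERIV_cmult stieltjes_real_DERIV out z)
    ultimately have gd: "(g has_real_derivative d1 - (a (Suc m))\<^sup>2 * d2) (at z)"
      unfolding g_def by (rule DERIV_diff)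
    have "d1 = wronskian z / (poly (T m) z * poly (T m) z)"
      unfolding d1_def wronskian_def by simp
    moreover have "poly (T m) z * poly (T m) z > 0"
      using nz[OF z] by (metis not_real_square_gt_zero)
    ultimately have "d1 > 0"
      using wronskian_pos[of z] by simp
    moreover have "(a (Suc m))\<^sup>2 * d2 < 0"
      unfolding d2_def using a2_pos stieltjes_real_deriv_neg[OF alpha out[OF z]] by (rule mult_pos_neg)
    ultimately have "d1 - (a (Suc m))\<^sup>2 * d2 > 0" by linarith
    with gd show ?thesis by blast
  qed
  then have "g x < g y" by (rule DERIV_pos_imp_increasing[OF assms(3)])
  moreover have "g z = 0" if "z \<in> zeros" for z
    using that T_nonzero_at_zeros[OF that] by (simp add: g_def zeros_def weyl_den_real_def field_simps)
  ultimately show False using assms(1,2) by simp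
qed

lemma T_roots: "finite {z. poly (T m) z = 0}" "card {z. poly (T m) z = 0} \<le> m"
proof -
  have "lead_coeff (T m) = 1" by (rule lead_coeff_ttr_poly)
  then have "T m \<noteq> 0" by auto
  then show "finite {z. poly (T m) z = 0}" "card {z. poly (T m) z = 0} \<le> m"
    using poly_roots_finite card_poly_roots_bound[of "T m"] degree_ttr_poly[of b a m] by auto
qed

lemma zeros_right: "finite (zeros \<inter> {1<..})" "card (zeros \<inter> {1<..}) \<le> Suc m"
proof -
  have sep: "\<exists>z\<in>{z. poly (T m) z = 0}. x < z \<and> z < y"
    if "x \<in> zeros \<inter> {1<..}" "y \<in> zeros \<inter> {1<..}" "x < y" for x y
    using zeros_separated[of x y] that by auto
  note c = card_le_Suc_card_separating[OF T_roots(1) sep]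
  show "finite (zeros \<inter> {1<..})" by (rule c(1))
  show "card (zeros \<inter> {1<..}) \<le> Suc m" by (rule order_trans[OF c(2) Suc_le_mono[THEN iffD2, OF T_roots(2)]])
qed

lemma zeros_left: "finite (zeros \<inter> {..<-1})" "card (zeros \<inter> {..<-1}) \<le> Suc m"
proof -
  have sep: "\<exists>z\<in>{z. poly (T m) z = 0}. x < z \<and> z < y"
    if "x \<in> zeros \<inter> {..<-1}" "y \<in> zeros \<inter> {..<-1}" "x < y" for x y
    using zeros_separated[of x y] that by auto
  note c = card_le_Suc_card_separating[OF T_roots(1) sep]
  show "finite (zeros \<inter> {..<-1})" by (rule c(1))
  show "card (zeros \<inter> {..<-1}) \<le> Suc m" by (rule order_trans[OF c(2) Suc_le_mono[THEN iffD2, OF T_roots(2)]])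
qed

lemma zeros_split: "zeros = (zeros \<inter> {..<-1}) \<union> (zeros \<inter> {1<..})"
  by (auto simp: zeros_def)

lemma finite_zeros: "finite zeros"
  by (subst zeros_split) (intro finite_UnI zeros_left zeros_right)

definition disc_zero :: "real \<Rightarrow> complex" where "disc_zero x = of_real (jouk_inv x)"

lemma disc_zero:
  assumes "x \<in> zeros"
  shows "cmod (disc_zero x) < 1" "disc_zero x \<noteq> 0" "jouk (disc_zero x) = of_real x" "weyl_den (disc_zero x) = 0"
    "stieltjes \<alpha> (disc_zero x) = of_real (stieltjes_real \<alpha> x)"
proof -
  have x: "x \<notin> {-1..1}" "weyl_den_real x = 0" using assms by (auto simp: zeros_def)
  note u = jouk_inv[OF x(1)]
  show "cmod (disc_zero x) < 1" "disc_zero x \<noteq> 0" using u by (auto simp: disc_zero_def)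
  show "jouk (disc_zero x) = of_real x" using u by (simp add: disc_zero_def jouk_of_real)
  show "weyl_den (disc_zero x) = 0" unfolding disc_zero_def weyl_den_of_real[OF u(3,2)] using u(1) x(2) by simp
  show "stieltjes \<alpha> (disc_zero x) = of_real (stieltjes_real \<alpha> x)"
    unfolding disc_zero_def stieltjes_of_real[OF u(3,2)] using u(1) by simp
qed

text \<open>Zeros in the disc are real, so they come from the real zeros outside the
  interval.\<close>
lemma weyl_den_eq_0_iff:
  assumes "cmod u < 1" "u \<noteq> 0"
  shows "weyl_den u = 0 \<longleftrightarrow> u \<in> disc_zero ` zeros"
proof
  assume "weyl_den u = 0"
  then have "Im u = 0" using weyl_den_zero_real assms by blast
  define v where "v = Re u"
  have u: "u = of_real v" using \<open>Im u = 0\<close> by (simp add: v_def complex_eq_iff)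
  then have v: "\<bar>v\<bar> < 1" "v \<noteq> 0" using assms by auto
  then have "weyl_den_real (jouk_real v) = 0" using weyl_den_of_real[OF v] \<open>weyl_den u = 0\<close> u by simp
  then have z: "jouk_real v \<in> zeros" using jouk_real_outside[OF v] by (simp add: zeros_def)
  have "jouk (disc_zero (jouk_real v)) = jouk u" using disc_zero(3)[OF z] u by (simp add: jouk_of_real)
  then have "disc_zero (jouk_real v) = u"
    by (rule jouk_inj[OF disc_zero(1)[OF z] assms(1) disc_zero(2)[OF z] assms(2)])
  then show "u \<in> disc_zero ` zeros" using z by blast
next
  assume "u \<in> disc_zero ` zeros"
  then show "weyl_den u = 0" using disc_zero(4) by blast
qed

lemma inj_on_disc_zero: "inj_on disc_zero zeros"
proof (rule inj_onI)
  fix x y assume xy: "x \<in> zeros" "y \<in> zeros" "disc_zero x = disc_zero y"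
  have "complex_of_real x = jouk (disc_zero x)" using disc_zero(3)[OF xy(1)] by (rule sym)
  also have "\<dots> = of_real y" unfolding xy(3) using xy(2) by (rule disc_zero(3))
  finally show "x = y" by (rule of_real_eq_iff[THEN iffD1])
qed

lemma second_num_holomorphic: "second_num n holomorphic_on ball 0 1 - {0}"
  unfolding second_num_def[abs_def] by (intro holomorphic_intros weyl_num_holomorphic weyl_den_holomorphic) auto

lemma weyl_num_disc_zero:
  assumes "x \<in> zeros"
  shows "weyl_num (disc_zero x) = of_real (\<gamma> m / poly (T m) x)"
proof -
  have "of_real (poly (T m) x) * weyl_num (disc_zero x) = of_real (\<gamma> m)"
    using second_num_m[of "disc_zero x"] disc_zero[OF assms] by (simp add: second_num_def)
  then show ?thesis using T_nonzero_at_zeros[OF assms] by (simp add: field_simps)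
qed

text \<open>At a zero the transform can be eliminated, which leaves a multiple of the Wronskian
  minus a positive multiple of the derivative of the transform. The differential of the
  Joukowski map is kept as a factor since it cancels in the residue.\<close>
lemma weyl_den_has_derivative_disc_zero:
  assumes "x \<in> zeros"
  shows "(weyl_den has_field_derivative djouk (disc_zero x) * of_real (\<gamma> m / (poly (T m) x * mass x))) (at (disc_zero x))"
proof -
  define u where "u = disc_zero x"
  define f where "f = stieltjes_real \<alpha> x"
  define d where "d = stieltjes_real \<alpha> x * (2 * \<alpha> + 1 - x) / (x\<^sup>2 - 1)"
  define A where "A = (a (Suc m))\<^sup>2"
  define t where "t = poly (T m) x"
  define t' where "t' = poly (pderiv (T m)) x"
  define s where "s = poly (T (Suc m)) x"
  define s' where "s' = poly (pderiv (T (Suc m))) x"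
  note uz = disc_zero[OF assms, folded u_def]
  have jd: "(jouk has_field_derivative djouk u) (at u)"
    using uz(2) by (rule jouk_has_field_derivative)
  have gd: "(stieltjes \<alpha> has_field_derivative of_real d * djouk u) (at u)"
    using stieltjes_has_field_derivative[OF uz(1,2), of \<alpha>] uz(3,5) by (simp add: d_def)
  have cd: "((\<lambda>u. cpoly p (jouk u)) has_field_derivative of_real (poly (pderiv p) x) * djouk u) (at u)" for p
    using cpoly_has_field_derivative[OF jd, of p] uz(3) by simp
  have dd: "(weyl_den has_field_derivative of_real s' * djouk u -
     (of_real A * cpoly (T m) (jouk u) * (of_real d * djouk u) + of_real A * (of_real t' * djouk u) * stieltjes \<alpha> u)) (at u)"
    unfolding weyl_den_def[abs_def] A_def s'_def t'_def
    by (intro DERIV_diff DERIV_mult' DERIV_cmult cd gd)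
  have e1: "of_real s' * djouk u -
     (of_real A * cpoly (T m) (jouk u) * (of_real d * djouk u) + of_real A * (of_real t' * djouk u) * stieltjes \<alpha> u)
     = djouk u * of_real (s' - A * t' * f - A * t * d)"
    using uz(3,5) by (simp add: f_def t_def algebra_simps)
  have e2: "s' - A * t' * f - A * t * d = \<gamma> m / (t * mass x)"
  proof -
    have t0: "t \<noteq> 0" using T_nonzero_at_zeros[OF assms] by (simp add: t_def)
    have sf: "s = A * t * f" using assms by (simp add: zeros_def weyl_den_real_def s_def A_def t_def f_def)
    have w: "wronskian x = s' * t - s * t'" by (simp add: wronskian_def s'_def s_def t_def t'_def)
    have "t * (s' - A * t' * f - A * t * d) = wronskian x - A * t\<^sup>2 * d"
      unfolding w sf by (simp add: power2_eq_square algebra_simps)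
    moreover have M: "mass x = \<gamma> m / (wronskian x - A * t\<^sup>2 * d)"
      by (simp add: mass_def A_def t_def d_def)
    moreover have "wronskian x - A * t\<^sup>2 * d \<noteq> 0"
      using mass_pos[of x] assms unfolding M by (auto simp: zeros_def)
    moreover have "E = \<gamma> m / (t * M)" if "t * E = W" "M = \<gamma> m / W" "W \<noteq> 0" for E M W
    proof -
      have "E = W / t" using that(1) t0 by (simp add: field_simps)
      then show ?thesis using that(2,3) \<gamma>_pos[of m] by simp
    qed
    ultimately show ?thesis by blast
  qed
  show ?thesis using dd unfolding e1 e2 unfolding u_def t_def .
qed

section \<open>Orthogonality\<close>

text \<open>The pole is simple. At it the function of the second kind is the polynomial times
  the numerator of the quotient, because its other term contains the denominator.\<close>
lemma residue_disc_zero: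
  assumes "x \<in> zeros"
  shows "residue (\<lambda>u. cpoly p (jouk u) * (second_num n u / weyl_den u) * djouk u) (disc_zero x)
     = of_real (poly p x * poly (T n) x * mass x)"
proof -
  define S where "S = ball 0 1 - {0} - disc_zero ` (zeros - {x})"
  note uz = disc_zero[OF assms]
  define h where "h = (\<lambda>u. cpoly p (jouk u) * second_num n u * djouk u)"
  define D where "D = djouk (disc_zero x) * of_real (\<gamma> m / (poly (T m) x * mass x))"
  have S0: "0 \<notin> S" by (simp add: S_def)
  have "open S"
    unfolding S_def using finite_zeros by (intro open_Diff finite_imp_closed) auto
  moreover have "disc_zero x \<in> S"
    using uz assms inj_on_disc_zero by (auto simp: S_def inj_on_def)
  moreover have dz: "weyl_den u \<noteq> 0" if "u \<in> S - {disc_zero x}" for u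
    using that weyl_den_eq_0_iff[of u] by (auto simp: S_def)
  have hh: "h holomorphic_on S"
    unfolding h_def djouk_def using S0
    by (intro holomorphic_intros holomorphic_on_subset[OF second_num_holomorphic]) (auto simp: S_def)
  have "(\<lambda>u. h u / weyl_den u) holomorphic_on S - {disc_zero x}"
    using dz by (intro holomorphic_on_divide holomorphic_on_subset[OF hh] holomorphic_on_subset[OF weyl_den_holomorphic])
      (auto simp: S_def)
  moreover have "((\<lambda>u. h u / weyl_den u * (u - disc_zero x)) \<longlongrightarrow> of_real (poly p x * poly (T n) x * mass x)) (at (disc_zero x))"
  proof -
    have dj: "djouk (disc_zero x) \<noteq> 0"
      using uz(1,2) djouk_alt[of "disc_zero x"] by (auto simp: one_plus_eq_0_iff)
    have mp: "mass x > 0" using assms by (intro mass_pos) (auto simp: zeros_def)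
    have D0: "D \<noteq> 0"
      using dj mp T_nonzero_at_zeros[OF assms] \<gamma>_pos[of m] by (simp add: D_def)
    have "((\<lambda>u. (weyl_den u - weyl_den (disc_zero x)) / (u - disc_zero x)) \<longlongrightarrow> D) (at (disc_zero x))"
      using weyl_den_has_derivative_disc_zero[OF assms] unfolding D_def[symmetric] by (simp only: has_field_derivative_iff)
    moreover have "(h \<longlongrightarrow> h (disc_zero x)) (at (disc_zero x))"
      using hh \<open>open S\<close> \<open>disc_zero x \<in> S\<close>
      by (meson continuous_on_eq_continuous_at holomorphic_on_imp_continuous_on isContD)
    ultimately have "((\<lambda>u. h u / ((weyl_den u - weyl_den (disc_zero x)) / (u - disc_zero x))) \<longlongrightarrow> h (disc_zero x) / D) (at (disc_zero x))"
      using D0 by (intro tendsto_divide)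
    moreover have "h (disc_zero x) / D = of_real (poly p x * poly (T n) x * mass x)"
    proof -
      have "h (disc_zero x) = of_real (poly p x * (poly (T n) x * (\<gamma> m / poly (T m) x))) * djouk (disc_zero x)"
        using uz(3,4) weyl_num_disc_zero[OF assms] by (simp add: h_def second_num_def)
      then show ?thesis
        using dj mp T_nonzero_at_zeros[OF assms] \<gamma>_pos[of m] unfolding D_def by (simp add: field_simps)
    qed
    moreover have "(\<lambda>u. h u / ((weyl_den u - weyl_den (disc_zero x)) / (u - disc_zero x))) = (\<lambda>u. h u / weyl_den u * (u - disc_zero x))"
      using uz(4) by (auto simp: field_simps)
    ultimately show ?thesis by simp
  qed
  ultimately have "residue (\<lambda>u. h u / weyl_den u) (disc_zero x) = of_real (poly p x * poly (T n) x * mass x)"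
    by (rule residue_simple')
  moreover have "(\<lambda>u. h u / weyl_den u) = (\<lambda>u. cpoly p (jouk u) * (second_num n u / weyl_den u) * djouk u)"
    by (rule ext) (simp add: h_def)
  ultimately show ?thesis by (simp only:)
qed

text \<open>Only the Casoratian survives in the imaginary part of the numerator times the
  conjugate denominator, since the polynomials are real.\<close>
lemma Im_theta_cis:
  assumes "0 < t" "t < pi"
  shows "Im (second_num n (cis t) / weyl_den (cis t)) = pi * (poly (T n) (cos t) * ac_density (cos t))"
proof -
  define x where "x = cos t"
  define g where "g = stieltjes \<alpha> (cis t)"
  define A where "A = (a (Suc m))\<^sup>2"
  define s where "s = poly (T (Suc m)) x"
  define q where "q = poly (T m) x"
  define v where "v = poly (V (Suc m)) x"
  define w where "w = poly (V m) x"
  have d0: "weyl_den (cis t) \<noteq> 0" by (rule weyl_den_cis_neq_0[OF assms])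
  have weyl_den: "weyl_den (cis t) = of_real s - of_real (A * q) * g"
    by (simp add: weyl_den_def jouk_cis s_def A_def q_def g_def x_def)
  have weyl_num: "weyl_num (cis t) = of_real v - of_real (A * w) * g"
    by (simp add: weyl_num_def jouk_cis v_def A_def w_def g_def x_def)
  have cas: "q * v - s * w = \<gamma> m"
  proof -
    have "complex_of_real (q * v - s * w) = of_real (\<gamma> m)"
      using casoratian[of m "of_real x"] by (simp add: s_def q_def v_def w_def)
    then show ?thesis by (simp only: of_real_eq_iff)
  qed
  have Ig: "Im g = sin (- pi * \<alpha>) * jacobi \<alpha> x"
    using Im_stieltjes_cis[OF assms] by (simp add: g_def x_def)
  have Inum: "Im (weyl_num (cis t) * cnj (weyl_den (cis t))) = A * \<gamma> m * Im g"
  proof -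
    have "Im (weyl_num (cis t) * cnj (weyl_den (cis t))) = A * (q * v - s * w) * Im g"
      unfolding weyl_num weyl_den by (simp add: algebra_simps)
    then show ?thesis by (simp only: cas)
  qed
  have cden: "cmod (weyl_den (cis t)) = cmod (of_real s - of_real (A * q * jacobi \<alpha> x) * cis (\<alpha> * pi))"
  proof -
    have "weyl_den (cis t) = cnj (of_real s - of_real (A * q * jacobi \<alpha> x) * cis (\<alpha> * pi))"
      unfolding weyl_den g_def stieltjes_cis[OF assms] by (simp add: x_def)
    then show ?thesis by (simp only: complex_mod_cnj)
  qed
  have "second_num n (cis t) / weyl_den (cis t) = of_real (poly (T n) x) * (weyl_num (cis t) / weyl_den (cis t)) - of_real (poly (V n) x)"
    using d0 by (simp add: second_num_def jouk_cis x_def diff_divide_distrib)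
  then have "Im (second_num n (cis t) / weyl_den (cis t)) = poly (T n) x * Im (weyl_num (cis t) / weyl_den (cis t))"
    by (simp del: times_divide_eq_right)
  also have "Im (weyl_num (cis t) / weyl_den (cis t)) = Im (weyl_num (cis t) * cnj (weyl_den (cis t))) / (cmod (weyl_den (cis t)))\<^sup>2"
    by (simp add: complex_div_cnj[of "weyl_num (cis t)"] flip: of_real_power)
  also have "\<dots> = pi * ac_density x"
    unfolding Inum Ig cden ac_density_def \<gamma>_Suc s_def q_def A_def by (simp add: mult_ac)
  finally show ?thesis by (simp add: x_def)
qed

text \<open>The boundary integral is the absolutely continuous part, the residues at the zeros
  of the denominator are the point masses, and the residue at infinity is the value of the inner
  product.\<close>
lemma orthogonality_aux:
  assumes "j \<le> n"
  defines "y \<equiv> \<lambda>x. pi * (poly (T j) x * poly (T n) x * ac_density x)"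
  shows "y absolutely_integrable_on {-1<..<1}"
    and "integral {-1<..<1} y
       = pi * ((if j = n then \<gamma> n else 0) - (\<Sum>x\<in>zeros. poly (T j) x * poly (T n) x * mass x))"
proof -
  define Y where "Y = (\<lambda>u. cpoly (T j) (jouk u) * (second_num n u / weyl_den u))"
  define S where "S = insert 0 (disc_zero ` zeros)"
  define P1 where "P1 = T j * (T n * V (Suc m) - V n * T (Suc m))"
  define P2 where "P2 = smult ((a (Suc m))\<^sup>2) (T j * (T n * V m - V n * T m))"
  obtain \<rho> c where \<rho>: "\<rho> < 1" "c > 0" "\<And>u. \<rho> \<le> cmod u \<Longrightarrow> cmod u < 1 \<Longrightarrow> c \<le> cmod (weyl_den u)"
    using weyl_den_lower_bound by blast
  obtain B1 where B1: "B1 \<ge> 0" "\<And>u. 1/2 \<le> cmod u \<Longrightarrow> cmod u \<le> 1 \<Longrightarrow> cmod (cpoly P1 (jouk u)) \<le> B1"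
    using cpoly_jouk_bounded by blast
  obtain B2 where B2: "B2 \<ge> 0" "\<And>u. 1/2 \<le> cmod u \<Longrightarrow> cmod u \<le> 1 \<Longrightarrow> cmod (cpoly P2 (jouk u)) \<le> B2"
    using cpoly_jouk_bounded by blast
  have dz: "weyl_den u \<noteq> 0" if "u \<in> ball 0 1 - S" for u
    using that weyl_den_eq_0_iff[of u] by (auto simp: S_def)
  have S: "finite S" "S \<subseteq> ball 0 1" "0 \<in> S"
    using finite_zeros disc_zero(1) by (auto simp: S_def)
  have "Y holomorphic_on ball 0 1 - S"
    unfolding Y_def using dz
    by (intro holomorphic_on_mult holomorphic_on_divide cpoly_holomorphic jouk_holomorphic
        holomorphic_on_subset[OF second_num_holomorphic] holomorphic_on_subset[OF weyl_den_holomorphic]) (auto simp: S_def)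
  note holo = this
  have dz': "weyl_den u \<noteq> 0" if "u \<in> cball 0 1 - S - {1, -1}" for u
    using that dz[of u] weyl_den_circle_neq_0[of u] by (cases "cmod u = 1") auto
  have "continuous_on (cball 0 1 - S - {1, -1}) Y"
    unfolding Y_def second_num_def using dz'
    by (intro continuous_on_mult continuous_on_divide continuous_on_diff cpoly_continuous_on jouk_continuous_on
        continuous_on_subset[OF weyl_num_continuous_on] continuous_on_subset[OF weyl_den_continuous_on]) (auto simp: S_def)
  note cont = this
  have sym: "Y (cnj u) = cnj (Y u)" if "u \<in> ball 0 1 - S" for u
  proof -
    have "cmod u \<le> 1" "u \<noteq> 1" "u \<noteq> -1" using that by auto
    then show ?thesis by (simp add: Y_def second_num_def jouk_cnj weyl_den_cnj weyl_num_cnj)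
  qed
  define C where "C = (B1 + B2) / c"
  have bound: "cmod (Y u) \<le> C * (1 + cmod (stieltjes \<alpha> u))"
    if "max \<rho> (1/2) \<le> cmod u" "u \<in> ball 0 1 - S" for u
  proof -
    have u: "\<rho> \<le> cmod u" "1/2 \<le> cmod u" "cmod u < 1" using that by auto
    have "cpoly (T j) (jouk u) * second_num n u = cpoly P1 (jouk u) - cpoly P2 (jouk u) * stieltjes \<alpha> u"
      unfolding second_num_def weyl_num_def weyl_den_def P1_def P2_def by (simp add: algebra_simps)
    then have "cmod (cpoly (T j) (jouk u) * second_num n u) \<le> cmod (cpoly P1 (jouk u)) + cmod (cpoly P2 (jouk u)) * cmod (stieltjes \<alpha> u)"
      by (metis norm_triangle_ineq4 norm_mult)
    also have "\<dots> \<le> B1 + B2 * cmod (stieltjes \<alpha> u)"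
      using u B1 B2 by (intro add_mono mult_right_mono) auto
    also have "\<dots> \<le> (B1 + B2) * (1 + cmod (stieltjes \<alpha> u))"
      using B1(1) B2(1) by (simp add: distrib_left distrib_right)
    finally have 1: "cmod (cpoly (T j) (jouk u) * second_num n u) \<le> (B1 + B2) * (1 + cmod (stieltjes \<alpha> u))" .
    have "Y u = cpoly (T j) (jouk u) * second_num n u / weyl_den u" by (simp add: Y_def)
    then have "cmod (Y u) = cmod (cpoly (T j) (jouk u) * second_num n u) / cmod (weyl_den u)" by (simp only: norm_divide)
    also have "\<dots> \<le> (B1 + B2) * (1 + cmod (stieltjes \<alpha> u)) / c"
      using 1 \<rho>(2) \<rho>(3)[OF u(1,3)] B1(1) B2(1) by (intro frac_le) auto
    finally show ?thesis by (simp add: C_def)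
  qed
  have im: "Im (Y (cis t)) = y (cos t)" if "0 < t" "t < pi" for t
  proof -
    have "Y (cis t) = of_real (poly (T j) (cos t)) * (second_num n (cis t) / weyl_den (cis t))"
      by (simp only: Y_def jouk_cis cpoly_of_real)
    then have "Im (Y (cis t)) = poly (T j) (cos t) * Im (second_num n (cis t) / weyl_den (cis t))"
      by (simp del: times_divide_eq_right)
    then show ?thesis unfolding Im_theta_cis[OF that] by (simp add: y_def)
  qed
  have mx: "max \<rho> (1/2) < 1" using \<rho>(1) by simp
  note br = boundary_residues[where Y=Y and y=y, OF alpha S holo cont sym mx bound im]
  show "y absolutely_integrable_on {-1<..<1}" by (rule br(1))
  have r0: "residue (\<lambda>u. Y u * djouk u) 0 = - of_real (if j = n then \<gamma> n else 0)"
  proof (rule residue_at_0[of "ball 0 1 - disc_zero ` zeros"])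
    show "open (ball 0 1 - disc_zero ` zeros)" using finite_zeros by (intro open_Diff finite_imp_closed) auto
    show "0 \<in> ball 0 1 - disc_zero ` zeros" using disc_zero(2) by force
    show "Y holomorphic_on ball 0 1 - disc_zero ` zeros - {0}"
      using holo by (rule holomorphic_on_subset) (auto simp: S_def)
    have lim: "((\<lambda>u. (cpoly (T j) (jouk u) / jouk u ^ j) * (jouk u ^ Suc n * (second_num n u / weyl_den u)) * (1 / jouk u) ^ (n - j))
        \<longlongrightarrow> 1 * of_real (\<gamma> n) * 0 ^ (n - j)) (at 0)"
      by (intro tendsto_mult tendsto_power ttr_poly_jouk_tendsto theta_limit inverse_jouk_tendsto)
    have val: "1 * of_real (\<gamma> n) * 0 ^ (n - j) = complex_of_real (if j = n then \<gamma> n else 0)"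
      using assms(1) by (simp add: power_0_left)
    have ev: "eventually (\<lambda>u. (cpoly (T j) (jouk u) / jouk u ^ j) * (jouk u ^ Suc n * (second_num n u / weyl_den u)) * (1 / jouk u) ^ (n - j)
        = jouk u * Y u) (at 0)"
      using eventually_jouk_neq_0
    proof eventually_elim
      case (elim u)
      have e: "z ^ Suc n = z * z ^ j * z ^ (n - j)" for z :: complex
        using assms(1) by (simp flip: power_add)
      have "(p / z ^ j) * (z ^ Suc n * s) * (1 / z) ^ (n - j) = z * (p * s)" if "z \<noteq> 0" for p z s :: complex
        unfolding e using that by (simp add: power_divide)
      from this[OF elim] show ?case by (simp only: Y_def)
    qed
    show "((\<lambda>u. jouk u * Y u) \<longlongrightarrow> of_real (if j = n then \<gamma> n else 0)) (at 0)"
      using Lim_transform_eventually[OF lim ev] unfolding val .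
  qed
  have "(\<Sum>p\<in>S. residue (\<lambda>u. Y u * djouk u) p)
      = residue (\<lambda>u. Y u * djouk u) 0 + (\<Sum>p\<in>disc_zero ` zeros. residue (\<lambda>u. Y u * djouk u) p)"
  proof -
    have "0 \<notin> disc_zero ` zeros" using disc_zero(2) by (metis imageE)
    then show ?thesis unfolding S_def using finite_zeros by simp
  qed
  also have "(\<Sum>p\<in>disc_zero ` zeros. residue (\<lambda>u. Y u * djouk u) p) = (\<Sum>x\<in>zeros. residue (\<lambda>u. Y u * djouk u) (disc_zero x))"
    using inj_on_disc_zero by (simp add: sum.reindex)
  also have "\<dots> = (\<Sum>x\<in>zeros. of_real (poly (T j) x * poly (T n) x * mass x))"
    unfolding Y_def by (intro sum.cong refl residue_disc_zero)
  finally have ss: "(\<Sum>p\<in>S. residue (\<lambda>u. Y u * djouk u) p)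
      = of_real ((\<Sum>x\<in>zeros. poly (T j) x * poly (T n) x * mass x) - (if j = n then \<gamma> n else 0))"
    unfolding r0 by simp
  have neg: "- pi * (M - g) = pi * (g - M)" for M g
    by (simp add: algebra_simps)
  have "complex_of_real (integral {-1<..<1} y)
      = of_real (- pi * ((\<Sum>x\<in>zeros. poly (T j) x * poly (T n) x * mass x) - (if j = n then \<gamma> n else 0)))"
    using br(2) unfolding ss of_real_mult by (simp only: of_real_minus)
  then have "complex_of_real (integral {-1<..<1} y)
      = of_real (pi * ((if j = n then \<gamma> n else 0) - (\<Sum>x\<in>zeros. poly (T j) x * poly (T n) x * mass x)))"
    unfolding neg .
  then show "integral {-1<..<1} y
       = pi * ((if j = n then \<gamma> n else 0) - (\<Sum>x\<in>zeros. poly (T j) x * poly (T n) x * mass x))"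
    by (rule of_real_eq_iff[THEN iffD1])
qed

lemma measurable_ac_density [measurable]: "ac_density \<in> borel_measurable borel"
  unfolding ac_density_def[abs_def] by measurable

lemma ac_density_nonneg: "ac_density x \<ge> 0"
proof -
  have "0 \<le> sin (- pi * \<alpha>) / pi" using sin_alpha_pos by (intro divide_nonneg_pos less_imp_le pi_gt_zero)
  then have "0 \<le> sin (- pi * \<alpha>) / pi * jacobi \<alpha> x * \<gamma> (Suc m)"
    by (rule mult_nonneg_nonneg[OF mult_nonneg_nonneg[OF _ jacobi_nonneg] less_imp_le[OF \<gamma>_pos]])
  then show ?thesis
    unfolding ac_density_def by (rule divide_nonneg_nonneg) (rule zero_le_power2)
qed

theorem orthogonality:
  shows "set_integrable lborel {-1<..<1} (\<lambda>x. poly (T j) x * poly (T n) x * ac_density x)"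
    and "(LINT x:{-1<..<1}|lborel. poly (T j) x * poly (T n) x * ac_density x)
        + (\<Sum>x\<in>zeros. poly (T j) x * poly (T n) x * mass x) = (if j = n then \<gamma> n else 0)"
proof -
  have *: "set_integrable lborel {-1<..<1} (\<lambda>x. poly (T j) x * poly (T n) x * ac_density x) \<and>
    (LINT x:{-1<..<1}|lborel. poly (T j) x * poly (T n) x * ac_density x)
        + (\<Sum>x\<in>zeros. poly (T j) x * poly (T n) x * mass x) = (if j = n then \<gamma> n else 0)"
    if "j \<le> n" for j n
  proof -
    define y where "y = (\<lambda>x. pi * (poly (T j) x * poly (T n) x * ac_density x))"
    have ym: "y \<in> borel_measurable borel" unfolding y_def by measurable
    note o = orthogonality_aux[OF that, folded y_def]
    note l = set_integral_eq_integral[OF o(1) ym]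
    have y: "(\<lambda>x. poly (T j) x * poly (T n) x * ac_density x) = (\<lambda>x. (1 / pi) * y x)" by (simp add: y_def)
    have "set_integrable lborel {-1<..<1} (\<lambda>x. (1 / pi) * y x)"
      using l(1) by (intro set_integrable_mult_right) simp
    moreover have "(LINT x:{-1<..<1}|lborel. (1 / pi) * y x) = (1 / pi) * integral {-1<..<1} y"
      using l(2) by simp
    ultimately show ?thesis unfolding y o(2) by simp
  qed
  have comm: "poly (T n) x * poly (T j) x * c = poly (T j) x * poly (T n) x * c" for x c
    by (simp only: mult.commute)
  have "set_integrable lborel {-1<..<1} (\<lambda>x. poly (T j) x * poly (T n) x * ac_density x) \<and>
    (LINT x:{-1<..<1}|lborel. poly (T j) x * poly (T n) x * ac_density x)
        + (\<Sum>x\<in>zeros. poly (T j) x * poly (T n) x * mass x) = (if j = n then \<gamma> n else 0)"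
  proof (cases "j \<le> n")
    case False
    then show ?thesis using *[of n j] unfolding comm by auto
  qed (rule *)
  then show "set_integrable lborel {-1<..<1} (\<lambda>x. poly (T j) x * poly (T n) x * ac_density x)"
    "(LINT x:{-1<..<1}|lborel. poly (T j) x * poly (T n) x * ac_density x)
        + (\<Sum>x\<in>zeros. poly (T j) x * poly (T n) x * mass x) = (if j = n then \<gamma> n else 0)"
    by (blast, blast)
qed

end

section \<open>Sums of measures\<close>

definition add_measure :: "'a measure \<Rightarrow> 'a measure \<Rightarrow> 'a measure" where
  "add_measure M N = measure_of (space M) (sets M) (\<lambda>A. emeasure M A + emeasure N A)"

lemma sets_add_measure [simp, measurable_cong]: "sets (add_measure M N) = sets M"
  and space_add_measure [simp]: "space (add_measure M N) = space M"
  by (simp_all add: add_measure_def)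

lemma emeasure_add_measure:
  assumes "sets N = sets M" "A \<in> sets M"
  shows "emeasure (add_measure M N) A = emeasure M A + emeasure N A"
proof (rule emeasure_measure_of[OF add_measure_def])
  show "countably_additive (sets (add_measure M N)) (\<lambda>A. emeasure M A + emeasure N A)"
  proof (rule countably_additiveI)
    fix A :: "nat \<Rightarrow> _"
    assume A: "range A \<subseteq> sets (add_measure M N)" "disjoint_family A"
    have "(\<Sum>i. emeasure M (A i) + emeasure N (A i)) = (\<Sum>i. emeasure M (A i)) + (\<Sum>i. emeasure N (A i))"
      by (rule suminf_add[symmetric]) (rule summableI)+
    also have "\<dots> = emeasure M (\<Union>i. A i) + emeasure N (\<Union>i. A i)"
      using A assms(1) by (simp add: suminf_emeasure)
    finally show "(\<Sum>i. emeasure M (A i) + emeasure N (A i)) = emeasure M (\<Union>i. A i) + emeasure N (\<Union>i. A i)" .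
  qed
qed (use assms sets.space_closed[of M] in \<open>auto simp: positive_def\<close>)

lemma nn_integral_add_measure:
  assumes N: "sets N = sets M" and f: "f \<in> borel_measurable M"
  shows "(\<integral>\<^sup>+x. f x \<partial>add_measure M N) = (\<integral>\<^sup>+x. f x \<partial>M) + (\<integral>\<^sup>+x. f x \<partial>N)"
proof -
  have meas: "w \<in> borel_measurable K" if "sets K = sets M" "w \<in> borel_measurable M" for w :: "_ \<Rightarrow> ennreal" and K
    using that(2) by (subst measurable_cong_sets[OF that(1) refl])
  from f show ?thesis
  proof (induct rule: borel_measurable_induct)
    case (cong f g)
    have "(\<integral>\<^sup>+x. f x \<partial>K) = (\<integral>\<^sup>+x. g x \<partial>K)" if "space K = space M" for K
      using cong(3) that by (intro nn_integral_cong) simp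
    then show ?case using cong(4) sets_eq_imp_space_eq[OF N] by simp
  next
    case (set A)
    then show ?case using N by (simp add: emeasure_add_measure)
  next
    case (mult u c)
    have "(\<integral>\<^sup>+x. c * u x \<partial>K) = c * (\<integral>\<^sup>+x. u x \<partial>K)" if "sets K = sets M" for K
      by (intro nn_integral_cmult meas[OF that] mult(2))
    then show ?case using mult(4) N by (simp only: sets_add_measure distrib_left)
  next
    case (add u v)
    have "(\<integral>\<^sup>+x. v x + u x \<partial>K) = (\<integral>\<^sup>+x. v x \<partial>K) + (\<integral>\<^sup>+x. u x \<partial>K)" if "sets K = sets M" for K
      by (intro nn_integral_add meas[OF that] add(1,4))
    then show ?case using add(3,7) N by (simp only: sets_add_measure add_ac)
  next
    case (seq U)
    have mono: "incseq (\<lambda>i. \<integral>\<^sup>+x. U i x \<partial>K)" for K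
      using seq(4) by (intro incseq_SucI nn_integral_mono) (auto simp: incseq_Suc_iff le_fun_def)
    have S: "(\<integral>\<^sup>+x. (SUP i. U i) x \<partial>K) = (SUP i. \<integral>\<^sup>+x. U i x \<partial>K)"
      if "sets K = sets M" for K
      unfolding SUP_apply
      by (intro nn_integral_monotone_convergence_SUP seq(4) meas[OF that] seq(1))
    show ?case
      unfolding S[OF refl] S[OF N] S[OF sets_add_measure] seq(3)
      by (rule ennreal_SUP_add[OF mono mono])
  qed
qed

lemma integral_add_measure:
  fixes f :: "'a \<Rightarrow> real"
  assumes N: "sets N = sets M" and f: "integrable M f" "integrable N f"
  shows "integrable (add_measure M N) f"
    and "(LINT x|add_measure M N. f x) = (LINT x|M. f x) + (LINT x|N. f x)"
proof -
  have m: "f \<in> borel_measurable M" using f(1) by auto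
  then have m': "f \<in> borel_measurable (add_measure M N)" by (auto cong: measurable_cong_sets)
  have nn: "(\<integral>\<^sup>+x. ennreal (g x) \<partial>add_measure M N) = (\<integral>\<^sup>+x. ennreal (g x) \<partial>M) + (\<integral>\<^sup>+x. ennreal (g x) \<partial>N)"
    if "g \<in> borel_measurable M" for g :: "'a \<Rightarrow> real"
    using that by (intro nn_integral_add_measure N) auto
  have "(\<integral>\<^sup>+x. ennreal (norm (f x)) \<partial>add_measure M N) < \<infinity>"
    using f m by (subst nn) (auto simp: integrable_iff_bounded)
  then show int: "integrable (add_measure M N) f"
    using m' by (simp add: integrable_iff_bounded)
  have fin: "(\<integral>\<^sup>+x. ennreal (f x) \<partial>K) < \<top>" "(\<integral>\<^sup>+x. ennreal (- f x) \<partial>K) < \<top>" if "integrable K f" for K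
    using that by (auto simp: real_integrable_def top.not_eq_extremum)
  have m2: "(\<lambda>x. - f x) \<in> borel_measurable M" using m by simp
  show "(LINT x|add_measure M N. f x) = (LINT x|M. f x) + (LINT x|N. f x)"
    unfolding real_lebesgue_integral_def[OF int] real_lebesgue_integral_def[OF f(1)]
      real_lebesgue_integral_def[OF f(2)] nn[OF m] nn[OF m2]
    using fin[OF f(1)] fin[OF f(2)] by (simp add: enn2real_plus)
qed

context antiassociation begin

section \<open>The spectral measure\<close>

definition ac_part :: "real measure" where
  "ac_part = density lborel (\<lambda>x. ennreal (ac_density x * indicator {-1<..<1} x))"

definition pp_part :: "real measure" where
  "pp_part = distr (point_measure zeros (\<lambda>x. ennreal (mass x))) borel (\<lambda>x. x)"

definition spectral :: "real measure" where "spectral = add_measure ac_part pp_part"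

lemma sets_parts [simp]: "sets ac_part = sets borel" "sets pp_part = sets borel" "sets spectral = sets borel"
  by (simp_all add: ac_part_def pp_part_def spectral_def)

lemma space_spectral [simp]: "space spectral = UNIV"
  using sets_eq_imp_space_eq[of spectral borel] by simp

lemma emeasure_ac_part:
  "A \<in> sets borel \<Longrightarrow> emeasure ac_part A = (\<integral>\<^sup>+x\<in>A \<inter> {-1<..<1}. ennreal (ac_density x) \<partial>lborel)"
  unfolding ac_part_def
  by (subst emeasure_density) (auto intro!: nn_integral_cong simp: indicator_def)

lemma emeasure_pp_part:
  assumes "A \<in> sets borel"
  shows "emeasure pp_part A = (\<Sum>x\<in>zeros \<inter> A. ennreal (mass x))"
proof -
  have "emeasure pp_part A = emeasure (point_measure zeros (\<lambda>x. ennreal (mass x))) (zeros \<inter> A)"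
    unfolding pp_part_def
    by (subst emeasure_distr) (use assms in \<open>auto simp: space_point_measure measurable_def sets_point_measure intro!: arg_cong2[where f=emeasure]\<close>)
  also have "\<dots> = (\<Sum>x\<in>zeros \<inter> A. ennreal (mass x))"
    using finite_zeros by (intro emeasure_point_measure_finite2) auto
  finally show ?thesis .
qed

lemma emeasure_spectral:
  assumes "A \<in> sets borel"
  shows "emeasure spectral A
     = (\<integral>\<^sup>+x\<in>A \<inter> {-1<..<1}. ennreal (ac_density x) \<partial>lborel) + (\<Sum>x\<in>zeros \<inter> A. ennreal (mass x))"
  unfolding spectral_def using assms
  by (subst emeasure_add_measure) (simp_all add: emeasure_ac_part emeasure_pp_part)

lemma spectral_orthogonality:
  shows "integrable spectral (\<lambda>x. poly (T j) x * poly (T n) x)"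
    and "(LINT x|spectral. poly (T j) x * poly (T n) x) = (if j = n then \<gamma> n else 0)"
proof -
  define f where "f = (\<lambda>x. poly (T j) x * poly (T n) x)"
  have fm: "f \<in> borel_measurable borel" unfolding f_def by measurable
  have fml: "f \<in> borel_measurable lborel" using fm by simp
  have dens: "(\<lambda>x. ac_density x * indicator {-1<..<1} x) \<in> borel_measurable lborel" by measurable
  have nonneg: "AE x in lborel. 0 \<le> ac_density x * indicator {-1<..<1} x"
    using ac_density_nonneg by (intro AE_I2 mult_nonneg_nonneg) auto
  have eq: "(\<lambda>x. (ac_density x * indicator {-1<..<1} x) *\<^sub>R f x)
      = (\<lambda>x. indicator {-1<..<1} x *\<^sub>R (poly (T j) x * poly (T n) x * ac_density x))"
    by (rule ext) (simp add: f_def)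
  have i1: "integrable ac_part f"
    using orthogonality(1)[of j n]
    unfolding ac_part_def integrable_density[OF fml dens nonneg] eq set_integrable_def .
  have v1: "(LINT x|ac_part. f x) = (LINT x:{-1<..<1}|lborel. poly (T j) x * poly (T n) x * ac_density x)"
    unfolding ac_part_def integral_density[OF fml dens nonneg] eq set_lebesgue_integral_def ..
  have mp: "mass x \<ge> 0" if "x \<in> zeros" for x
    using mass_pos[of x] that by (auto simp: zeros_def)
  have id: "(\<lambda>x. x) \<in> measurable (point_measure zeros (\<lambda>x. ennreal (mass x))) borel"
    by (simp add: measurable_def space_point_measure sets_point_measure)
  have i2: "integrable pp_part f"
    unfolding pp_part_def integrable_distr_eq[OF id fm]
    using finite_zeros by (rule integrable_point_measure_finite)
  have v2: "(LINT x|pp_part. f x) = (\<Sum>x\<in>zeros. poly (T j) x * poly (T n) x * mass x)"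
  proof -
    have "(LINT x|pp_part. f x) = (\<Sum>x\<in>zeros. mass x * f x)"
      unfolding pp_part_def integral_distr[OF id fm] real_scaleR_def[symmetric]
      by (rule lebesgue_integral_point_measure_finite[OF finite_zeros mp])
    then show ?thesis by (simp only: f_def mult.commute)
  qed
  show "integrable spectral (\<lambda>x. poly (T j) x * poly (T n) x)"
    using integral_add_measure(1)[OF _ i1 i2] by (simp add: spectral_def f_def)
  have "(LINT x|spectral. f x) = (LINT x|ac_part. f x) + (LINT x|pp_part. f x)"
    unfolding spectral_def by (rule integral_add_measure(2)[OF _ i1 i2]) simp
  then show "(LINT x|spectral. poly (T j) x * poly (T n) x) = (if j = n then \<gamma> n else 0)"
    using orthogonality(2)[of j n] unfolding v1 v2 by (simp add: f_def)
qed

text \<open>The total mass is the squared norm of the constant polynomial 1.\<close>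
lemma prob_space_spectral: "prob_space spectral"
proof (rule prob_spaceI)
  have i: "integrable spectral (\<lambda>x. 1 :: real)" and v: "(LINT x|spectral. 1) = (1::real)"
    using spectral_orthogonality[of 0 0] by (simp_all add: \<gamma>_def)
  have "emeasure spectral (space spectral) < \<infinity>"
    using i integrable_iff_bounded[of spectral "\<lambda>x. 1 :: real"] by simp
  moreover have "measure spectral (space spectral) = 1" using v by simp
  ultimately show "emeasure spectral (space spectral) = 1"
    by (simp add: emeasure_eq_ennreal_measure top.not_eq_extremum)
qed

lemma mass_points_spectral: "mass_points spectral - {-1..1} = zeros"
proof -
  have "emeasure spectral {x} > 0 \<longleftrightarrow> x \<in> zeros" if "x \<notin> {-1..1}" for x
  proof -
    have "{x} \<inter> {-1<..<1} = {}" using that by auto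
    then have "emeasure spectral {x} = (\<Sum>y\<in>zeros \<inter> {x}. ennreal (mass y))"
      by (subst emeasure_spectral) simp_all
    moreover have "zeros \<inter> {x} = (if x \<in> zeros then {x} else {})" by auto
    ultimately show ?thesis using mass_pos[OF that] by simp
  qed
  moreover have "zeros \<inter> {-1..1} = {}" by (auto simp: zeros_def)
  ultimately show ?thesis unfolding mass_points_def by blast
qed

lemma spectral_outside_null: "emeasure spectral (- {-1..1} - zeros) = 0"
proof -
  have "zeros \<in> sets borel" using finite_zeros by (intro borel_closed finite_imp_closed)
  then have b: "- {-1..1} - zeros \<in> sets borel" by (intro sets.Diff) auto
  have "(- {-1..1} - zeros) \<inter> {-1<..<1} = {}" "zeros \<inter> (- {-1..1} - zeros) = {}" by auto
  then show ?thesis unfolding emeasure_spectral[OF b] by simp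
qed

lemma spectral_inside:
  assumes "A \<in> sets borel" "A \<subseteq> {-1..1}"
  shows "emeasure spectral A = (\<integral>\<^sup>+x\<in>A \<inter> {-1<..<1}. ennreal (ac_density x) \<partial>lborel)"
proof -
  have "zeros \<inter> A = {}" using assms(2) by (auto simp: zeros_def)
  then show ?thesis unfolding emeasure_spectral[OF assms(1)] by simp
qed

lemma card_zeros: "card zeros \<le> 2 * Suc m"
proof -
  have "card zeros \<le> card (zeros \<inter> {..<-1}) + card (zeros \<inter> {1<..})"
    by (subst (1) zeros_split) (rule card_Un_le)
  also have "\<dots> \<le> Suc m + Suc m" by (rule add_mono[OF zeros_left(2) zeros_right(2)])
  finally show ?thesis by (simp only: mult_2)
qed

end

section \<open>Anti-associated Grosjean polynomials\<close>

theorem theorem1: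
  fixes \<alpha> :: real and r :: nat and G :: "nat \<Rightarrow> real poly" and b a :: "int \<Rightarrow> real"
  assumes "-1 < \<alpha>" and "\<alpha> < 0" and "r \<ge> 1"
    and "grosjean_polys \<alpha> G"
    and "recurrence_coeffs G (\<lambda>n. b (int n)) (\<lambda>n. a (int n))"
    and "\<And>j. - int r < j \<Longrightarrow> j \<le> 0 \<Longrightarrow> a j > 0"
  shows "\<exists>\<mu> :: real measure.
    prob_space \<mu> \<and> sets \<mu> = sets borel \<and>
    orthonormal_polys \<mu> (antiassoc_orthonormal b a r) \<and>
    (\<forall>A\<in>sets borel. A \<subseteq> {-1..1} \<longrightarrow>
       emeasure \<mu> A = (\<integral>\<^sup>+x\<in>A \<inter> {-1<..<1}. ennreal (antiassoc_weight \<alpha> b a r x) \<partial>lborel)) \<and>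
    (let D = mass_points \<mu> - {-1..1} in
       emeasure \<mu> (- {-1..1} - D) = 0 \<and>
       finite D \<and> card D \<le> 2 * r \<and>
       card (D \<inter> {..<-1}) \<le> r \<and> card (D \<inter> {1<..}) \<le> r \<and>
       D = {x. x \<notin> {-1..1} \<and>
              poly (antiassoc_orthonormal b a r r) x
              - a 0 * poly (antiassoc_orthonormal b a r (r - 1)) x * sgn x
                * (\<bar>x - 1\<bar> powr \<alpha> / \<bar>x + 1\<bar> powr (\<alpha> + 1)) = 0})"
proof -
  define m where "m = r - 1"
  have r: "r = Suc m" using \<open>r \<ge> 1\<close> by (simp add: m_def)
  (* The coefficients of the anti-associated family, indexed from 0. *)
  define B where "B = (\<lambda>k. b (int k - int r))"
  define A where "A = (\<lambda>k. a (int k - int r))"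
  have A_pos: "A k > 0" if "k \<ge> 1" for k
  proof (cases "k \<le> r")
    case True
    then show ?thesis unfolding A_def using assms(6)[of "int k - int r"] that by simp
  next
    case False
    then have "int k - int r = int (k - r)" "k - r \<ge> 1" by (auto simp: of_nat_diff)
    then show ?thesis using assms(5) unfolding A_def recurrence_coeffs_def by metis
  qed
  interpret antiassociation \<alpha> B A m
  proof
    have "(\<lambda>k. B (k + Suc m)) = (\<lambda>k. b (int k))" "(\<lambda>k. A (k + Suc m)) = (\<lambda>k. a (int k))"
      by (simp_all add: B_def A_def r)
    moreover have "G = ttr_poly (\<lambda>k. b (int k)) (\<lambda>k. a (int k))"
      using assms(5) by (auto simp: recurrence_coeffs_def)
    ultimately show "grosjean_polys \<alpha> (ttr_poly (\<lambda>k. B (k + Suc m)) (\<lambda>k. A (k + Suc m)))"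
      using assms(4) by simp
  qed (use assms(1,2) A_pos in auto)
  define \<pi> where "\<pi> = (\<lambda>n. \<Prod>k=1..n. A k)"
  have \<pi>_pos: "\<pi> n > 0" for n unfolding \<pi>_def using A_pos by (intro prod_pos) simp
  have \<pi>_sq: "(\<pi> n)\<^sup>2 = \<gamma> n" for n by (simp add: \<pi>_def \<gamma>_def prod_power_distrib)
  have \<pi>_r: "\<pi> (Suc m) = \<pi> m * A (Suc m)" by (simp add: \<pi>_def)
  have A_r: "A (Suc m) = a 0" by (simp add: A_def r)
  have q: "antiassoc_orthonormal b a r n = smult (1 / \<pi> n) (T n)" for n
    by (simp add: antiassoc_orthonormal_def antiassoc_def \<pi>_def A_def B_def)
  have pq: "poly (antiassoc_orthonormal b a r n) x = poly (T n) x / \<pi> n" for n x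
    by (simp add: q)
  have qr: "poly (antiassoc_orthonormal b a r r) x = poly (T (Suc m)) x / \<pi> (Suc m)" for x
    by (simp only: pq r[symmetric])
  have a0q: "a 0 * poly (antiassoc_orthonormal b a r (r - 1)) x = (A (Suc m))\<^sup>2 * poly (T m) x / \<pi> (Suc m)" for x
  proof -
    have "c * (t / p) = c\<^sup>2 * t / (p * c)" if "c > 0" for c t p :: real
      using that by (simp add: power2_eq_square)
    from this[of "A (Suc m)" "poly (T m) x" "\<pi> m"]
    have "A (Suc m) * (poly (T m) x / \<pi> m) = (A (Suc m))\<^sup>2 * poly (T m) x / \<pi> (Suc m)"
      unfolding \<pi>_r using A_pos by simp
    moreover have "r - 1 = m" by (simp add: r)
    ultimately show ?thesis by (simp only: pq A_r)
  qed
  have weight: "antiassoc_weight \<alpha> b a r x = ac_density x" for x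
  proof -
    define z where "z = of_real (poly (T (Suc m)) x) - of_real ((A (Suc m))\<^sup>2 * poly (T m) x * jacobi \<alpha> x) * cis (\<alpha> * pi)"
    have "of_real (poly (antiassoc_orthonormal b a r r) x)
        - of_real (a 0) * exp (\<i> * of_real (\<alpha> * pi)) * of_real (poly (antiassoc_orthonormal b a r (r - 1)) x) * of_real (jacobi \<alpha> x)
       = of_real (poly (antiassoc_orthonormal b a r r) x)
        - of_real (a 0 * poly (antiassoc_orthonormal b a r (r - 1)) x) * of_real (jacobi \<alpha> x) * cis (\<alpha> * pi)"
      by (simp only: cis_conv_exp of_real_mult mult_ac)
    also have "\<dots> = z / of_real (\<pi> (Suc m))"
    proof -
      have "of_real (p / s) - of_real (q / s) * of_real g * c = (of_real p - of_real (q * g) * c) / of_real s"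
        for p q s g :: real and c :: complex
        by (simp add: diff_divide_distrib)
      then show ?thesis unfolding a0q qr z_def .
    qed
    finally have "cmod (of_real (poly (antiassoc_orthonormal b a r r) x)
        - of_real (a 0) * exp (\<i> * of_real (\<alpha> * pi)) * of_real (poly (antiassoc_orthonormal b a r (r - 1)) x) * of_real (jacobi \<alpha> x))
       = cmod z / \<pi> (Suc m)"
      using \<pi>_pos[of "Suc m"] by (simp only: norm_divide norm_of_real abs_of_pos)
    then have "antiassoc_weight \<alpha> b a r x = sin (- pi * \<alpha>) / pi * jacobi \<alpha> x / (cmod z / \<pi> (Suc m))\<^sup>2"
      unfolding antiassoc_weight_def Let_def jacobi_def[symmetric] by (simp only:)
    also have "\<dots> = ac_density x"
    proof -
      have "c / (w / g) = c * g / w" for c w g :: real by simp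
      then show ?thesis unfolding ac_density_def z_def[symmetric] power_divide \<pi>_sq .
    qed
    finally show ?thesis .
  qed
  have zeros_eq: "zeros = {x. x \<notin> {-1..1} \<and>
      poly (antiassoc_orthonormal b a r r) x - a 0 * poly (antiassoc_orthonormal b a r (r - 1)) x * sgn x
        * (\<bar>x - 1\<bar> powr \<alpha> / \<bar>x + 1\<bar> powr (\<alpha> + 1)) = 0}"
  proof -
    have "poly (antiassoc_orthonormal b a r r) x - a 0 * poly (antiassoc_orthonormal b a r (r - 1)) x * sgn x
        * (\<bar>x - 1\<bar> powr \<alpha> / \<bar>x + 1\<bar> powr (\<alpha> + 1)) = weyl_den_real x / \<pi> (Suc m)" for x
    proof -
      have "p / s - q / s * h * g = (p - q * (h * g)) / s" for p q s h g :: real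
        by (simp add: diff_divide_distrib)
      then show ?thesis unfolding a0q qr weyl_den_real_def stieltjes_real_def .
    qed
    then show ?thesis
      using \<pi>_pos[of "Suc m"] unfolding zeros_def by (simp only: divide_eq_0_iff less_imp_neq[THEN not_sym] simp_thms)
  qed
  have orth: "orthonormal_polys spectral (antiassoc_orthonormal b a r)"
  proof -
    have pp: "(\<lambda>x. poly (antiassoc_orthonormal b a r i) x * poly (antiassoc_orthonormal b a r j) x)
        = (\<lambda>x. 1 / (\<pi> i * \<pi> j) * (poly (T i) x * poly (T j) x))" for i j
      by (rule ext) (simp add: pq)
    show ?thesis
      unfolding orthonormal_polys_def orthogonal_polys_def pp
    proof (intro conjI allI impI)
      show "integrable spectral (\<lambda>x. 1 / (\<pi> i * \<pi> j) * (poly (T i) x * poly (T j) x))" for i j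
        by (intro integrable_mult_right spectral_orthogonality(1))
      show "(LINT x|spectral. 1 / (\<pi> i * \<pi> j) * (poly (T i) x * poly (T j) x)) = 0" if "i \<noteq> j" for i j
        using that spectral_orthogonality(2)[of i j] by (subst integral_mult_right_zero) simp
      show "(LINT x|spectral. 1 / (\<pi> n * \<pi> n) * (poly (T n) x * poly (T n) x)) = 1" for n
        using spectral_orthogonality(2)[of n n] \<pi>_sq[of n] \<gamma>_pos[of n]
        by (subst integral_mult_right_zero) (simp add: power2_eq_square)
    qed
  qed
  show ?thesis
  proof (rule exI[of _ spectral], unfold Let_def mass_points_spectral weight, intro conjI ballI impI)
    show "prob_space spectral" by (rule prob_space_spectral)
    show "sets spectral = sets borel" by (rule sets_parts)
    show "orthonormal_polys spectral (antiassoc_orthonormal b a r)" by (rule orth)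
    show "emeasure spectral A = (\<integral>\<^sup>+x\<in>A \<inter> {-1<..<1}. ennreal (ac_density x) \<partial>lborel)"
      if "A \<in> sets borel" "A \<subseteq> {-1..1}" for A
      using that by (rule spectral_inside)
    show "emeasure spectral (- {-1..1} - zeros) = 0" by (rule spectral_outside_null)
    show "finite zeros" by (rule finite_zeros)
    show "card zeros \<le> 2 * r" unfolding r by (rule card_zeros)
    show "card (zeros \<inter> {..<-1}) \<le> r" unfolding r by (rule zeros_left)
    show "card (zeros \<inter> {1<..}) \<le> r" unfolding r by (rule zeros_right)
    show "zeros = {x. x \<notin> {-1..1} \<and>
      poly (antiassoc_orthonormal b a r r) x - a 0 * poly (antiassoc_orthonormal b a r (r - 1)) x * sgn x
        * (\<bar>x - 1\<bar> powr \<alpha> / \<bar>x + 1\<bar> powr (\<alpha> + 1)) = 0}" by (rule zeros_eq)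
  qed
qed

end
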